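(* Let $N\ge1$, $\nu=N-1$, $m\ge1$. The average value $\Omega_m(N)=\omega_{m,N}(\mathbbm{h}_m)$ of the quantum $\mathfrak{gl}(N)$-weight system, identified with a symmetric polynomial in $x_1,\dots,x_N$ via the quantum Harish-Chandra isomorphism, equals $$\Omega_m(N)=\frac{m!}{(\nu+m)!}\,\frac{[\nu+m]_q!}{[m]_q!}\sum_{l=0}^{m}\frac{(\nu+m)_l}{q^{2l}\,l!}\;\beta_l^{(\nu+m-l,\nu)}\!\left(\frac\nu2\right)S_{m-l}(x_1,\dots,x_N).$$
   Context: Work over $\mathbb C(q)$. Conventions: $[a]_q=\frac{1-q^{-2a}}{1-q^{-2}}$, $[a]_q!=[1]_q\cdots[a]_q$; $(a)_b=a(a-1)\cdots(a-b+1)$ and $([a]_q)_b=[a]_q[a-1]_q\cdots[a-b+1]_q$. $S_j(x_1,\dots,x_N)=\sum_{1\le i_1\le\dots\le i_j\le N}x_{i_1}\cdots x_{i_j}$, $S_0=1$. The $q$-Bernoulli polynomial of order $k$ is $$\beta_l^{(h,k)}(\xi)=\frac1{(1-q^{-2})^l}\sum_{i=0}^l\binom li\frac{(i+h)_k}{([i+h]_q)_k}(-q^{-2\xi})^i .$$ **Hecke algebra.** $\mathbb H_m$ is the unital associative $\mathbb C(q)$-algebra with generators $g_1,\dots,g_{m-1}$ and relations $g_ig_j=g_jg_i$ ($|i-j|>1$), $g_ig_{i+1}g_i=g_{i+1}g_ig_{i+1}$, $g_i^2=1+(q-q^{-1})g_i$. The $q$-symmetrizer $\mathbbm{h}_m\in\mathbb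 H_m$ is the central idempotent given by $\mathbbm{h}_1=1$, $\mathbbm{h}_m=\frac1{[m]_q}\mathbbm{h}_{m-1}\big(q^{2-2m}+q^{-1}[m-1]_q\,g_{m-1}\big)\mathbbm{h}_{m-1}$ for $m\ge2$, where $\mathbb H_{m-1}\subset\mathbb H_m$. **$R$-matrix representation and $R$-trace.** Let $V=\mathbb C(q)^N$ and $$R=q\sum_iE_i^i\otimes E_i^i+\sum_{i\ne j}E_i^j\otimes E_j^i+(q-q^{-1})\sum_{i<j}E_i^i\otimes E_j^j\in\mathrm{End}(V\otimes V),$$ with $E_i^j$ the matrix units; $R_{i,i+1}$ is $R$ acting in tensor factors $i,i+1$. $\rho:\mathbb H_m\to\mathrm{End}(V^{\otimes m})$ is the representation $g_i\mapsto R_{i,i+1}$. With $D=\mathrm{diag}(q^{1-2N},q^{3-2N},\dots,q^{-1})$, set $\langle X\rangle_{k,n}=\mathrm{Tr}_{k,\dots,n}(D_k\cdots D_nX)$ (trace over tensor factors $k,\dots,n$; subscripts denote the tensor factor on which a matrix acts). **Reflection Equation algebra.** $\mathbb M(N)$ is the unital associative $\mathbb C(q)$-algebra generated by the entries $m_i^j$ of an $N\times N$ matrix $M$ subject to $R_{1,2}M_1R_{1,2}M_1=M_1R_{1,2}M_1R_{1,2}$. Put $L=\frac{1-M}{q-q^{-1}}$, and for a matrix $K$ over $\mathbb M(N)$ put $K_{\overline1}=K_1$, $K_{\overline i}=R_{i-1,i}K_{\overline{i-1}}R_{i-1,i}^{-1}$. The quantum $\mathfrak{gl}(N)$-weight system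 is $\omega_{m,N}:\mathbb H_m\to\mathbb M(N)$, $\omega_{m,N}(x)=\langle L_{\overline1}\cdots L_{\overline m}\,\rho(x)\rangle_{1,m}$; its values are known to lie in the center of $\mathbb M(N)$ and to be polynomials in the quantum power sums $p_k=\langle M_{\overline1}\cdots M_{\overline k}R_{k-1,k}R_{k-2,k-1}\cdots R_{1,2}\rangle_{1,k}$. **Quantum Harish-Chandra isomorphism.** It is known that the center of $\mathbb M(N)$ is identified with the symmetric polynomials in $\xi_1,\dots,\xi_N$ over $\mathbb C(q)$ by the algebra isomorphism determined by $$1+(q-q^{-1})\sum_{m\ge1}p_mv^m=\prod_{i=1}^N\frac{1-q^{-2}\xi_iv}{1-\xi_iv}.$$ The variables $x_i$ are $x_i=\frac{q^{1-N}-\xi_i}{q^2-1}$. *)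

theory Defs
  imports
    "HOL-Algebra.QuotRing"
    "HOL-Computational_Algebra.Polynomial"
    "HOL-Computational_Algebra.Formal_Power_Series"
    "HOL-Computational_Algebra.Fraction_Field"
    "HOL-Analysis.Cartesian_Space"
    "HOL-Library.Poly_Mapping"
begin

section \<open>The ground field and $q$-numbers\<close>

type_synonym Cq = "complex poly fract"

definition qq :: Cq
  where "qq = Fract [:0, 1:] 1"

definition qint :: "int \<Rightarrow> Cq"
  where "qint a = (1 - qq powi (- 2 * a)) / (1 - qq powi (- 2))"

definition qfact :: "nat \<Rightarrow> Cq"
  where "qfact a = (\<Prod>j = 1..a. qint (int j))"

definition falling :: "int \<Rightarrow> nat \<Rightarrow> Cq"
  where "falling a b = (\<Prod>j<b. of_int (a - int j))"

definition qfalling :: "int \<Rightarrow> nat \<Rightarrow> Cq"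
  where "qfalling a b = (\<Prod>j<b. qint (a - int j))"

text \<open>The argument \<open>\<xi>\<close> must be an integer or a half-integer, so that $q^{-2\xi}$ lies in the
  ground field; the floor only converts the integer \<open>- 2 * \<xi>\<close> to type \<open>int\<close>.\<close>

definition qbernoulli :: "nat \<Rightarrow> int \<Rightarrow> nat \<Rightarrow> rat \<Rightarrow> Cq"
  where "qbernoulli l h k \<xi> =
    1 / (1 - qq powi (- 2)) ^ l *
    (\<Sum>i = 0..l. of_nat (l choose i) * (falling (int i + h) k / qfalling (int i + h) k) *
       (- (qq powi \<lfloor>- 2 * \<xi>\<rfloor>)) ^ i)"


section \<open>Free algebras\<close>

datatype 'g ncmon = NCMon (letters: "'g list")

instantiation ncmon :: (type) monoid_add
begin

definition zero_ncmon :: "'a ncmon"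
  where "0 = NCMon []"

definition plus_ncmon :: "'a ncmon \<Rightarrow> 'a ncmon \<Rightarrow> 'a ncmon"
  where "u + v = NCMon (letters u @ letters v)"

instance
  by standard (simp_all add: zero_ncmon_def plus_ncmon_def)

end

text \<open>The multiplication of \<open>poly_mapping\<close> is convolution along addition of the keys, which for
  \<open>ncmon\<close> is concatenation of words; hence the type below is the free unital associative
  algebra on the generators of type \<open>'g\<close>.\<close>

type_synonym 'g free_alg = "'g ncmon \<Rightarrow>\<^sub>0 Cq"

definition gen :: "'g \<Rightarrow> 'g free_alg"
  where "gen x = Poly_Mapping.single (NCMon [x]) 1"

definition cst :: "Cq \<Rightarrow> 'g free_alg"
  where "cst c = Poly_Mapping.single 0 c"

definition free_algebra :: "'g set \<Rightarrow> 'g free_alg ring"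
  where "free_algebra S =
    \<lparr>carrier = {p. \<forall>w \<in> Poly_Mapping.keys p. set (letters w) \<subseteq> S},
     monoid.mult = (*), one = 1, zero = 0, add = (+)\<rparr>"

lemma carrier_free_algebra:
  "p \<in> carrier (free_algebra S) \<longleftrightarrow> (\<forall>w \<in> Poly_Mapping.keys p. set (letters w) \<subseteq> S)"
  by (simp add: free_algebra_def)

lemma carrier_free_algebra_UNIV [simp]: "carrier (free_algebra UNIV) = UNIV"
  by (auto simp: carrier_free_algebra)

lemma free_algebra_simps [simp]:
  "monoid.mult (free_algebra S) = (*)" "one (free_algebra S) = 1"
  "zero (free_algebra S) = 0" "add (free_algebra S) = (+)"
  by (simp_all add: free_algebra_def)

lemma ring_free_algebra: "ring (free_algebra S)"
proof -
  have add: "p + r \<in> carrier (free_algebra S)"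
    if "p \<in> carrier (free_algebra S)" "r \<in> carrier (free_algebra S)" for p r
    using that Poly_Mapping.keys_add [of p r] unfolding carrier_free_algebra by blast
  have mult: "p * r \<in> carrier (free_algebra S)"
    if "p \<in> carrier (free_algebra S)" "r \<in> carrier (free_algebra S)" for p r
    unfolding carrier_free_algebra
  proof
    fix w assume "w \<in> Poly_Mapping.keys (p * r)"
    then obtain u v where "w = u + v" "u \<in> Poly_Mapping.keys p" "v \<in> Poly_Mapping.keys r"
      using keys_mult [of p r] by blast
    with that show "set (letters w) \<subseteq> S"
      by (simp add: carrier_free_algebra plus_ncmon_def)
  qed
  have const: "0 \<in> carrier (free_algebra S)" "1 \<in> carrier (free_algebra S)"
    by (simp_all add: carrier_free_algebra zero_ncmon_def)
  have uminus: "- p \<in> carrier (free_algebra S)" if "p \<in> carrier (free_algebra S)" for p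
    using that by (simp add: carrier_free_algebra)
  show ?thesis
  proof (intro ringI abelian_groupI monoidI)
    fix p assume "p \<in> carrier (free_algebra S)"
    then show "\<exists>r \<in> carrier (free_algebra S). r \<oplus>\<^bsub>free_algebra S\<^esub> p = \<zero>\<^bsub>free_algebra S\<^esub>"
      by (intro bexI [of _ "- p"]) (simp_all add: uminus)
  qed (simp_all add: add mult const algebra_simps)
qed


section \<open>The Hecke algebra and the $q$-symmetrizer\<close>

definition hecke_relators :: "nat \<Rightarrow> nat free_alg set"
  where "hecke_relators m =
    {gen i * gen j - gen j * gen i | i j.
       i \<in> {1..<m} \<and> j \<in> {1..<m} \<and> \<bar>int i - int j\<bar> > 1} \<union>
    {gen i * gen (i + 1) * gen i - gen (i + 1) * gen i * gen (i + 1) | i.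
       i \<in> {1..<m} \<and> i + 1 \<in> {1..<m}} \<union>
    {gen i * gen i - (1 + cst (qq - inverse qq) * gen i) | i. i \<in> {1..<m}}"

definition hecke_ideal :: "nat \<Rightarrow> nat free_alg set"
  where "hecke_ideal m = genideal (free_algebra {1..<m}) (hecke_relators m)"

definition hecke_algebra :: "nat \<Rightarrow> nat free_alg set ring"
  where "hecke_algebra m = free_algebra {1..<m} Quot hecke_ideal m"

text \<open>The embedding of $\mathbb H_{m-1}$ into $\mathbb H_m$ is induced by the inclusion of the
  free algebras, so the recursion for the $q$-symmetrizer can be carried out on representatives.
  The value at \<open>0\<close> is irrelevant.\<close>

fun q_symmetrizer_rep :: "nat \<Rightarrow> nat free_alg"
  where
    "q_symmetrizer_rep 0 = 1"
  | "q_symmetrizer_rep (Suc 0) = 1"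
  | "q_symmetrizer_rep (Suc (Suc k)) =
       (let m = Suc (Suc k) in
        cst (1 / qint (int m)) * q_symmetrizer_rep (Suc k) *
        (cst (qq powi (2 - 2 * int m)) + cst (inverse qq * qint (int m - 1)) * gen (m - 1)) *
        q_symmetrizer_rep (Suc k))"

definition q_symmetrizer :: "nat \<Rightarrow> nat free_alg set"
  where "q_symmetrizer m = hecke_ideal m +>\<^bsub>free_algebra {1..<m}\<^esub> q_symmetrizer_rep m"


section \<open>The $R$-matrix and the Reflection Equation algebra\<close>

text \<open>The basis of $V = \mathbb C(q)^N$ is indexed by a finite linearly ordered type \<open>'n\<close>
  with \<open>N = CARD('n)\<close>; the basis of $V \otimes V$ is indexed by pairs.\<close>

definition R_matrix :: "Cq ^ ('n::{finite,linorder} \<times> 'n) ^ ('n \<times> 'n)"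
  where "R_matrix = (\<chi> a b.
    (if fst a = snd a \<and> a = b then qq else 0) +
    (if fst a \<noteq> snd a \<and> fst b = snd a \<and> snd b = fst a then 1 else 0) +
    (if fst a < snd a \<and> a = b then qq - inverse qq else 0))"

definition index_pos :: "'n::{finite,linorder} \<Rightarrow> nat"
  where "index_pos i = card {j. j \<le> i}"

definition D_matrix :: "Cq ^ 'n::{finite,linorder} ^ 'n::{finite,linorder}"
  where "D_matrix = (\<chi> i j.
    if i = j then qq powi (2 * int (index_pos i) - 1 - 2 * int (CARD('n))) else 0)"

text \<open>The matrix $K_1 = K \otimes 1$ on $V \otimes V$.\<close>

definition fst_factor :: "'a::semiring_1 ^ 'n ^ 'n \<Rightarrow> 'a ^ ('n::finite \<times> 'n) ^ ('n \<times> 'n)"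
  where "fst_factor K = (\<chi> a b. if snd a = snd b then K $ fst a $ fst b else 0)"

definition rea_relators :: "('n::{finite,linorder} \<times> 'n) free_alg set"
  where "rea_relators =
    (let M1 = fst_factor (\<chi> i j. gen (i, j)); R12 = map_matrix cst R_matrix in
     {(R12 ** M1 ** R12 ** M1 - M1 ** R12 ** M1 ** R12) $ a $ b | a b. True})"

definition rea_ideal :: "('n::{finite,linorder} \<times> 'n) free_alg set"
  where "rea_ideal = genideal (free_algebra UNIV) rea_relators"

lemma ideal_rea_ideal: "ideal rea_ideal (free_algebra UNIV)"
  unfolding rea_ideal_def
  by (rule ring.genideal_ideal [OF ring_free_algebra]) auto

lemma free_a_inv [simp]: "a_inv (free_algebra UNIV) p = - p"
proof -
  interpret F: ring "free_algebra UNIV" by (rule ring_free_algebra)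
  show ?thesis
    using F.minus_equality [of "- p" p] by simp
qed

lemma rea_ideal_zero: "0 \<in> rea_ideal"
  using additive_subgroup.zero_closed [OF ideal.axioms(1) [OF ideal_rea_ideal]] by simp

lemma rea_ideal_add: "x \<in> rea_ideal \<Longrightarrow> y \<in> rea_ideal \<Longrightarrow> x + y \<in> rea_ideal"
  using additive_subgroup.a_closed [OF ideal.axioms(1) [OF ideal_rea_ideal]] by simp

lemma rea_ideal_mult_left: "x \<in> rea_ideal \<Longrightarrow> y * x \<in> rea_ideal"
  using ideal.I_l_closed [OF ideal_rea_ideal] by simp

lemma rea_ideal_mult_right: "x \<in> rea_ideal \<Longrightarrow> x * y \<in> rea_ideal"
  using ideal.I_r_closed [OF ideal_rea_ideal] by simp

lemma rea_ideal_uminus: "x \<in> rea_ideal \<Longrightarrow> - x \<in> rea_ideal"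
  using rea_ideal_mult_left [of x "- 1"] by simp

lemma lookup_mult_zero:
  fixes p r :: "'g free_alg"
  shows "Poly_Mapping.lookup (p * r) 0 = Poly_Mapping.lookup p 0 * Poly_Mapping.lookup r 0"
proof -
  have eq: "l + k = 0 \<longleftrightarrow> l = 0 \<and> k = 0" for l k :: "'g ncmon"
    by (cases l; cases k) (auto simp: zero_ncmon_def plus_ncmon_def)
  have inner: "(\<Sum>k. Poly_Mapping.lookup r k when l + k = 0) =
      (Poly_Mapping.lookup r 0 when l = 0)" for l
    by (cases "l = 0") (simp_all add: eq)
  show ?thesis
    by (simp add: lookup_mult inner mult_when)
qed

lemma lookup_zero_matrix_mult:
  fixes A B :: "'g free_alg ^ 'k ^ 'k"
  assumes "(\<forall>i j. Poly_Mapping.lookup (A $ i $ j) 0 = 0) \<or>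
    (\<forall>i j. Poly_Mapping.lookup (B $ i $ j) 0 = 0)"
  shows "\<forall>i j. Poly_Mapping.lookup ((A ** B) $ i $ j) 0 = 0"
  using assms by (auto simp: matrix_matrix_mult_def lookup_sum lookup_mult_zero)

lemma one_notin_rea_ideal: "1 \<notin> (rea_ideal :: ('n::{finite,linorder} \<times> 'n) free_alg set)"
proof -
  let ?F = "free_algebra UNIV :: ('n \<times> 'n) free_alg ring"
  let ?A = "{p. Poly_Mapping.lookup p 0 = 0} :: ('n \<times> 'n) free_alg set"
  interpret F: ring ?F by (rule ring_free_algebra)
  have sub: "additive_subgroup ?A ?F"
  proof (intro additive_subgroup.intro subgroup.intro)
    show "m_inv (add_monoid ?F) x \<in> ?A" if "x \<in> ?A" for x
      unfolding a_inv_def [symmetric] using that by simp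
  qed (auto simp: lookup_add)
  have "ideal ?A ?F"
    by (intro idealI F.ring_axioms additive_subgroup.a_subgroup [OF sub])
      (auto simp: lookup_mult_zero)
  moreover have "rea_relators \<subseteq> ?A"
  proof -
    define M1 :: "('n \<times> 'n) free_alg ^ ('n \<times> 'n) ^ ('n \<times> 'n)"
      where "M1 = fst_factor (\<chi> i j. gen (i, j))"
    have "\<forall>i j. Poly_Mapping.lookup (M1 $ i $ j) 0 = 0"
      by (auto simp: M1_def fst_factor_def gen_def lookup_single when_def zero_ncmon_def)
    then show ?thesis
      unfolding rea_relators_def Let_def M1_def [symmetric]
      by (auto simp: lookup_minus lookup_zero_matrix_mult)
  qed
  ultimately have "rea_ideal \<subseteq> ?A"
    unfolding rea_ideal_def by (rule F.genideal_minimal)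
  then show ?thesis
    by (auto simp: lookup_one)
qed

quotient_type (overloaded) 'n rea = "('n::{finite,linorder} \<times> 'n) free_alg" /
  "\<lambda>x y. x - y \<in> rea_ideal"
proof (intro equivpI reflpI sympI transpI)
  fix x y z :: "('n \<times> 'n) free_alg"
  show "x - x \<in> rea_ideal"
    by (simp add: rea_ideal_zero)
  show "y - x \<in> rea_ideal" if "x - y \<in> rea_ideal"
    using rea_ideal_uminus [OF that] by simp
  show "x - z \<in> rea_ideal" if "x - y \<in> rea_ideal" "y - z \<in> rea_ideal"
    using rea_ideal_add [OF that] by simp
qed

instantiation rea :: ("{finite,linorder}") ring_1
begin

lift_definition zero_rea :: "'a rea" is 0 .

lift_definition one_rea :: "'a rea" is 1 .

lift_definition plus_rea :: "'a rea \<Rightarrow> 'a rea \<Rightarrow> 'a rea" is "(+)"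
  using rea_ideal_add by (fastforce simp: algebra_simps)

lift_definition uminus_rea :: "'a rea \<Rightarrow> 'a rea" is uminus
  using rea_ideal_uminus by fastforce

lift_definition minus_rea :: "'a rea \<Rightarrow> 'a rea \<Rightarrow> 'a rea" is "(-)"
proof -
  fix x x' y y' :: "('a \<times> 'a) free_alg"
  assume "x - x' \<in> rea_ideal" "y - y' \<in> rea_ideal"
  then have "(x - x') + - (y - y') \<in> rea_ideal"
    by (intro rea_ideal_add rea_ideal_uminus)
  then show "x - y - (x' - y') \<in> rea_ideal"
    by (simp add: algebra_simps)
qed

lift_definition times_rea :: "'a rea \<Rightarrow> 'a rea \<Rightarrow> 'a rea" is "(*)"
proof -
  fix x x' y y' :: "('a \<times> 'a) free_alg"
  assume "x - x' \<in> rea_ideal" "y - y' \<in> rea_ideal"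
  then have "(x - x') * y + x' * (y - y') \<in> rea_ideal"
    by (intro rea_ideal_add rea_ideal_mult_left rea_ideal_mult_right)
  then show "x * y - x' * y' \<in> rea_ideal"
    by (simp add: algebra_simps)
qed

instance
proof
  fix x y z :: "'a rea"
  show "x + y + z = x + (y + z)" "x + y = y + x" "0 + x = x" "- x + x = 0" "x - y = x + - y"
    "x * y * z = x * (y * z)" "1 * x = x" "x * 1 = x"
    "(x + y) * z = x * z + y * z" "x * (y + z) = x * y + x * z"
    by (transfer; simp add: algebra_simps rea_ideal_zero)+
  show "(0::'a rea) \<noteq> 1"
  proof (transfer, rule notI)
    assume "0 - 1 \<in> (rea_ideal :: ('a \<times> 'a) free_alg set)"
    from rea_ideal_uminus [OF this] show False
      by (simp add: one_notin_rea_ideal)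
  qed
qed

end

lift_definition rea_gen :: "'n \<Rightarrow> 'n \<Rightarrow> 'n::{finite,linorder} rea" is "\<lambda>i j. gen (i, j)" .

lift_definition rea_cst :: "Cq \<Rightarrow> 'n::{finite,linorder} rea" is cst .

definition rea_center :: "'n::{finite,linorder} rea set"
  where "rea_center = {z. \<forall>x. z * x = x * z}"

definition M_matrix :: "'n rea ^ 'n::{finite,linorder} ^ 'n::{finite,linorder}"
  where "M_matrix = (\<chi> i j. rea_gen i j)"

definition L_matrix :: "'n rea ^ 'n::{finite,linorder} ^ 'n::{finite,linorder}"
  where "L_matrix = (\<chi> i j. rea_cst (1 / (qq - inverse qq)) * (mat 1 - M_matrix) $ i $ j)"


section \<open>Endomorphisms of tensor powers\<close>

text \<open>A matrix acting on $V^{\otimes m}$ is a function of two multi-indices, which are lists of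
  length \<open>m\<close>; it vanishes when one of its arguments has a different length.
  Tensor factors are numbered from \<open>1\<close>, whereas \<open>nth\<close> counts from \<open>0\<close>; \<open>on_factors m i\<close>
  acts in the factors \<open>i\<close> and \<open>i + 1\<close>.\<close>

type_synonym ('n, 'a) tmat = "'n list \<Rightarrow> 'n list \<Rightarrow> 'a"

definition tmat_one :: "nat \<Rightarrow> ('n, 'a::semiring_1) tmat"
  where "tmat_one m = (\<lambda>a b. if length a = m \<and> a = b then 1 else 0)"

definition tmat_mult :: "nat \<Rightarrow> ('n::finite, 'a::semiring_1) tmat \<Rightarrow> ('n, 'a) tmat \<Rightarrow> ('n, 'a) tmat"
  where "tmat_mult m A B = (\<lambda>a b. \<Sum>c | length c = m. A a c * B c b)"

definition tmat_prod :: "nat \<Rightarrow> ('n::finite, 'a::semiring_1) tmat list \<Rightarrow> ('n, 'a) tmat"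
  where "tmat_prod m As = foldr (tmat_mult m) As (tmat_one m)"

definition on_factor :: "nat \<Rightarrow> nat \<Rightarrow> 'a::semiring_1 ^ 'n ^ 'n::finite \<Rightarrow> ('n, 'a) tmat"
  where "on_factor m i K = (\<lambda>a b.
    if length a = m \<and> length b = m \<and> (\<forall>j<m. j \<noteq> i - 1 \<longrightarrow> a ! j = b ! j)
    then K $ (a ! (i - 1)) $ (b ! (i - 1)) else 0)"

definition on_factors :: "nat \<Rightarrow> nat \<Rightarrow> 'a::semiring_1 ^ ('n \<times> 'n) ^ ('n::finite \<times> 'n) \<Rightarrow> ('n, 'a) tmat"
  where "on_factors m i X = (\<lambda>a b.
    if length a = m \<and> length b = m \<and> (\<forall>j<m. j \<noteq> i - 1 \<and> j \<noteq> i \<longrightarrow> a ! j = b ! j)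
    then X $ (a ! (i - 1), a ! i) $ (b ! (i - 1), b ! i) else 0)"

definition tmat_cst :: "('n::{finite,linorder}, Cq) tmat \<Rightarrow> ('n, 'n rea) tmat"
  where "tmat_cst A = (\<lambda>a b. rea_cst (A a b))"

definition R_trace :: "nat \<Rightarrow> ('n::{finite,linorder}, 'n rea) tmat \<Rightarrow> 'n rea"
  where "R_trace m X =
    (\<Sum>a | length a = m.
      tmat_mult m (tmat_cst (tmat_prod m (map (\<lambda>i. on_factor m i D_matrix) [1..<m + 1]))) X a a)"

text \<open>The matrices $K_{\overline i}$; the value at \<open>0\<close> is irrelevant.\<close>

fun overlined :: "nat \<Rightarrow> 'n rea ^ 'n::{finite,linorder} ^ 'n::{finite,linorder} \<Rightarrow> nat \<Rightarrow> ('n, 'n rea) tmat"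
  where
    "overlined m K 0 = (\<lambda>a b. 0)"
  | "overlined m K (Suc 0) = on_factor m 1 K"
  | "overlined m K (Suc (Suc i)) =
       tmat_prod m [tmat_cst (on_factors m (i + 1) R_matrix), overlined m K (Suc i),
         tmat_cst (on_factors m (i + 1) (matrix_inv R_matrix))]"


section \<open>The weight system\<close>

text \<open>The representation is defined on the free algebra and factored through the quotient: it is
  constant on each coset, and \<open>the_elem\<close> picks that constant value.\<close>

definition free_rep :: "nat \<Rightarrow> nat free_alg \<Rightarrow> ('n::{finite,linorder}, Cq) tmat"
  where "free_rep m p = (\<lambda>a b. \<Sum>w \<in> Poly_Mapping.keys p.
    Poly_Mapping.lookup p w * tmat_prod m (map (\<lambda>i. on_factors m i R_matrix) (letters w)) a b)"

definition hecke_rep :: "nat \<Rightarrow> nat free_alg set \<Rightarrow> ('n::{finite,linorder}, Cq) tmat"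
  where "hecke_rep m x = the_elem (free_rep m ` x)"

definition weight_system :: "nat \<Rightarrow> nat free_alg set \<Rightarrow> 'n::{finite,linorder} rea"
  where "weight_system m x =
    R_trace m (tmat_mult m (tmat_prod m (map (overlined m L_matrix) [1..<m + 1]))
      (tmat_cst (hecke_rep m x)))"

definition average_value :: "nat \<Rightarrow> 'n::{finite,linorder} rea"
  where "average_value m = weight_system m (q_symmetrizer m)"

definition power_sum :: "nat \<Rightarrow> 'n::{finite,linorder} rea"
  where "power_sum k =
    R_trace k (tmat_mult k (tmat_prod k (map (overlined k M_matrix) [1..<k + 1]))
      (tmat_cst (tmat_prod k (map (\<lambda>i. on_factors k i R_matrix) (rev [1..<k])))))"


section \<open>Symmetric polynomials and the quantum Harish-Chandra isomorphism\<close>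

text \<open>Commutative polynomials in the variables $\xi_i$, with \<open>i\<close> ranging over \<open>'n\<close>.\<close>

type_synonym 'n xi_poly = "('n \<Rightarrow>\<^sub>0 nat) \<Rightarrow>\<^sub>0 Cq"

definition pcst :: "Cq \<Rightarrow> 'n xi_poly"
  where "pcst c = Poly_Mapping.single 0 c"

definition xi :: "'n \<Rightarrow> 'n xi_poly"
  where "xi i = Poly_Mapping.single (Poly_Mapping.single i 1) 1"

definition symmetric_polys :: "'n xi_poly set"
  where "symmetric_polys =
    {p. \<forall>\<pi>. bij \<pi> \<longrightarrow>
      (\<forall>e. Poly_Mapping.lookup p (Poly_Mapping.map_key \<pi> e) = Poly_Mapping.lookup p e)}"

definition complete_sym :: "nat \<Rightarrow> ('n::{finite,linorder} \<Rightarrow> 'a::comm_ring_1) \<Rightarrow> 'a"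
  where "complete_sym j x = (\<Sum>is | length is = j \<and> sorted is. prod_list (map x is))"

definition x_var :: "'n::finite \<Rightarrow> 'n xi_poly"
  where "x_var i = pcst (1 / (qq ^ 2 - 1)) * (pcst (qq powi (1 - int (CARD('n)))) - xi i)"

text \<open>The factor $1 / (1 - \xi_i v)$ of the generating function is the geometric series.\<close>

definition quantum_Harish_Chandra :: "('n::{finite,linorder} rea \<Rightarrow> 'n xi_poly) \<Rightarrow> bool"
  where "quantum_Harish_Chandra \<Phi> \<longleftrightarrow>
    bij_betw \<Phi> rea_center symmetric_polys \<and>
    \<Phi> 1 = 1 \<and>
    (\<forall>y \<in> rea_center. \<forall>z \<in> rea_center. \<Phi> (y + z) = \<Phi> y + \<Phi> z) \<and>
    (\<forall>y \<in> rea_center. \<forall>z \<in> rea_center. \<Phi> (y * z) = \<Phi> y * \<Phi> z) \<and>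
    (\<forall>c. \<forall>z \<in> rea_center. \<Phi> (rea_cst c * z) = pcst c * \<Phi> z) \<and>
    1 + fps_const (pcst (qq - inverse qq)) *
        Abs_fps (\<lambda>k. if k = 0 then 0 else \<Phi> (power_sum k)) =
      (\<Prod>i \<in> UNIV. (1 - fps_const (pcst (inverse qq ^ 2) * xi i) * fps_X) *
        Abs_fps (\<lambda>k. xi i ^ k))"

end

theory Submission
  imports Defs
begin

text \<open>
  Write $\langle\cdot\rangle$ for the \<open>R\<close>-trace and $s_k = \langle M_{\overline 1} \cdots M_{\overline k} h_k\rangle$
  with $h_k$ the \<open>q\<close>-symmetrizer. In the expansion of $\prod_i (1 - M_{\overline i})$ every product of \<open>k\<close>
  factors is conjugate under braid operators to $M_{\overline 1} \cdots M_{\overline k}$; since $h_m$ is central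
  and the \<open>R\<close>-trace is cyclic for braid operators, $\Omega_m$ is a sum over \<open>k\<close> with ordinary
  binomial coefficients of $\langle M_{\overline 1} \cdots M_{\overline k} h_m\rangle$, and tracing out the last
  $m - k$ factors of $h_m$ leaves a \<open>q\<close>-binomial multiple of $s_k$.

  The recursion of the \<open>q\<close>-symmetrizer gives the Newton identities between the $s_k$ and the quantum
  power sums, which on the Harish-Chandra side are those of $q^{-k}$ times the complete symmetric
  polynomial of degree \<open>k\<close> in the $\xi_i$. The affine substitution from $\xi_i$ to $x_i$ then
  produces the \<open>q\<close>-Bernoulli polynomials.

  Centrality of $\langle M_{\overline 1} \cdots M_{\overline k} Z\rangle$ for \<open>Z\<close> in the Hecke algebra holds because
  the partial \<open>R\<close>-trace is unchanged when the factors are shifted by conjugation with either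
  $R_1 \cdots R_k$ or $R_1^{-1} \cdots R_k^{-1}$, and the reflection equation turns
  multiplication by $M_1$ from the left in one picture into multiplication from the right in the other.
\<close>

section \<open>Operators on an infinite tensor power\<close>

text \<open>The entries of \<open>M\<close> do not commute, so a trace of a product is not cyclic in
  general. The argument is arranged so that only braid operators, which have scalar coefficients and
  commute with D tensor D, are ever moved around the trace. The Harish-Chandra map is a homomorphism
  on the center only; hence each s_k and each power sum must be known to be central before the
  Newton identities can be transported.

  Two kinds of factorials meet in the result. Ordinary ones come from expanding the product of the 1
  - M and from the substitution \<xi>_i = q^(-\<nu>) + (1 - q^2) x_i; q-factorials come from tracing
  out factors of the symmetrizer. For fixed k they combine to ((\<nu> + k)! / k!) ([k]_q! /
  [\<nu> + k]_q!), the quotient of falling factorials in the q-Bernoulli polynomial, while the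
  constant q^(-\<nu>) of the substitution produces its argument \<nu> / 2.\<close>

text \<open>Functions of infinite index sequences replace the vectors of all $V^{\otimes m}$ at once, so that
  \<open>X\<close> and \<open>X \<otimes> 1\<close> are the same operator. Right linearity is what makes multiplication by a
  central element commute with every operator.\<close>

typedef (overloaded) ('n, 'a) opr =
  "{X :: ((nat \<Rightarrow> 'n) \<Rightarrow> 'a::ring_1) \<Rightarrow> ((nat \<Rightarrow> 'n) \<Rightarrow> 'a).
    (\<forall>f g. X (\<lambda>s. f s + g s) = (\<lambda>s. X f s + X g s)) \<and>
    (\<forall>f z. X (\<lambda>s. f s * z) = (\<lambda>s. X f s * z))}"
  morphisms app Opr
  by (rule exI [of _ "\<lambda>f. f"]) simp

setup_lifting type_definition_opr

instantiation opr :: (type, ring_1) ring_1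
begin

lift_definition zero_opr :: "('a, 'b) opr" is "\<lambda>f s. 0" by simp
lift_definition one_opr :: "('a, 'b) opr" is "\<lambda>f. f" by simp
lift_definition plus_opr :: "('a, 'b) opr \<Rightarrow> ('a, 'b) opr \<Rightarrow> ('a, 'b) opr"
  is "\<lambda>X Y f s. X f s + Y f s" by (simp add: algebra_simps)
lift_definition uminus_opr :: "('a, 'b) opr \<Rightarrow> ('a, 'b) opr"
  is "\<lambda>X f s. - X f s" by simp
lift_definition minus_opr :: "('a, 'b) opr \<Rightarrow> ('a, 'b) opr \<Rightarrow> ('a, 'b) opr"
  is "\<lambda>X Y f s. X f s - Y f s" by (simp add: algebra_simps)
lift_definition times_opr :: "('a, 'b) opr \<Rightarrow> ('a, 'b) opr \<Rightarrow> ('a, 'b) opr"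
  is "\<lambda>X Y f. X (Y f)" by simp

instance
proof
  show "(0 :: ('a, 'b) opr) \<noteq> 1"
    by transfer (metis zero_neq_one)
qed (transfer; simp add: fun_eq_iff algebra_simps)+

end

lemma app_simps [simp]:
  "app 0 f s = 0" "app 1 f = f" "app (X + Y) f s = app X f s + app Y f s"
  "app (- X) f s = - app X f s" "app (X - Y) f s = app X f s - app Y f s"
  "app (X * Y) f = app X (app Y f)"
  by (transfer; simp)+

lemma app_mult_right: "app X (\<lambda>s. f s * z) s = app X f s * z"
  by transfer (simp add: fun_eq_iff)

lemma sum_app [simp]: "app (\<Sum>i\<in>A. X i) f s = (\<Sum>i\<in>A. app (X i) f s)"
proof (cases "finite A")
  case True
  then show ?thesis by induction simp_all
qed simp

lemma opr_eqI: "(\<And>f s. app X f s = app Y f s) \<Longrightarrow> X = Y"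
  by transfer (simp add: fun_eq_iff)

lift_definition left_mult :: "'a::ring_1 \<Rightarrow> ('n, 'a) opr" is "\<lambda>z f s. z * f s"
  by (simp add: algebra_simps)

lemma app_left_mult [simp]: "app (left_mult z) f s = z * f s"
  by transfer simp

lemma left_mult_hom: "left_mult (x + y) = left_mult x + left_mult y" "left_mult (x * y) =
    left_mult x * left_mult y" "left_mult (- x) = - left_mult x"
  "left_mult (x - y) = left_mult x - left_mult y" "left_mult 0 = 0" "left_mult 1 = 1"
  by (auto intro!: opr_eqI simp: algebra_simps)

lemma left_mult_sum: "left_mult (\<Sum>i\<in>A. f i) = (\<Sum>i\<in>A. left_mult (f i))"
  by (rule opr_eqI) (simp add: sum_distrib_right)

text \<open>Fully traced operators have the form \<open>left_mult z\<close>; this is how an identity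
  between them becomes an identity in the algebra.\<close>

lemma left_mult_inject [simp]: "left_mult x = (left_mult y :: ('n, 'a::ring_1) opr) \<longleftrightarrow> x = y"
proof
  assume "left_mult x = (left_mult y :: ('n, 'a) opr)"
  then have "app (left_mult x :: ('n, 'a) opr) (\<lambda>s. 1) undefined =
      app (left_mult y :: ('n, 'a) opr) (\<lambda>s. 1) undefined"
    by simp
  then show "x = y" by simp
qed simp

lemma left_mult_central:
  fixes X :: "('n, 'a::ring_1) opr"
  assumes z: "\<And>y. z * y = y * z"
  shows "left_mult z * X = X * left_mult z"
proof (rule opr_eqI)
  fix f :: "(nat \<Rightarrow> 'n) \<Rightarrow> 'a" and s
  have "app (left_mult z) f = (\<lambda>s. f s * z)"
    by (simp add: fun_eq_iff z)
  then show "app (left_mult z * X) f s = app (X * left_mult z) f s"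
    by (simp add: app_mult_right z)
qed

text \<open>Tensor factors are numbered from \<open>0\<close> here, as for \<open>nth\<close>.\<close>

lift_definition E :: "nat \<Rightarrow> 'n \<Rightarrow> 'n \<Rightarrow> ('n, 'a::ring_1) opr"
  is "\<lambda>j a b f s. if s j = a then f (s(j := b)) else 0"
  by auto

lemma app_E [simp]: "app (E j a b) f s = (if s j = a then f (s(j := b)) else 0)"
  by transfer simp

lemma E_mult: "E j a b * E j c d = (if b = c then E j a d else 0)"
  by (rule opr_eqI) simp

lemma E_commute: "i \<noteq> j \<Longrightarrow> E i a b * E j c d = E j c d * E i a b"
  by (rule opr_eqI) (auto simp: fun_upd_twist [of i j])

lemma sum_E [simp]: "(\<Sum>a\<in>UNIV. E j a a) = (1 :: ('n::finite, 'a::ring_1) opr)"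
  by (rule opr_eqI) (simp add: fun_upd_idem_iff)

lemma E_left_mult: "E j a b * left_mult z = left_mult z * E j a b"
  by (rule opr_eqI) simp

section \<open>Scalars\<close>

lemma gen_cst: "cst a + cst b = cst (a + b)" "cst a * cst b = cst (a * b)" "cst 1 = 1" "cst 0 = 0"
  by (simp_all add: cst_def Poly_Mapping.single_add Poly_Mapping.mult_single)

lemma rea_cst_hom: "rea_cst (a + b) = rea_cst a + rea_cst b" "rea_cst (a * b) =
    rea_cst a * rea_cst b"
  "rea_cst 1 = 1" "rea_cst 0 = 0"
  by (transfer; simp add: gen_cst rea_ideal_zero)+

lemma poly_mapping_add_induct [case_names zero add]:
  assumes "P 0" and "\<And>p u b. P p \<Longrightarrow> P (p + Poly_Mapping.single u b)"
  shows "P (p :: 'a \<Rightarrow>\<^sub>0 'b::monoid_add)"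
proof (induction p rule: update_induct)
  case (update f a b)
  then have "Poly_Mapping.update a b f = f + Poly_Mapping.single a b"
    by (intro poly_mapping_eqI) (auto simp: lookup_update lookup_add lookup_single in_keys_iff)
  with update assms(2) show ?case by simp
qed (use assms in simp)

lemma cst_commute: "cst a * p = p * (cst a :: 'g free_alg)"
proof -
  have "cst a * Poly_Mapping.single u b = Poly_Mapping.single u b * (cst a :: 'g free_alg)" for u b
    by (simp add: cst_def Poly_Mapping.mult_single mult.commute)
  then show ?thesis
    by (induction p rule: poly_mapping_add_induct) (simp_all add: algebra_simps)
qed

lemma rea_cst_commute: "rea_cst a * x = x * rea_cst a"
  by transfer (simp add: cst_commute rea_ideal_zero)

type_synonym 'n op = "('n, 'n rea) opr"

text \<open>Scalars of the ground field act through the central elements \<open>rea_cst c\<close>;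
  this is why they can be pulled out of either side of a product.\<close>

definition sc :: "Cq \<Rightarrow> 'n::{finite,linorder} op \<Rightarrow> 'n op"
  where "sc c X = left_mult (rea_cst c) * X"

lemma app_sc [simp]: "app (sc c X) f s = rea_cst c * app X f s"
  by (simp add: sc_def)

lemma left_mult_cst_commute: "left_mult (rea_cst c) * X = X * left_mult (rea_cst c)"
  by (rule left_mult_central) (rule rea_cst_commute)

lemma sc_mult [simp]: "sc c X * Y = sc c (X * Y)" "X * sc c Y = sc c (X * Y)"
  unfolding sc_def by (simp_all only: mult.assoc flip: mult.assoc [of X] left_mult_cst_commute
      [of c X])

lemma sc_sc [simp]: "sc c (sc d X) = sc (c * d) X"
  by (simp add: sc_def rea_cst_hom left_mult_hom mult.assoc)

lemma sc_one [simp]: "sc 1 X = X"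
  by (simp add: sc_def rea_cst_hom left_mult_hom)

lemma sc_zero [simp]: "sc 0 X = 0" "sc c 0 = 0"
  by (simp_all add: sc_def rea_cst_hom left_mult_hom)

lemma sc_add: "sc c (X + Y) = sc c X + sc c Y" "sc (c + d) X = sc c X + sc d X"
  by (simp_all add: sc_def rea_cst_hom left_mult_hom algebra_simps)

lemma sc_minus: "sc c (- X) = - sc c X" "sc (- c) X = - sc c X"
  "sc c (X - Y) = sc c X - sc c Y" "sc (c - d) X = sc c X - sc d X"
proof -
  have *: "sc (- c) X = - sc c X" for c X
    using sc_add(2) [of c "- c" X] by (simp add: add_eq_0_iff)
  show "sc c (- X) = - sc c X" by (simp add: sc_def)
  show "sc (- c) X = - sc c X" by (rule *)
  show "sc c (X - Y) = sc c X - sc c Y" by (simp add: sc_def algebra_simps)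
  show "sc (c - d) X = sc c X - sc d X"
    using sc_add(2) [of c "- d" X] by (simp add: *)
qed

lemma sc_sum: "sc c (\<Sum>i\<in>A. X i) = (\<Sum>i\<in>A. sc c (X i))"
  by (simp add: sc_def sum_distrib_left)

lemma sum_sc: "sc (\<Sum>i\<in>A. c i) X = (\<Sum>i\<in>A. sc (c i) X)"
proof (cases "finite A")
  case True
  then show ?thesis by induction (simp_all add: sc_add)
qed simp

lemma sc_left_mult: "sc c (left_mult z) = left_mult (rea_cst c * z)"
  by (simp add: sc_def left_mult_hom)

section \<open>The operators attached to matrices\<close>

lift_definition on1 :: "nat \<Rightarrow> 'a::ring_1 ^ 'n::finite ^ 'n \<Rightarrow> ('n, 'a) opr"
  is "\<lambda>j K f s. \<Sum>b\<in>UNIV. K $ s j $ b * f (s(j := b))"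
  by (simp add: algebra_simps sum.distrib sum_distrib_right)

lift_definition on2 :: "nat \<Rightarrow> 'a::ring_1 ^ ('n \<times> 'n) ^ ('n::finite \<times> 'n) \<Rightarrow> ('n, 'a) opr"
  is "\<lambda>i X f s. \<Sum>b\<in>UNIV. X $ (s i, s (Suc i)) $ b * f (s(i := fst b, Suc i := snd b))"
  by (simp add: algebra_simps sum.distrib sum_distrib_right)

lemma app_on1 [simp]: "app (on1 j K) f s = (\<Sum>b\<in>UNIV. K $ s j $ b * f (s(j := b)))"
  by transfer simp

lemma app_on2: "app (on2 i X) f s =
    (\<Sum>b\<in>UNIV. X $ (s i, s (Suc i)) $ b * f (s(i := fst b, Suc i := snd b)))"
  by transfer simp

lemma on2_mult: "on2 i (X ** Y) = on2 i X * on2 i Y"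
proof (rule opr_eqI)
  fix f :: "(nat \<Rightarrow> 'a) \<Rightarrow> 'b" and s :: "nat \<Rightarrow> 'a"
  have *: "s(i := a, Suc i := b, i := c, Suc i := d) = s(i := c, Suc i := d)" for a b c d
    by (auto simp: fun_eq_iff)
  have "app (on2 i (X ** Y)) f s = (\<Sum>b\<in>UNIV. \<Sum>c\<in>UNIV.
      X $ (s i, s (Suc i)) $ c * Y $ c $ b * f (s(i := fst b, Suc i := snd b)))"
    by (simp add: app_on2 matrix_matrix_mult_def sum_distrib_right)
  also have "\<dots> = app (on2 i X * on2 i Y) f s"
    by (subst sum.swap) (simp add: app_on2 sum_distrib_left mult.assoc *)
  finally show "app (on2 i (X ** Y)) f s = app (on2 i X * on2 i Y) f s" .
qed

lemma on2_one: "on2 i (mat 1) = 1"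
proof (rule opr_eqI)
  fix f :: "(nat \<Rightarrow> 'a) \<Rightarrow> 'b" and s :: "nat \<Rightarrow> 'a"
  have "(if (s i, s (Suc i)) = b then 1 else 0) * f (s(i := fst b, Suc i := snd b)) =
      (if (s i, s (Suc i)) = b then f s else 0)" for b
    by (auto simp: fun_upd_idem_iff)
  then show "app (on2 i (mat 1)) f s = app 1 f s"
    by (simp add: app_on2 mat_def del: fun_upd_apply)
qed

text \<open>Connects the reflection equation, whose relators live on two tensor factors, with
  operators acting in a single factor.\<close>

lemma on2_fst_factor: "on2 i (fst_factor K) = on1 i K"
proof (rule opr_eqI)
  fix f :: "(nat \<Rightarrow> 'a) \<Rightarrow> 'b" and s :: "nat \<Rightarrow> 'a"
  have "app (on2 i (fst_factor K)) f s = (\<Sum>b\<in>UNIV. \<Sum>c\<in>UNIV.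
      (if s (Suc i) = c then K $ s i $ b * f (s(i := b, Suc i := c)) else 0))"
    unfolding app_on2 UNIV_Times_UNIV [symmetric] sum.cartesian_product'
    by (auto simp: fst_factor_def if_distrib [of "\<lambda>x. x * _"] cong: if_cong intro!: sum.cong)
  also have "\<dots> = app (on1 i K) f s"
  proof -
    have "s(i := b, Suc i := s (Suc i)) = s(i := b)" for b
      by (auto simp: fun_eq_iff)
    then show ?thesis by simp
  qed
  finally show "app (on2 i (fst_factor K)) f s = app (on1 i K) f s" .
qed

lemma on1_E: "on1 j K * E i a b = E i a b * on1 j K" if "i \<noteq> j"
  using that by (intro opr_eqI) (auto simp: fun_upd_twist [of i j])

lemma on2_E: "on2 i X * E j a b = E j a b * on2 i X" if "j \<noteq> i" "j \<noteq> Suc i"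
proof (rule opr_eqI)
  fix f :: "(nat \<Rightarrow> 'a) \<Rightarrow> 'b" and s :: "nat \<Rightarrow> 'a"
  have "s(i := c, Suc i := d, j := b) = s(j := b, i := c, Suc i := d)" for c d
    using that by (auto simp: fun_eq_iff)
  then show "app (on2 i X * E j a b) f s = app (E j a b * on2 i X) f s"
    using that by (auto simp: app_on2)
qed

lemma additive_sum:
  assumes "\<And>x y. h (x + y) = h x + h y" "h 0 = 0"
  shows "h (\<Sum>i\<in>F. g i) = (\<Sum>i\<in>F. h (g i))"
proof (cases "finite F")
  case True
  then show ?thesis by induction (simp_all add: assms)
qed (simp add: assms)

lemma map_matrix_mult:
  assumes "\<And>x y. h (x + y) = h x + h y" "\<And>x y. h (x * y) = h x * h y" "h 0 = 0"
  shows "map_matrix h (A ** B) = map_matrix h A ** map_matrix h B"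
  by (simp add: vec_eq_iff matrix_matrix_mult_def map_matrix_def assms(2)
      additive_sum [of h, OF assms(1,3)])

lemmas map_matrix_rea_cst = map_matrix_mult [of rea_cst, OF rea_cst_hom(1,2,4)]

lemma map_matrix_rea_cst_one: "map_matrix rea_cst (mat 1) = mat 1"
  by (simp add: vec_eq_iff map_matrix_def mat_def rea_cst_hom)

section \<open>The braid operators\<close>

lemma qq_nonzero [simp]: "qq \<noteq> 0"
  unfolding qq_def Zero_fract_def by (subst eq_fract) auto

definition q_diff :: Cq
  where "q_diff = qq - inverse qq"

definition r :: "nat \<Rightarrow> 'n::{finite,linorder} op"
  where "r i = on2 i (map_matrix rea_cst R_matrix)"

definition ri :: "nat \<Rightarrow> 'n::{finite,linorder} op"
  where "ri i = on2 i (map_matrix rea_cst (matrix_inv R_matrix))"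

text \<open>Splitting each row into two delta functions, at \<open>(x, y)\<close> and at
  \<open>(y, x)\<close>, lets every later sum over the column index collapse at once.\<close>

lemma R_matrix_entry: "R_matrix $ (x, y) $ b =
    (if b = (x, y) then (if x = y then qq else if x < y then q_diff else 0) else 0) +
    (if b = (y, x) then (if x \<noteq> y then 1 else 0) else 0)"
proof -
  obtain u v where b: "b = (u, v)" by (cases b)
  show ?thesis
  proof (cases "x = y")
    case True
    show ?thesis
      unfolding R_matrix_def b True by (auto split: if_split)
  next
    case False
    show ?thesis
    proof (cases "u = x")
      case True
      with False show ?thesis
        unfolding R_matrix_def b True by (auto simp: q_diff_def)
    next
      case ux: False
      with False show ?thesis
        unfolding R_matrix_def b by simp
    qed
  qed
qed

lemma rea_cst_if: "rea_cst (if A then c else 0) * z = (if A then rea_cst c * z else 0)"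
  by (simp add: rea_cst_hom)

lemma app_r: "app (r i) f s = (if s i = s (Suc i) then rea_cst qq * f s
    else f (s(i := s (Suc i), Suc i := s i)) +
        (if s i < s (Suc i) then rea_cst q_diff * f s else 0))"
proof -
  define x y where "x = s i" and "y = s (Suc i)"
  have s: "s(i := x, Suc i := y) = s"
    by (simp add: x_def y_def)
  define g where "g b = f (s(i := fst b, Suc i := snd b))" for b
  have "app (r i) f s = (\<Sum>b\<in>UNIV. rea_cst (R_matrix $ (x, y) $ b) * g b)"
    by (simp add: r_def app_on2 x_def y_def g_def map_matrix_def)
  also have "\<dots> = (\<Sum>b\<in>UNIV.
      (if b = (x, y) then rea_cst (if x = y then qq else if x < y then q_diff else 0) * g b else
          0) +
      (if b = (y, x) then rea_cst (if x \<noteq> y then 1 else 0) * g b else 0))"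
    by (rule sum.cong [OF refl])
      (simp only: R_matrix_entry rea_cst_hom(1) distrib_right rea_cst_if)
  also have "\<dots> = rea_cst (if x = y then qq else if x < y then q_diff else 0) * g (x, y) +
      rea_cst (if x \<noteq> y then 1 else 0) * g (y, x)"
    by (simp add: sum.distrib)
  also have "\<dots> = (if x = y then rea_cst qq * f s
    else f (s(i := y, Suc i := x)) + (if x < y then rea_cst q_diff * f s else 0))"
    by (simp add: g_def s rea_cst_hom(3,4))
  finally show ?thesis by (simp add: x_def y_def)
qed

lemma qq_square: "rea_cst qq * (rea_cst qq * z) = z +
    rea_cst q_diff * (rea_cst qq * (z :: 'n::{finite,linorder} rea))"
proof -
  have "qq * qq = 1 + q_diff * qq"
    by (simp add: q_diff_def algebra_simps)
  then have "rea_cst qq * rea_cst qq = (1 + rea_cst q_diff * rea_cst qq :: 'n rea)"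
    by (simp flip: rea_cst_hom)
  then have "(rea_cst qq * rea_cst qq) * z = (1 + rea_cst q_diff * rea_cst qq) * z"
    by simp
  then show ?thesis
    by (simp only: mult.assoc distrib_right mult_1_left)
qed

lemma rea_cst_left_commute: "rea_cst a * (rea_cst b * z) = rea_cst b * (rea_cst a * z)"
  by (simp add: mult.assoc [symmetric] rea_cst_hom(2)[symmetric] mult.commute)

lemma r_hecke: "r i * r i = 1 + sc q_diff (r i)"
proof (rule opr_eqI)
  fix f :: "(nat \<Rightarrow> 'a) \<Rightarrow> 'a rea" and s :: "nat \<Rightarrow> 'a"
  have s: "s(i := s (Suc i), Suc i := s i, i := s i, Suc i := s (Suc i)) = s"
    by (simp add: fun_eq_iff)
  show "app (r i * r i) f s = app (1 + sc q_diff (r i)) f s"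
  proof (cases "s i = s (Suc i)")
    case True
    then show ?thesis by (simp add: app_r qq_square)
  next
    case False
    then show ?thesis
      by (cases "s i" "s (Suc i)" rule: linorder_cases) (auto simp: app_r s algebra_simps)
  qed
qed

text \<open>Only three neighbouring indices take part, and all coefficients depend on their relative
  order alone; the identity is checked in each ordering, with q^2 = 1 + (q - q^(-1)) q where equal
  indices occur.\<close>

lemma r_braid: "r i * r (Suc i) * r i = r (Suc i) * r i * r (Suc i)"
proof (rule opr_eqI)
  fix f :: "(nat \<Rightarrow> 'a) \<Rightarrow> 'a rea" and s :: "nat \<Rightarrow> 'a"
  define t where "t a b c = s(i := a, Suc i := b, Suc (Suc i) := c)" for a b c :: 'a
  have t: "s = t (s i) (s (Suc i)) (s (Suc (Suc i)))"
    by (simp add: t_def)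
  have r1: "app (r i) g (t a b c) = (if a = b then rea_cst qq * g (t a b c)
    else g (t b a c) + (if a < b then rea_cst q_diff * g (t a b c) else 0))" for g a b c
  proof -
    have "(t a b c)(i := b, Suc i := a) = t b a c" by (auto simp: t_def fun_eq_iff)
    then show ?thesis by (subst app_r) (simp add: t_def)
  qed
  have r2: "app (r (Suc i)) g (t a b c) = (if b = c then rea_cst qq * g (t a b c)
    else g (t a c b) + (if b < c then rea_cst q_diff * g (t a b c) else 0))" for g a b c
  proof -
    have "(t a b c)(Suc i := c, Suc (Suc i) := b) = t a c b" by (auto simp: t_def fun_eq_iff)
    then show ?thesis by (subst app_r) (simp add: t_def)
  qed
  have "app (r i * r (Suc i) * r i) f (t a b c) = app (r (Suc i) * r i * r (Suc i)) f (t a b c)"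
    for a b c
    by (cases a b rule: linorder_cases; cases b c rule: linorder_cases;
        cases a c rule: linorder_cases)
      (auto simp: r1 r2 distrib_left rea_cst_left_commute qq_square add_ac)
  from this [of "s i" "s (Suc i)" "s (Suc (Suc i))"]
  show "app (r i * r (Suc i) * r i) f s = app (r (Suc i) * r i * r (Suc i)) f s"
    by (simp only: t [symmetric])
qed

lemma r_far: "Suc i < j \<Longrightarrow> r i * r j = (r j * r i :: 'n::{finite,linorder} op)"
proof (rule opr_eqI)
  fix f :: "(nat \<Rightarrow> 'n) \<Rightarrow> 'n rea" and s :: "nat \<Rightarrow> 'n"
  assume "Suc i < j"
  then have "s(i := a, Suc i := b, j := c, Suc j := d) = s(j := c, Suc j := d, i := a, Suc i := b)"
    for a b c d
    by (auto simp: fun_eq_iff)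
  with \<open>Suc i < j\<close> show "app (r i * r j) f s = app (r j * r i) f s"
    by (simp add: app_r distrib_left rea_cst_left_commute add_ac)
qed

section \<open>Diagonal weights and invertibility of the R-matrix\<close>

definition R_weight :: "'n::linorder \<Rightarrow> 'n \<Rightarrow> Cq"
  where "R_weight x y = (if x = y then qq else if x < y then q_diff else 0)"

lemma R_matrix_mult_row:
  "(R_matrix ** X) $ (x, y) $ b = R_weight x y * X $ (x, y) $ b +
      (if x \<noteq> y then X $ (y, x) $ b else 0)"
proof -
  have "R_matrix $ (x, y) $ c * X $ c $ b = (if c = (x, y) then R_weight x y * X $ c $ b else 0) +
      (if c = (y, x) then (if x \<noteq> y then X $ c $ b else 0) else 0)" for c
    by (simp only: R_matrix_entry R_weight_def distrib_right if_distrib [of "\<lambda>u. u * _"]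
        mult_zero_left mult_1_left)
  then show ?thesis
    by (simp add: matrix_matrix_mult_def sum.distrib)
qed

text \<open>The quadratic relation is repeated for the matrix itself: it exhibits R - (q - q^(-1))
  as a two-sided inverse, so that \<open>matrix_inv\<close>, a choice operator, denotes the true
  inverse.\<close>

lemma R_matrix_hecke: "R_matrix ** R_matrix = mat 1 + mat q_diff ** R_matrix"
proof -
  have qq2: "qq * (qq * z) = z + q_diff * (qq * z)" for z
    by (simp add: q_diff_def algebra_simps)
  have k: "(mat q_diff ** X) $ i $ b = q_diff * X $ i $ b" for X ::
      "Cq ^ ('a \<times> 'a) ^ ('a \<times> 'a)" and i b
    by (simp add: matrix_matrix_mult_def mat_def if_distrib [of "\<lambda>u. u * _"] cong: if_cong)
  have R1: "R_matrix $ (x, y) $ b = R_weight x y * mat 1 $ (x, y) $ b +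
      (if x \<noteq> y then mat 1 $ (y, x) $ b else 0)" for x y :: 'a and b
    using R_matrix_mult_row [of "mat 1"] by (simp only: matrix_mul_rid)
  have "(R_matrix ** R_matrix) $ (x, y) $ b = (mat 1 + mat q_diff ** R_matrix) $ (x, y) $ b"
    for x y :: 'a and b
  proof -
    have "(R_matrix ** R_matrix) $ (x, y) $ b = R_weight x y * R_matrix $ (x, y) $ b +
        (if x \<noteq> y then R_matrix $ (y, x) $ b else 0)"
      by (rule R_matrix_mult_row)
    also have "\<dots> = mat 1 $ (x, y) $ b + q_diff * R_matrix $ (x, y) $ b"
    proof (cases "x = y")
      case True
      show ?thesis
        unfolding R1 True by (simp add: R_weight_def qq2)
    next
      case False
      then have "R_weight x y = q_diff \<and> R_weight y x = 0 \<or> R_weight x y = 0 \<and> R_weight y x =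
          q_diff"
        by (auto simp: R_weight_def)
      with False show ?thesis
        unfolding R1 by auto
    qed
    finally show ?thesis
      by (simp add: k)
  qed
  then show ?thesis
    by (simp add: vec_eq_iff split_paired_all)
qed

lemma R_matrix_invertible: "invertible (R_matrix :: Cq ^ ('a::{finite,linorder} \<times> 'a) ^ ('a \<times> 'a))"
proof -
  have c: "mat q_diff ** R_matrix = R_matrix ** (mat q_diff :: Cq ^ ('a \<times> 'a) ^ ('a \<times> 'a))"
    by (simp add: vec_eq_iff matrix_matrix_mult_def mat_def if_distrib [of "\<lambda>u. u * _"]
        if_distrib [of "\<lambda>u. _ * u"] mult.commute cong: if_cong)
  have sub: "A ** (B - C) = A ** B - A ** C" "(B - C) ** A = B ** A - C ** A"
    for A B C :: "Cq ^ ('a \<times> 'a) ^ ('a \<times> 'a)"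
    by (simp_all add: vec_eq_iff matrix_matrix_mult_def algebra_simps sum_subtractf)
  have "R_matrix ** (R_matrix - mat q_diff) = (mat 1 ::
      Cq ^ ('a \<times> 'a) ^ ('a \<times> 'a))" "(R_matrix - mat q_diff) ** R_matrix =
          (mat 1 :: Cq ^ ('a \<times> 'a) ^ ('a \<times> 'a))"
    by (simp_all add: sub R_matrix_hecke c)
  then show ?thesis
    unfolding invertible_def by blast
qed

lemma matrix_inv_R_matrix:
  "R_matrix ** matrix_inv R_matrix = mat 1" "matrix_inv R_matrix ** R_matrix = mat 1"
  using someI_ex [OF R_matrix_invertible [unfolded invertible_def]]
  unfolding matrix_inv_def by blast+

lemma r_ri [simp]: "r i * ri i = 1" "ri i * r i = 1"
  by (simp_all add: matrix_inv_R_matrix r_def ri_def map_matrix_rea_cst_one on2_one flip: on2_mult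
      map_matrix_rea_cst)

lemma r_ri_left [simp]: "r i * (ri i * X) = X" "ri i * (r i * X) = X"
  by (simp_all flip: mult.assoc)

lemma ri_eq: "ri i = (r i - sc q_diff 1 :: 'n::{finite,linorder} op)"
proof -
  have "r i * (r i - sc q_diff 1) = (1 :: 'n op)"
    by (simp add: right_diff_distrib r_hecke)
  then have "ri i * (r i * (r i - sc q_diff 1)) = (ri i :: 'n op)"
    by (simp only: mult_1_right)
  then show ?thesis unfolding r_ri_left by simp
qed

lemma r_E: "j \<noteq> i \<Longrightarrow> j \<noteq> Suc i \<Longrightarrow> r i * E j a b = E j a b * r i"
  unfolding r_def by (rule on2_E)

lemma r_left_mult: "r i * left_mult z = left_mult z * r i"
proof (rule opr_eqI)
  fix f :: "(nat \<Rightarrow> 'a) \<Rightarrow> 'a rea" and s :: "nat \<Rightarrow> 'a"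
  show "app (r i * left_mult z) f s = app (left_mult z * r i) f s"
    by (simp add: app_r distrib_left rea_cst_commute [of _ z] flip: mult.assoc)
qed

text \<open>Traces are computed on matrix units. In every term here the same two indices occur as
  rows and as columns, which later makes the weights of \<open>D\<close> cancel.\<close>

lemma r_expand: "r i = (\<Sum>x\<in>UNIV. \<Sum>y\<in>UNIV. sc (R_weight x y) (E i x x * E (Suc i) y y) +
    (if x \<noteq> y then E i x y * E (Suc i) y x else 0))"
proof (rule opr_eqI)
  fix f :: "(nat \<Rightarrow> 'a) \<Rightarrow> 'a rea" and s :: "nat \<Rightarrow> 'a"
  let ?x = "s i" and ?y = "s (Suc i)"
  have "app (\<Sum>x\<in>UNIV. \<Sum>y\<in>UNIV. sc (R_weight x y) (E i x x * E (Suc i) y y) +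
    (if x \<noteq> y then E i x y * E (Suc i) y x else 0)) f s =
    (\<Sum>x\<in>UNIV. \<Sum>y\<in>UNIV. if ?y = y then (if ?x = x then
       rea_cst (R_weight x y) * f s + (if x \<noteq> y then f (s(i := y, Suc i := x)) else 0) else 0)
           else 0)"
    unfolding sum_app
    by (intro sum.cong refl) (auto simp: fun_upd_idem)
  also have "\<dots> = app (r i) f s"
    by (simp add: app_r) (simp add: R_weight_def rea_cst_hom)
  finally show "app (r i) f s = app (\<Sum>x\<in>UNIV. \<Sum>y\<in>UNIV. sc (R_weight x y) (E i x x * E (Suc i) y y) +
    (if x \<noteq> y then E i x y * E (Suc i) y x else 0)) f s" ..
qed

section \<open>The weights of the R-trace\<close>

definition D_weight :: "'n::{finite,linorder} \<Rightarrow> Cq"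
  where "D_weight a = qq powi (2 * int (index_pos a) - 1 - 2 * int (CARD('n)))"

lemma D_weight_nonzero [simp]: "D_weight a \<noteq> 0"
  by (simp add: D_weight_def)

lemma index_pos_mono: "index_pos a < index_pos b \<longleftrightarrow> a < b"
proof -
  have "index_pos a < index_pos b" if "a < b" for a b :: 'a
    unfolding index_pos_def by (rule psubset_card_mono)
        (use that in \<open>auto intro: order_trans simp: not_le [symmetric] psubset_eq dest: equalityD2\<close>)
  then show ?thesis
    by (metis linorder_less_linear order_less_irrefl order_less_asym)
qed

lemma inj_index_pos: "inj index_pos"
  by (rule injI) (metis index_pos_mono less_irrefl linorder_neqE)

text \<open>An injection into a set of the same size; it turns sums of \<open>D_weight\<close> over
  the basis into geometric sums.\<close>

lemma range_index_pos: "range (index_pos :: 'n \<Rightarrow> nat) = {1..CARD('n::{finite,linorder})}"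
proof (rule card_subset_eq)
  show "range (index_pos :: 'n \<Rightarrow> nat) \<subseteq> {1..CARD('n)}"
  proof (rule image_subsetI)
    fix a :: 'n
    have "{a} \<subseteq> {j. j \<le> a}" by auto
    then have "card {a} \<le> card {j. j \<le> a}" by (rule card_mono [rotated]) simp
    moreover have "card {j. j \<le> a} \<le> CARD('n)" by (rule card_mono) auto
    ultimately show "index_pos a \<in> {1..CARD('n)}" by (simp add: index_pos_def)
  qed
qed (simp_all add: card_image [OF inj_index_pos])

lemma qq_powi_Suc: "b = a + 1 \<Longrightarrow> qq powi b = qq * qq powi a"
  by (simp add: power_int_add_1')

text \<open>Each term times q - q^(-1) is the difference of q^(2j - 2n) and q^(2j - 2 - 2n), so the
  sum telescopes.\<close>

lemma geometric_telescope:
  assumes "p \<le> n"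
  shows "q_diff * (\<Sum>j\<in>{p<..n}. qq powi (2 * int j - 1 - 2 * int n)) =
      1 - qq powi (2 * int p - 2 * int n)"
  using assms
proof (induction p rule: inc_induct)
  case (step p)
  have "{p<..n} = insert (Suc p) {Suc p<..n}" using step.hyps by auto
  moreover have "q_diff * qq powi (2 * int (Suc p) - 1 - 2 * int n) =
      qq powi (2 * int (Suc p) - 2 * int n) - qq powi (2 * int p - 2 * int n)"
  proof -
    have "qq powi (2 * int (Suc p) - 2 * int n) = qq * qq powi (2 * int (Suc p) - 1 - 2 * int n)"
      by (rule qq_powi_Suc) simp
    moreover have "qq * qq powi (2 * int p - 2 * int n) = qq powi (2 * int (Suc p) - 1 - 2 * int n)"
      by (rule qq_powi_Suc [symmetric]) simp
    ultimately show ?thesis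
      by (simp add: q_diff_def field_simps)
  qed
  ultimately show ?case
    using step.IH by (simp add: distrib_left)
qed simp

text \<open>The identity behind the choice of \<open>D\<close>: it is what makes the partial R-trace
  of the braid operator equal to 1.\<close>

lemma sum_D_weight_greater: "q_diff * (\<Sum>y\<in>{y. a < y}. D_weight y) =
    1 - qq * D_weight (a :: 'n::{finite,linorder})"
proof -
  have a: "index_pos a \<in> {1..CARD('n)}"
    using range_index_pos by blast
  have "index_pos ` {y. a < y} = {index_pos a<..CARD('n)}"
  proof (intro equalityI subsetI)
    fix k assume k: "k \<in> {index_pos a<..CARD('n)}"
    then have "k \<in> range (index_pos :: 'n \<Rightarrow> nat)"
      unfolding range_index_pos by simp
    with k show "k \<in> index_pos ` {y. a < y}" by (auto simp: index_pos_mono)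
  next
    fix k assume "k \<in> index_pos ` {y. a < y}"
    then obtain y where "k = index_pos y" "a < y" by blast
    moreover have "index_pos y \<in> {1..CARD('n)}"
      using range_index_pos by blast
    ultimately show "k \<in> {index_pos a<..CARD('n)}" by (simp add: index_pos_mono)
  qed
  then have "(\<Sum>y\<in>{y. a < y}. D_weight y) =
      (\<Sum>j\<in>{index_pos a<..CARD('n)}. qq powi (2 * int j - 1 - 2 * int CARD('n)))"
    unfolding D_weight_def by
        (subst sum.reindex [OF inj_on_subset [OF inj_index_pos], symmetric, unfolded o_def]) auto
  then show ?thesis
    using geometric_telescope [of "index_pos a" "CARD('n)"] a
      qq_powi_Suc [of "2 * int (index_pos a) - 2 * int CARD('n)"
        "2 * int (index_pos a) - 1 - 2 * int CARD('n)"]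
    by (simp add: D_weight_def)
qed

lemma q_diff_eq: "q_diff = qq * (1 - qq powi (- 2))"
  using qq_powi_Suc [of "- 1" "- 2"] by (simp add: q_diff_def algebra_simps)

lemma q_diff_nonzero [simp]: "q_diff \<noteq> 0"
proof
  assume "q_diff = 0"
  then have "qq * qq = 1"
    by (simp add: q_diff_def field_simps)
  then show False
    by (simp add: qq_def One_fract_def eq_fract one_pCons)
qed

lemma sum_D_weight: "(\<Sum>y\<in>UNIV. D_weight (y :: 'n::{finite,linorder})) =
    inverse qq * qint (int CARD('n))"
proof -
  have "(\<Sum>y\<in>UNIV. D_weight (y :: 'n)) =
      (\<Sum>j\<in>{0<..CARD('n)}. qq powi (2 * int j - 1 - 2 * int CARD('n)))"
  proof -
    have "index_pos ` (UNIV :: 'n set) = {0<..CARD('n)}"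
      unfolding range_index_pos by auto
    then show ?thesis
      unfolding D_weight_def by (subst sum.reindex [OF inj_index_pos, symmetric, unfolded o_def])
          auto
  qed
  then have "q_diff * (\<Sum>y\<in>UNIV. D_weight (y :: 'n)) = 1 - qq powi (- 2 * int CARD('n))"
    using geometric_telescope [of 0 "CARD('n)"] by simp
  moreover have "1 - qq powi (- 2) \<noteq> 0"
    using q_diff_nonzero unfolding q_diff_eq by auto
  ultimately show ?thesis
    by (simp add: qint_def q_diff_eq field_simps)
qed

section \<open>Partial R-traces\<close>

lemma left_commute_if:
  assumes "x * y = y * x"
  shows "x * (y * z) = y * (x * (z :: 'a::semigroup_mult))"
  by (simp add: assms flip: mult.assoc)

lemma E_left_commute: "i \<noteq> j \<Longrightarrow> E i a b * (E j c d * X) = E j c d * (E i a b * X)"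
  by (rule left_commute_if) (rule E_commute)

text \<open>The trace over factor \<open>j\<close> weighted by \<open>D\<close>. The sum over
  \<open>e\<close> puts the identity back into that factor, so the result is again an operator on
  the same space and commutes with all matrix units there.\<close>

definition ptrace :: "nat \<Rightarrow> 'n::{finite,linorder} op \<Rightarrow> 'n op"
  where "ptrace j X = (\<Sum>c\<in>UNIV. \<Sum>e\<in>UNIV. sc (D_weight c) (E j e c * X * E j c e))"

lemma ptrace_add: "ptrace j (X + Y) = ptrace j X + ptrace j Y"
  by (simp add: ptrace_def algebra_simps sc_add sum.distrib)

lemma ptrace_zero [simp]: "ptrace j 0 = 0"
  by (simp add: ptrace_def)

lemma ptrace_diff: "ptrace j (X - Y) = ptrace j X - ptrace j Y"
  using ptrace_add [of j "X - Y" Y] by simp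

lemma ptrace_sum: "ptrace j (\<Sum>i\<in>A. X i) = (\<Sum>i\<in>A. ptrace j (X i))"
  by (rule additive_sum) (simp_all add: ptrace_add)

lemma ptrace_sc [simp]: "ptrace j (sc c X) = sc c (ptrace j X)"
  by (simp add: ptrace_def sc_sum mult.commute)

lemma ptrace_left:
  assumes "\<And>a b. E j a b * Y = Y * E j a b"
  shows "ptrace j (Y * X) = Y * ptrace j X"
proof -
  have "E j a b * (Y * Z) = Y * (E j a b * Z)" for a b Z
    by (simp add: assms flip: mult.assoc)
  then show ?thesis
    by (simp add: ptrace_def sum_distrib_left mult.assoc)
qed

lemma ptrace_right:
  assumes "\<And>a b. E j a b * Y = Y * E j a b"
  shows "ptrace j (X * Y) = ptrace j X * Y"
  by (simp add: ptrace_def sum_distrib_right mult.assoc flip: assms)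

lemma ptrace_one: "ptrace j (1 :: 'n::{finite,linorder} op) =
    sc (inverse qq * qint (int CARD('n))) 1"
proof -
  have "ptrace j (1 :: 'n op) = (\<Sum>c\<in>UNIV. sc (D_weight (c :: 'n)) (\<Sum>e\<in>UNIV. E j e e))"
    by (simp add: ptrace_def E_mult flip: sc_sum)
  then show ?thesis
    by (simp only: sum_E sum_sc [symmetric] sum_D_weight)
qed

lemma ptrace_E_left: "ptrace j (E j a b * X) = sc (D_weight a) (\<Sum>e\<in>UNIV. E j e b * X * E j a e)"
proof -
  have "ptrace j (E j a b * X) = (\<Sum>c\<in>UNIV. if c =
      a then \<Sum>e\<in>UNIV. sc (D_weight c) (E j e b * X * E j c e) else 0)"
    unfolding ptrace_def by (intro sum.cong refl) (simp add: E_mult flip: mult.assoc)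
  then show ?thesis by (simp add: sc_sum)
qed

lemma ptrace_E_right: "ptrace j (X * E j a b) = sc (D_weight b) (\<Sum>e\<in>UNIV. E j e b * X * E j a e)"
proof -
  have "ptrace j (X * E j a b) = (\<Sum>c\<in>UNIV. if c =
      b then \<Sum>e\<in>UNIV. sc (D_weight c) (E j e b * X * E j a e) else 0)"
    unfolding ptrace_def by (intro sum.cong refl) (auto simp add: E_mult mult.assoc)
  then show ?thesis by (simp add: sc_sum)
qed

text \<open>On both sides only one index survives the sum over \<open>c\<close>, and what remains is
  the same operator, weighted by \<open>D_weight a\<close> or by \<open>D_weight b\<close>.\<close>

lemma ptrace_E_cyclic: "ptrace j (E j a b * X) =
    sc (D_weight a / D_weight b) (ptrace j (X * E j a b))"
  by (simp add: ptrace_E_left ptrace_E_right)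

lemma ptrace_E: "ptrace j (E j a b) = (if a = b then sc (D_weight a) 1 else 0)"
  using ptrace_E_left [of j a b 1] by (simp add: E_mult)

lemma E_ptrace: "E j a b * ptrace j X = ptrace j X * E j a b"
proof -
  have "E j a b * ptrace j X = (\<Sum>c\<in>UNIV. sc (D_weight c) (E j a c * X * E j c b))"
    unfolding ptrace_def sum_distrib_left
    by (intro sum.cong refl) (simp add: E_mult if_distrib [of "sc _"] if_distrib [of "\<lambda>u. u * _"]
        flip: mult.assoc cong: if_cong)
  moreover have "ptrace j X * E j a b = (\<Sum>c\<in>UNIV. sc (D_weight c) (E j a c * X * E j c b))"
    unfolding ptrace_def sum_distrib_right
    by (intro sum.cong refl) (simp add: E_mult if_distrib [of "sc _"] if_distrib [of "\<lambda>u. _ * u"]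
        mult.assoc cong: if_cong)
  ultimately show ?thesis by simp
qed

lemma E_ptrace_other:
  assumes "i \<noteq> j" and "E i a b * X = X * E i a b"
  shows "E i a b * ptrace j X = ptrace j X * E i a b"
proof -
  have "E i a b * (E j e c * (X * E j c e)) = E j e c * (X * (E j c e * E i a b))" for c e
    by (simp only: E_left_commute [OF assms(1)] left_commute_if [OF assms(2)] E_commute
        [OF assms(1)])
  then show ?thesis
    by (simp add: ptrace_def sum_distrib_left sum_distrib_right mult.assoc)
qed

text \<open>The components of \<open>X\<close> with respect to the matrix units in factor \<open>i\<close>.\<close>

definition slice :: "nat \<Rightarrow> 'n \<Rightarrow> 'n \<Rightarrow> 'n::{finite,linorder} op \<Rightarrow> 'n op"
  where "slice i a b X = (\<Sum>e\<in>UNIV. E i e a * X * E i b e)"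

lemma slice_expand: "X = (\<Sum>a\<in>UNIV. \<Sum>b\<in>UNIV. slice i a b X * E i a b)"
proof -
  have "(\<Sum>a\<in>UNIV. \<Sum>b\<in>UNIV. slice i a b X * E i a b) =
      (\<Sum>a\<in>UNIV. \<Sum>b\<in>UNIV. \<Sum>e\<in>UNIV. if e = a then E i a a * X * E i b b else 0)"
    unfolding slice_def sum_distrib_right
    by (intro sum.cong refl) (auto simp: E_mult mult.assoc)
  also have "\<dots> = (\<Sum>a\<in>UNIV. E i a a) * X * (\<Sum>b\<in>UNIV. E i b b)"
    by (subst sum.swap) (simp add: sum_distrib_left sum_distrib_right del: sum_E)
  finally show ?thesis by simp
qed

lemma E_slice: "E i u v * slice i a b X = slice i a b X * E i u v"
proof -
  have "E i u v * slice i a b X = (\<Sum>e\<in>UNIV. if e = v then E i u a * X * E i b v else 0)"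
    unfolding slice_def sum_distrib_left
    by (intro sum.cong refl) (auto simp: E_mult simp flip: mult.assoc)
  moreover have "slice i a b X * E i u v = (\<Sum>e\<in>UNIV. if e = u then E i u a * X * E i b v else 0)"
    unfolding slice_def sum_distrib_right
    by (intro sum.cong refl) (auto simp: E_mult mult.assoc)
  ultimately show ?thesis by simp
qed

lemma E_slice_other:
  assumes "i \<noteq> j" and "E j u v * X = X * E j u v"
  shows "E j u v * slice i a b X = slice i a b X * E j u v"
proof -
  have "E j u v * (E i e a * (X * E i b e)) = E i e a * (X * (E i b e * E j u v))" for e
    by (simp only: E_left_commute [OF assms(1) [symmetric]] left_commute_if [OF assms(2)]
        E_commute [OF assms(1) [symmetric]])
  then show ?thesis
    by (simp add: slice_def sum_distrib_left sum_distrib_right mult.assoc)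
qed

lemma r_commute:
  assumes "\<And>a b. E i a b * X = X * E i a b" and "\<And>a b. E (Suc i) a b * X = X * E (Suc i) a b"
  shows "r i * X = X * r i"
proof -
  have "E i a b * (E (Suc i) c d * X) = X * (E i a b * E (Suc i) c d)" for a b c d
    by (simp only: left_commute_if [OF assms(1)] assms(2) mult.assoc)
  then show ?thesis
    unfolding r_expand
    by (simp add: sum_distrib_left sum_distrib_right distrib_left distrib_right mult.assoc
        if_distrib [of "\<lambda>u. u * _"] if_distrib [of "\<lambda>u. _ * u"] cong: if_cong)
qed

section \<open>Partial traces of products with braid operators\<close>

lemma ptrace_E_r: "ptrace (Suc i) (E (Suc i) y z * r i) =
    (if y = z then (\<Sum>x\<in>UNIV. sc (D_weight y * R_weight x y) (E i x x)) else sc (D_weight y)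
        (E i y z))"
proof -
  have c: "E (Suc i) y z * (E i u v * E (Suc i) w x) =
      E i u v * (if z = w then E (Suc i) y x else 0)"
    for y z u v w x
    by (simp add: E_left_commute [of "Suc i" i] E_mult)
  have t: "ptrace (Suc i) (E (Suc i) y z * (E i u v * E (Suc i) w x)) =
      (if z = w \<and> y = x then sc (D_weight y) (E i u v) else 0)" for y z u v w x
    unfolding c by (subst ptrace_left) (simp_all add: E_commute [of i "Suc i"] ptrace_E)
  have "ptrace (Suc i) (E (Suc i) y z * r i) = (\<Sum>x\<in>UNIV. \<Sum>w\<in>UNIV.
      (if w = z then (if y = z then sc (D_weight y * R_weight x y) (E i x x) else 0) else 0) +
      (if x = y then (if w = z then (if y \<noteq> z then sc (D_weight y) (E i y z) else 0) else 0) else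
          0))"
    unfolding r_expand sum_distrib_left ptrace_sum
    by (intro sum.cong refl) (auto simp: distrib_left ptrace_add t mult.commute)
  also have "\<dots> = (\<Sum>x\<in>UNIV. if y = z then sc (D_weight y * R_weight x y) (E i x x) else 0) +
      (if y \<noteq> z then sc (D_weight y) (E i y z) else 0)"
    by (simp add: sum.distrib) (simp add: sum.If_cases)
  finally show ?thesis by simp
qed

lemma sum_D_weight_R_weight: "(\<Sum>y\<in>UNIV. D_weight y * (R_weight x y * c y)) =
    D_weight x * qq * c x + q_diff * (\<Sum>y\<in>{y. x < y}. D_weight y * c (y :: 'n::{finite,linorder}))"
proof -
  have "(\<Sum>y\<in>UNIV. D_weight y * (R_weight x y * c y)) = (\<Sum>y\<in>UNIV.
      (if y = x then D_weight y * qq * c y else 0) +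
          (if y \<in> {y. x < y} then q_diff * (D_weight y * c y) else 0))"
    by (intro sum.cong refl) (auto simp: R_weight_def)
  then show ?thesis
    by (simp only: sum.distrib sum.delta finite_UNIV finite sum.inter_restrict [symmetric] if_True
        UNIV_I Int_UNIV_left sum_distrib_left)
qed

lemma sum_D_weight_R_weight_R_weight:
  "(\<Sum>y\<in>UNIV. D_weight y * (R_weight a y * R_weight b y)) = (if a = b then D_weight a else 0) +
      q_diff"
proof -
  \<comment> \<open>The expression is symmetric in \<open>a\<close> and \<open>b\<close>. For
    \<open>b \<le> a\<close> the weight \<open>R_weight b y\<close> is constant on
    \<open>y > a\<close>, so the sum over the larger indices is the one known from
    \<open>sum_D_weight_greater\<close>.\<close>
  have *: "(\<Sum>y\<in>UNIV. D_weight y * (R_weight a y * R_weight b y)) =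
      (if a = b then D_weight a else 0) + q_diff"
    if "b \<le> a" for a b :: 'a
  proof -
    have "(\<Sum>y\<in>{y. a < y}. D_weight y * R_weight b y) = (\<Sum>y\<in>{y. a < y}. D_weight y) * q_diff"
      unfolding sum_distrib_right by (rule sum.cong) (use that in \<open>auto simp: R_weight_def\<close>)
    then have "(\<Sum>y\<in>UNIV. D_weight y * (R_weight a y * R_weight b y)) =
        D_weight a * qq * R_weight b a + (1 - qq * D_weight a) * q_diff"
      unfolding sum_D_weight_R_weight by (simp flip: sum_D_weight_greater add: mult.assoc)
    moreover have "D_weight a * qq * qq = D_weight a + q_diff * qq * D_weight a"
      by (simp add: q_diff_def algebra_simps)
    moreover have "R_weight b b = qq" "a \<noteq> b \<Longrightarrow> R_weight b a = q_diff"
      using that by (auto simp: R_weight_def)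
    ultimately show ?thesis
      by (cases "a = b") (simp_all add: algebra_simps)
  qed
  show ?thesis
    using * [of a b] * [of b a] by (cases "a \<le> b") (auto simp: mult_ac)
qed

lemma ptrace_r: "ptrace (Suc i) (r i) = 1"
proof -
  have "ptrace (Suc i) (r i) = ptrace (Suc i) ((\<Sum>y\<in>UNIV. E (Suc i) y y) * r i)"
    by simp
  also have "\<dots> = (\<Sum>x\<in>UNIV. sc (\<Sum>y\<in>UNIV. D_weight y * (R_weight x y * 1)) (E i x x))"
    unfolding sum_distrib_right ptrace_sum ptrace_E_r sum_sc by (subst sum.swap) simp
  also have "\<dots> = 1"
    unfolding sum_D_weight_R_weight by (simp add: sum_D_weight_greater)
  finally show ?thesis .
qed

text \<open>The case of a matrix unit in the trace of R X R. The diagonal part of R produces the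
  sums of two weights; for \<open>a = b\<close> the flip supplies the other diagonal units, which
  complete the result to a multiple of the identity.\<close>

lemma ptrace_r_E_r: "ptrace (Suc i) (r i * E i a b * r i) =
    (if a = b then sc (D_weight a) 1 else 0) + sc q_diff (E i a b)"
proof -
  have diag: "E i x x * E (Suc i) y y * E i a b = (if x = a then E i a b * E (Suc i) y y else 0)"
    and swap: "E i x y * E (Suc i) y x * E i a b =
        (if y = a then E i x b * E (Suc i) a x else 0)" for x y
    by (simp_all add: mult.assoc E_commute [of "Suc i" i]) (simp_all add: E_mult flip: mult.assoc)
  have "r i * E i a b = (\<Sum>x\<in>UNIV. \<Sum>y\<in>UNIV.
      (if x = a then sc (R_weight a y) (E i a b * E (Suc i) y y) else 0) +
      (if y = a then (if x \<noteq> a then E i x b * E (Suc i) a x else 0) else 0))"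
    unfolding r_expand sum_distrib_right
    by (intro sum.cong refl) (auto simp: distrib_right diag swap)
  also have "\<dots> = (\<Sum>y\<in>UNIV. sc (R_weight a y) (E i a b * E (Suc i) y y)) +
      (\<Sum>x\<in>UNIV. if x \<noteq> a then E i x b * E (Suc i) a x else 0)"
    by (simp add: sum.distrib) (simp add: sum.swap [of _ UNIV UNIV])
  finally have rE: "r i * E i a b = \<dots>" .
  have t: "ptrace (Suc i) (E i u v * (E (Suc i) y z * r i)) =
      E i u v * ptrace (Suc i) (E (Suc i) y z * r i)"
    for u v y z
    by (rule ptrace_left) (simp add: E_commute [of "Suc i" i])
  have "ptrace (Suc i) (r i * E i a b * r i) =
      (\<Sum>y\<in>UNIV. sc (D_weight y * (R_weight a y * R_weight b y)) (E i a b)) +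
      (\<Sum>x\<in>UNIV. if a = b then (if x \<noteq> a then sc (D_weight a) (E i x x) else 0) else 0)"
    unfolding rE distrib_right ptrace_add sum_distrib_right ptrace_sum
    by (intro arg_cong2 [of _ _ _ _ "(+)"] sum.cong refl)
      (auto simp: mult.assoc t ptrace_E_r E_mult sum_distrib_left mult_ac if_distrib [of "sc _"]
          cong: if_cong)
  also have "(\<Sum>y\<in>UNIV. sc (D_weight y * (R_weight a y * R_weight b y)) (E i a b)) =
      (if a = b then sc (D_weight a) (E i a a) else 0) + sc q_diff (E i a b)"
    by (simp add: sum_D_weight_R_weight_R_weight sc_add flip: sum_sc)
  also have "(if a = b then sc (D_weight a) (E i a a) else 0) + sc q_diff (E i a b) +
      (\<Sum>x\<in>UNIV. if a = b then (if x \<noteq> a then sc (D_weight a) (E i x x) else 0) else 0) =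
      (\<Sum>x\<in>UNIV. if a = b then sc (D_weight a) (E i x x) else 0) + sc q_diff (E i a b)"
  proof -
    have "{x. x \<noteq> a} = UNIV - {a}" by auto
    then show ?thesis
      by (simp add: sum.remove [of UNIV a] sum.If_cases)
  qed
  also have "\<dots> = (if a = b then sc (D_weight a) 1 else 0) + sc q_diff (E i a b)"
    by (simp flip: sc_sum)
  finally show ?thesis .
qed

text \<open>\<open>X\<close> may have arbitrary coefficients, but its slices commute with all matrix
  units in the factors \<open>i\<close> and \<open>Suc i\<close>; pulling them out of the trace
  leaves only the matrix units of \<open>ptrace_r_E_r\<close>.\<close>

lemma ptrace_r_X_r:
  assumes "\<And>a b. E (Suc i) a b * X = X * E (Suc i) a b"
  shows "ptrace (Suc i) (r i * X * r i) = ptrace i X + sc q_diff X"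
proof -
  have s: "r i * slice i a b X = slice i a b X * r i" for a b
    by (rule r_commute [OF E_slice E_slice_other]) (simp_all add: assms)
  have "ptrace (Suc i) (r i * X * r i) =
      ptrace (Suc i) (\<Sum>a\<in>UNIV. \<Sum>b\<in>UNIV. slice i a b X * (r i * E i a b * r i))"
    by (subst (1) slice_expand [of X i])
      (simp add: sum_distrib_left sum_distrib_right left_commute_if [OF s] mult.assoc)
  also have "\<dots> = (\<Sum>a\<in>UNIV. \<Sum>b\<in>UNIV. slice i a b X * ptrace (Suc i) (r i * E i a b * r i))"
    unfolding ptrace_sum by (intro sum.cong refl ptrace_left E_slice_other) (simp_all add: assms)
  also have "\<dots> = (\<Sum>a\<in>UNIV. sc (D_weight a) (slice i a a X)) +
      sc q_diff (\<Sum>a\<in>UNIV. \<Sum>b\<in>UNIV. slice i a b X * E i a b)"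
    unfolding ptrace_r_E_r
    by (simp add: distrib_left sum.distrib sc_sum if_distrib [of "\<lambda>u. _ * u"] cong: if_cong)
  also have "(\<Sum>a\<in>UNIV. sc (D_weight a) (slice i a a X)) = ptrace i X"
    by (simp add: ptrace_def slice_def sc_sum)
  finally show ?thesis
    by (simp only: slice_expand [symmetric])
qed

text \<open>With R^(-1) = R - (q - q^(-1)) the conjugate is R X R minus a multiple of R X or X R.
  Since the trace of R is 1, that term cancels the second term of
  \<open>ptrace_r_X_r\<close>.\<close>

lemma ptrace_conj:
  assumes "\<And>a b. E (Suc i) a b * X = X * E (Suc i) a b"
  shows "ptrace (Suc i) (r i * X * ri i) = ptrace i X" "ptrace (Suc i) (ri i * X * r i) =
      ptrace i X"
proof -
  have "ptrace (Suc i) (r i * X) = X" "ptrace (Suc i) (X * r i) = X"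
    using ptrace_left [of "Suc i" X "r i", OF assms] ptrace_right [of "Suc i" X "r i", OF assms]
    by (simp_all add: ptrace_r)
  then show "ptrace (Suc i) (r i * X * ri i) = ptrace i X" "ptrace (Suc i) (ri i * X * r i) =
      ptrace i X"
    by (simp_all add: ri_eq algebra_simps ptrace_diff ptrace_r_X_r
        [OF assms, simplified mult.assoc])
qed

section \<open>Cyclicity for braid operators\<close>

lemma ptrace_ptrace_E_cyclic:
  "ptrace i (ptrace (Suc i) (E i a b * E (Suc i) c d * X)) =
    sc (D_weight a / D_weight b * (D_weight c / D_weight d))
        (ptrace i (ptrace (Suc i) (X * (E i a b * E (Suc i) c d))))"
proof -
  have "ptrace (Suc i) (E i a b * E (Suc i) c d * X) =
      sc (D_weight c / D_weight d) (E i a b * ptrace (Suc i) (X * E (Suc i) c d))"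
    by (simp add: mult.assoc E_commute [of "Suc i" i] ptrace_left [of "Suc i" "E i a b"]
        ptrace_E_cyclic)
  then have "ptrace i (ptrace (Suc i) (E i a b * E (Suc i) c d * X)) =
      sc (D_weight a / D_weight b * (D_weight c / D_weight d))
          (ptrace i (ptrace (Suc i) (X * E (Suc i) c d) * E i a b))"
    by (simp add: ptrace_E_cyclic mult.commute)
  also have "ptrace (Suc i) (X * E (Suc i) c d) * E i a b =
      ptrace (Suc i) (X * (E i a b * E (Suc i) c d))"
    by (subst ptrace_right [symmetric]) (simp_all add: E_commute [of "Suc i" i] mult.assoc)
  finally show ?thesis .
qed

text \<open>Moving a matrix unit around the trace costs a quotient of weights. In each term of R the
  quotients from the two factors cancel, which expresses that R commutes with D tensor D.\<close>

lemma ptrace_ptrace_cyclic: "ptrace i (ptrace (Suc i) (r i * X)) =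
    ptrace i (ptrace (Suc i) (X * r i))"
  unfolding r_expand sum_distrib_left sum_distrib_right ptrace_sum distrib_left distrib_right
      ptrace_add
  by (intro arg_cong2 [of _ _ _ _ "(+)"] sum.cong refl)
    (auto simp: ptrace_ptrace_E_cyclic [of i x x for x] ptrace_ptrace_E_cyclic mult.commute)

section \<open>Operators on finitely many factors\<close>

lemma mult_commute_if:
  assumes "x * z = z * x" "y * z = z * (y :: 'a::semigroup_mult)"
  shows "x * y * z = z * (x * y)"
  by (simp add: assms(2) mult.assoc) (simp add: assms(1) flip: mult.assoc)

text \<open>Support in the factors 0, ..., n - 1 is expressed through commutation with the matrix
  units of all others, because this is the form in which partial traces use it.\<close>

definition located :: "nat \<Rightarrow> 'n::{finite,linorder} op \<Rightarrow> bool"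
  where "located n X \<longleftrightarrow> (\<forall>j\<ge>n. \<forall>a b. E j a b * X = X * E j a b)"

lemma locatedD: "located n X \<Longrightarrow> n \<le> j \<Longrightarrow> E j a b * X = X * E j a b"
  by (simp add: located_def)

lemma located_one: "located n 1"
  by (simp add: located_def)

lemma located_mult: "located n X \<Longrightarrow> located n Y \<Longrightarrow> located n (X * Y)"
  unfolding located_def by (simp add: mult_commute_if [symmetric])

lemma located_add: "located n X \<Longrightarrow> located n Y \<Longrightarrow> located n (X + Y)"
  unfolding located_def by (simp add: distrib_left distrib_right)

lemma located_sc: "located n X \<Longrightarrow> located n (sc c X)"
  unfolding located_def by simp

lemma located_r: "Suc i < n \<Longrightarrow> located n (r i)"
  unfolding located_def by (simp add: r_E)

lemma located_ri: "Suc i < n \<Longrightarrow> located n (ri i)"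
  unfolding located_def by (simp add: ri_eq algebra_simps r_E)

lemma located_ptrace: "located (Suc n) X \<Longrightarrow> located n (ptrace n X)"
  unfolding located_def by (metis E_ptrace E_ptrace_other Suc_leI le_neq_implies_less)

lemma r_located: "located n X \<Longrightarrow> n \<le> i \<Longrightarrow> r i * X = X * r i"
  by (rule r_commute) (simp_all add: locatedD)

lemma ri_commute_if: "r i * X = X * r i \<Longrightarrow> ri i * X = X * ri i"
  by (simp add: ri_eq algebra_simps)

section \<open>Iterated partial traces\<close>

primrec ptraces :: "nat \<Rightarrow> nat \<Rightarrow> 'n::{finite,linorder} op \<Rightarrow> 'n op" where
  "ptraces n 0 X = X"
| "ptraces n (Suc k) X = ptraces n k (ptrace (n + k) X)"

lemma ptraces_append: "ptraces n (k + l) X = ptraces n k (ptraces (n + k) l X)"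
  by (induction l arbitrary: X) (simp_all add: add.assoc)

lemma ptraces_add: "ptraces n k (X + Y) = ptraces n k X + ptraces n k Y"
  by (induction k arbitrary: X Y) (simp_all add: ptrace_add)

lemma ptraces_diff: "ptraces n k (X - Y) = ptraces n k X - ptraces n k Y"
  by (induction k arbitrary: X Y) (simp_all add: ptrace_diff)

lemma ptraces_sc: "ptraces n k (sc c X) = sc c (ptraces n k X)"
  by (induction k arbitrary: X) simp_all

lemma ptraces_left: "located n Y \<Longrightarrow> ptraces n k (Y * X) = Y * ptraces n k X"
  by (induction k arbitrary: X) (simp_all add: ptrace_left locatedD)

lemma ptraces_right: "located n Y \<Longrightarrow> ptraces n k (X * Y) = ptraces n k X * Y"
  by (induction k arbitrary: X) (simp_all add: ptrace_right locatedD)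

lemma ptraces_r_cyclic:
  assumes "Suc i < m"
  shows "ptraces 0 m (r i * X) = ptraces 0 m (X * r i)"
proof -
  \<comment> \<open>The factors beyond \<open>Suc i\<close> are traced out before those in which
    \<open>r i\<close> acts, and \<open>r i\<close> passes through these traces; the factors
    \<open>i\<close> and \<open>Suc i\<close> form the pair of
    \<open>ptrace_ptrace_cyclic\<close>.\<close>
  obtain l where m: "m = i + (Suc (Suc 0) + l)"
    using less_imp_Suc_add [OF assms] by auto
  have "located (Suc (Suc i)) (r i :: 'a op)"
    by (rule located_r) simp
  then have "ptraces i (Suc (Suc 0) + l) (r i * X) = ptraces i (Suc (Suc 0) + l) (X * r i)"
    unfolding ptraces_append [of i "Suc (Suc 0)" l]
      by (simp add: ptraces_left ptraces_right ptrace_ptrace_cyclic)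
  then show ?thesis
    unfolding m ptraces_append [of 0 i] by simp
qed

section \<open>Ascending and descending products\<close>

primrec up :: "(nat \<Rightarrow> 'a::monoid_mult) \<Rightarrow> nat \<Rightarrow> nat \<Rightarrow> 'a" where
  "up u n 0 = 1"
| "up u n (Suc k) = up u n k * u (n + k)"

primrec dn :: "(nat \<Rightarrow> 'a::monoid_mult) \<Rightarrow> nat \<Rightarrow> nat \<Rightarrow> 'a" where
  "dn u n 0 = 1"
| "dn u n (Suc k) = u (n + k) * dn u n k"

lemma up_Suc_left: "up u n (Suc k) = u n * up u (Suc n) k"
  by (induction k) (simp_all add: mult.assoc)

lemma dn_Suc_right: "dn u n (Suc k) = dn u (Suc n) k * u n"
  by (induction k) (simp_all add: mult.assoc)

lemma up_append: "up u n (k + l) = up u n k * up u (n + k) l"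
  by (induction l) (simp_all add: mult.assoc add.assoc)

lemma up_commute:
  "(\<And>i. n \<le> i \<Longrightarrow> i < n + k \<Longrightarrow> u i * X = X * u i) \<Longrightarrow> up u n k * X = X * up u n k"
  by (induction k) (simp_all add: mult_commute_if)

lemma dn_commute:
  "(\<And>i. n \<le> i \<Longrightarrow> i < n + k \<Longrightarrow> u i * X = X * u i) \<Longrightarrow> dn u n k * X = X * dn u n k"
  by (induction k) (simp_all add: mult_commute_if)

lemma up_dn:
  assumes "\<And>i. u i * v i = 1"
  shows "up u n k * dn v n k = 1"
proof (induction k)
  case (Suc k)
  have "u (n + k) * (v (n + k) * X) = X" for X
    by (simp add: assms flip: mult.assoc)
  with Suc show ?case by (simp add: mult.assoc)
qed simp

lemma dn_up:
  assumes "\<And>i. v i * u i = 1"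
  shows "dn v n k * up u n k = 1"
proof (induction k)
  case (Suc k)
  have "dn v n k * (up u n k * X) = X" for X
    by (simp add: Suc flip: mult.assoc)
  then show ?case by (simp add: mult.assoc assms)
qed simp

lemma located_up:
  "(\<And>i. n \<le> i \<Longrightarrow> i < n + k \<Longrightarrow> located m (u i)) \<Longrightarrow> located m (up u n k)"
  by (induction k) (simp_all add: located_one located_mult)

lemma located_dn:
  "(\<And>i. n \<le> i \<Longrightarrow> i < n + k \<Longrightarrow> located m (u i)) \<Longrightarrow> located m (dn u n k)"
  by (induction k) (simp_all add: located_one located_mult)

text \<open>Only the innermost \<open>u (n + k)\<close> and \<open>v (n + k)\<close> reach the last
  factor; the trace over it undoes them, and the remaining products conjugate a smaller operator.
  The pair \<open>u\<close>, \<open>v\<close> is general because the centrality proof shifts both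
  with R and with its inverse.\<close>

lemma ptraces_conj:
  assumes "\<And>i X. (\<And>a b. E (Suc i) a b * X = X * E (Suc i) a b) \<Longrightarrow>
      ptrace (Suc i) (u i * X * v i) = ptrace i (X :: 'n::{finite,linorder} op)"
    and "\<And>i n. Suc i < n \<Longrightarrow> located n (u i)" "\<And>i n. Suc i < n \<Longrightarrow> located n (v i)"
  shows "located (n + k) X \<Longrightarrow> ptraces (Suc n) k (up u n k * X * dn v n k) = ptraces n k X"
proof (induction k arbitrary: X)
  case (Suc k)
  have u: "located (Suc (n + k)) (up u n k)"
    by (rule located_up) (auto intro: assms(2))
  have v: "located (Suc (n + k)) (dn v n k)"
    by (rule located_dn) (auto intro: assms(3))
  have "ptrace (Suc (n + k)) (up u n (Suc k) * X * dn v n (Suc k)) =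
      ptrace (Suc (n + k)) (up u n k * ((u (n + k) * X * v (n + k)) * dn v n k))"
    by (simp add: mult.assoc)
  also have "\<dots> = up u n k * (ptrace (n + k) X * dn v n k)"
    using Suc.prems by (simp add: ptrace_left ptrace_right locatedD [OF u] locatedD [OF v]
        assms(1) locatedD)
  finally show ?case
    using Suc.IH [of "ptrace (n + k) X"] Suc.prems by (simp add: mult.assoc located_ptrace)
qed simp

lemma ptraces_conj_r: "located (n + k) X \<Longrightarrow> ptraces (Suc n) k (up r n k * X * dn ri n k) =
    ptraces n k X"
  by (rule ptraces_conj) (auto intro: ptrace_conj located_r located_ri)

lemma ptraces_conj_ri: "located (n + k) X \<Longrightarrow> ptraces (Suc n) k (up ri n k * X * dn r n k) =
    ptraces n k X"
  by (rule ptraces_conj) (auto intro: ptrace_conj located_r located_ri)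

lemmas r_up_dn [simp] = up_dn [of r ri, OF r_ri(1)] up_dn [of ri r, OF r_ri(2)]
  dn_up [of ri r, OF r_ri(2)] dn_up [of r ri, OF r_ri(1)]

text \<open>The one relation that carries \<open>r i\<close> through two neighbouring factors is
  shared by \<open>r\<close> and \<open>ri\<close>; all other factors commute with what has to
  pass.\<close>

lemma up_shift_r:
  assumes "\<And>i. u i * u (Suc i) * r i = r (Suc i) * (u i * u (Suc i))"
    and "\<And>i j. Suc i < j \<Longrightarrow> u j * r i = r i * u j" "\<And>i j. Suc i < j \<Longrightarrow> u i * r j = r j * u i"
  shows "Suc l < k \<Longrightarrow> up u n k * r (n + l) = r (Suc (n + l)) * up u n k"
proof (induction k)
  case (Suc k)
  show ?case
  proof (cases "Suc l < k")
    case True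
    then have "up u n (Suc k) * r (n + l) = up u n k * r (n + l) * u (n + k)"
      by (simp add: mult.assoc assms(2))
    with True Suc.IH show ?thesis by (simp add: mult.assoc)
  next
    case False
    with Suc.prems have k: "k = Suc l" by simp
    have "up u n l * r (Suc (n + l)) = r (Suc (n + l)) * up u n l"
      by (rule up_commute) (simp add: assms(3))
    then show ?thesis
      using assms(1) [of "n + l"] unfolding k by (simp add: mult.assoc) (simp flip: mult.assoc)
  qed
qed simp

lemma r_braid_left: "r i * (r (Suc i) * (r i * X)) = r (Suc i) * (r i * (r (Suc i) * X))"
  using r_braid [of i, THEN arg_cong, of "\<lambda>Y. Y * X"] by (simp add: mult.assoc)

lemma ri_ri_r: "ri i * ri (Suc i) * r i = r (Suc i) * (ri i * ri (Suc i) ::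
    'n::{finite,linorder} op)"
proof -
  have "r (Suc i) * (r i * (ri i * (ri (Suc i) * r i))) =
      r (Suc i) * (r i * (r (Suc i) * (ri i * (ri (Suc i) :: 'n op))))"
    by (simp flip: r_braid_left)
  then have "ri i * (ri (Suc i) * (r (Suc i) * (r i * (ri i * (ri (Suc i) * r i))))) =
      ri i * (ri (Suc i) * (r (Suc i) * (r i * (r (Suc i) * (ri i * (ri (Suc i) :: 'n op))))))"
    by (rule arg_cong)
  then show ?thesis
    unfolding r_ri_left by (simp only: mult.assoc)
qed

lemma r_ri_far: "Suc i < j \<Longrightarrow> ri j * r i = r i * ri j"
  by (rule ri_commute_if) (rule r_far [symmetric])

lemma ri_r_far: "Suc i < j \<Longrightarrow> ri i * r j = r j * ri i"
  by (rule ri_commute_if) (rule r_far)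

lemma up_r_shift: "Suc l < k \<Longrightarrow> up r n k * r (n + l) = r (Suc (n + l)) * up r n k"
  by (rule up_shift_r) (auto simp: r_braid [unfolded mult.assoc] mult.assoc intro: r_far r_far
      [symmetric])

lemma up_ri_shift: "Suc l < k \<Longrightarrow> up ri n k * r (n + l) = r (Suc (n + l)) * up ri n k"
  by (rule up_shift_r) (auto intro: ri_ri_r r_ri_far ri_r_far)

section \<open>The overlined matrices\<close>

text \<open>Factors count from 0, so \<open>overlined_op K i\<close> is the matrix with overlined
  index i + 1.\<close>

primrec overlined_op :: "'n rea ^ 'n::{finite,linorder} ^ 'n::{finite,linorder} \<Rightarrow> nat \<Rightarrow> 'n op" where
  "overlined_op K 0 = on1 0 K"
| "overlined_op K (Suc i) = r i * overlined_op K i * ri i"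

lemma located_overlined_op: "i < n \<Longrightarrow> located n (overlined_op K i)"
proof (induction i)
  case 0
  then show ?case by (simp add: located_def on1_E)
qed (simp add: located_mult located_r located_ri)

text \<open>The case with content is \<open>k\<close> two below the index of the matrix: the braid
  relation turns \<open>r k\<close> on the left into \<open>r i\<close> next to the inner matrix,
  with which it commutes, and the relation for the inverses turns it back into \<open>r k\<close> on
  the right.\<close>

lemma r_overlined_op: "k \<noteq> i \<Longrightarrow> Suc k \<noteq> i \<Longrightarrow> r k * overlined_op K i = overlined_op K i * r k"
proof (induction i)
  case (Suc i)
  show ?case
  proof (cases "k < i")
    case True
    show ?thesis
    proof (cases "Suc k = i")
      case False
      have "r k * r i = r i * (r k :: 'a op)"
        using True False by (simp add: r_far)
      with True False Suc.IH show ?thesis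
        by (simp add: mult_commute_if [symmetric] ri_commute_if)
    next
      case i: True
      have "r k * overlined_op K k * ri k * X = overlined_op K i * X" for X
        by (simp flip: i)
      have c: "r i * overlined_op K k = overlined_op K k * r i"
        by (rule r_located [OF located_overlined_op]) (use i in auto)
      have b: "r i * (ri k * ri i) = ri k * (ri i * (r k :: 'a op))"
        by (simp add: ri_ri_r flip: i mult.assoc)
      have "r k * overlined_op K (Suc i) = r k * (r i * (r k * (overlined_op K k * (ri k * ri i))))"
        by (simp add: mult.assoc flip: i)
      also have "\<dots> = r i * (r k * (r i * (overlined_op K k * (ri k * ri i))))"
        using r_braid_left [of k] by (simp add: i)
      also have "\<dots> = r i * (r k * (overlined_op K k * (r i * (ri k * ri i))))"
        by (simp add: left_commute_if [OF c])
      also have "\<dots> = overlined_op K (Suc i) * r k"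
        unfolding b by (simp add: mult.assoc flip: i)
      finally show ?thesis .
    qed
  next
    case False
    with Suc.prems show ?thesis
      by (intro r_located [OF located_overlined_op [of _ "Suc (Suc i)"]]) auto
  qed
qed (rule r_located [OF located_overlined_op], auto)

text \<open>By definition \<open>r i\<close> turns the matrix at \<open>i\<close> into the one at
  \<open>Suc i\<close>; every other factor of the product commutes with the matrix it meets.\<close>

lemma up_r_overlined_op: "l < k \<Longrightarrow> up r n k * overlined_op K (n + l) =
    overlined_op K (Suc (n + l)) * up r n k"
proof (induction k)
  case (Suc k)
  show ?case
  proof (cases "l < k")
    case True
    then have "up r n (Suc k) * overlined_op K (n + l) =
        up r n k * overlined_op K (n + l) * r (n + k)"
      by (simp add: mult.assoc r_overlined_op)
    with True Suc.IH show ?thesis by (simp add: mult.assoc)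
  next
    case False
    with Suc.prems have k: "l = k" by simp
    have "up r n k * overlined_op K (Suc (n + k)) = overlined_op K (Suc (n + k)) * up r n k"
      by (rule up_commute) (simp add: r_overlined_op del: overlined_op.simps)
    moreover have "r (n + k) * overlined_op K (n + k) = overlined_op K (Suc (n + k)) * r (n + k)"
      by (simp add: mult.assoc)
    ultimately show ?thesis
      unfolding k by (simp add: mult.assoc del: overlined_op.simps)
          (simp del: overlined_op.simps flip: mult.assoc)
  qed
qed simp

lemma overlined_op_eq: "overlined_op K k = dn r 0 k * overlined_op K 0 * up ri 0 k"
  by (induction k) (simp_all add: mult.assoc)

lemma up_shift:
  assumes "\<And>l. l < k \<Longrightarrow> up r n k * u (n + l) = u (Suc (n + l)) * up r n k"
  shows "j \<le> k \<Longrightarrow> up r n k * up u n j = up u (Suc n) j * up r n k"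
proof (induction j)
  case (Suc j)
  have "up r n k * up u n (Suc j) = up u (Suc n) j * (up r n k * u (n + j))"
    using Suc by (simp flip: mult.assoc)
  with Suc.prems show ?case by (simp add: assms mult.assoc)
qed simp

lemma dn_shift:
  assumes "\<And>l. l < k' \<Longrightarrow> up r n k * u (n + l) = u (Suc (n + l)) * up r n k"
  shows "j \<le> k' \<Longrightarrow> up r n k * dn u n j = dn u (Suc n) j * up r n k"
proof (induction j)
  case (Suc j)
  have "up r n k * dn u n (Suc j) = up r n k * u (n + j) * dn u n j"
    by (simp add: mult.assoc)
  with Suc show ?case by (simp add: assms mult.assoc)
qed simp

section \<open>The image of the Hecke algebra\<close>

inductive hecke_op :: "nat \<Rightarrow> 'n::{finite,linorder} op \<Rightarrow> bool" for m where
  one: "hecke_op m 1"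
| r: "Suc i < m \<Longrightarrow> hecke_op m (r i)"
| add: "hecke_op m X \<Longrightarrow> hecke_op m Y \<Longrightarrow> hecke_op m (X + Y)"
| sc: "hecke_op m X \<Longrightarrow> hecke_op m (sc c X)"
| mult: "hecke_op m X \<Longrightarrow> hecke_op m Y \<Longrightarrow> hecke_op m (X * Y)"

lemma hecke_op_mono: "hecke_op n X \<Longrightarrow> n \<le> m \<Longrightarrow> hecke_op m X"
  by (induction rule: hecke_op.induct) (auto intro: hecke_op.intros)

lemma located_hecke_op: "hecke_op m X \<Longrightarrow> located m X"
  by (induction rule: hecke_op.induct)
    (simp_all add: located_one located_r located_add located_sc located_mult)

lemma hecke_op_up: "n + k < m \<Longrightarrow> hecke_op m (up r n k)"
  by (induction k) (auto intro: hecke_op.intros)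

lemma hecke_op_dn: "n + k < m \<Longrightarrow> hecke_op m (dn r n k)"
  by (induction k) (auto intro: hecke_op.intros)

lemma ptraces_hecke_cyclic: "hecke_op m U \<Longrightarrow> ptraces 0 m (U * X) = ptraces 0 m (X * U)"
proof (induction arbitrary: X rule: hecke_op.induct)
  case (mult U V)
  show ?case
    using mult.IH(1) [of "V * X"] mult.IH(2) [of "X * U"] by (simp add: mult.assoc)
qed (simp_all add: ptraces_r_cyclic ptraces_add ptraces_sc distrib_left distrib_right)

lemma hecke_op_commute:
  assumes "hecke_op m U" "\<And>i. Suc i < m \<Longrightarrow> r i * X = X * r i"
  shows "U * X = X * U"
  using assms(1)
  by (induction rule: hecke_op.induct)
    (simp_all add: assms(2) distrib_left distrib_right mult_commute_if)

section \<open>The reflection equation\<close>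

lemma abs_rea_hom: "abs_rea (x + y) = abs_rea x + abs_rea y" "abs_rea (x * y) =
    abs_rea x * abs_rea y"
  "abs_rea 0 = 0"
  by (simp_all add: plus_rea.abs_eq times_rea.abs_eq zero_rea.abs_eq)

text \<open>The relators are the entries of the difference of both sides, so the quotient map
  \<open>abs_rea\<close> kills them; being a ring homomorphism, it is compatible with matrix
  products.\<close>

lemma rea_reflection:
  "map_matrix rea_cst R_matrix ** fst_factor M_matrix ** map_matrix rea_cst R_matrix ** fst_factor
      M_matrix =
   fst_factor M_matrix ** map_matrix rea_cst R_matrix ** fst_factor M_matrix **
     map_matrix rea_cst (R_matrix :: Cq ^ ('n::{finite,linorder} \<times> 'n) ^ ('n \<times> 'n))"
proof -
  define M1 :: "('n \<times> 'n) free_alg ^ ('n \<times> 'n) ^ ('n \<times> 'n)"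
    where "M1 = fst_factor (\<chi> i j. gen (i, j))"
  define R12 :: "('n \<times> 'n) free_alg ^ ('n \<times> 'n) ^ ('n \<times> 'n)"
    where "R12 = map_matrix cst R_matrix"
  have R: "map_matrix rea_cst R_matrix = map_matrix abs_rea R12"
    by (simp add: R12_def vec_eq_iff map_matrix_def rea_cst.abs_eq)
  have M: "fst_factor M_matrix = map_matrix abs_rea M1"
    by (simp add: M1_def vec_eq_iff map_matrix_def fst_factor_def M_matrix_def rea_gen.abs_eq
        zero_rea.abs_eq)
  have "abs_rea (X $ a $ b) = abs_rea (Y $ a $ b)"
    if "X = R12 ** M1 ** R12 ** M1" "Y = M1 ** R12 ** M1 ** R12" for X Y a b
  proof -
    have "(X - Y) $ a $ b \<in> rea_relators"
      unfolding rea_relators_def Let_def that R12_def M1_def by blast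
    then have "(X - Y) $ a $ b \<in> rea_ideal"
      unfolding rea_ideal_def
      by (rule subsetD [OF ring.genideal_self [OF ring_free_algebra], rotated]) simp
    then have "X $ a $ b - Y $ a $ b \<in> rea_ideal"
      by (simp only: vector_minus_component)
    then show ?thesis
      by (simp only: rea.abs_eq_iff)
  qed
  then have "map_matrix abs_rea (R12 ** M1 ** R12 ** M1) =
      map_matrix abs_rea (M1 ** R12 ** M1 ** R12)"
    by (simp add: vec_eq_iff map_matrix_def)
  then show ?thesis
    unfolding R M by (simp only: map_matrix_mult [of abs_rea, OF abs_rea_hom])
qed

abbreviation overlined_M :: "nat \<Rightarrow> 'n::{finite,linorder} op" where "overlined_M \<equiv> overlined_op
    M_matrix"

lemma reflection: "r 0 * overlined_M 0 * r 0 * overlined_M 0 =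
    overlined_M 0 * r 0 * overlined_M 0 * r 0"
  unfolding r_def overlined_op.simps on2_fst_factor [symmetric] on2_mult [symmetric]
      rea_reflection ..

text \<open>Since the second overlined matrix is R M R^(-1), the reflection equation says that R
  commutes with the product of the first two. Conjugation by \<open>r k * r (Suc k)\<close> moves
  this statement one factor to the right.\<close>

lemma r_overlined_M_overlined_M: "r k * (overlined_M k * overlined_M (Suc k)) =
    (overlined_M k * overlined_M (Suc k) * r k :: 'n::{finite,linorder} op)"
proof (induction k)
  case 0
  have "r 0 * (overlined_M 0 * overlined_M (Suc 0)) =
      (r 0 * overlined_M 0 * r 0 * overlined_M 0 * ri 0 :: 'n op)"
    by (simp add: mult.assoc)
  then show ?case
    unfolding reflection by (simp add: mult.assoc)
next
  case (Suc k)
  let ?U = "up r k 2 :: 'n op"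
  have U: "?U = r k * r (Suc k)"
    by (simp add: numeral_2_eq_2)
  have M0: "?U * overlined_M k = overlined_M (Suc k) * ?U" and M1: "?U * overlined_M (Suc k) =
      overlined_M (Suc (Suc k)) * ?U"
    using up_r_overlined_op [of 0 2 k "M_matrix ::
        'n rea ^ 'n::{finite,linorder} ^ 'n::{finite,linorder}"] up_r_overlined_op
            [of 1 2 k "M_matrix :: 'n rea ^ 'n::{finite,linorder} ^ 'n::{finite,linorder}"]
    by (simp_all del: overlined_op.simps up.simps)
  have M: "?U * (overlined_M k * overlined_M (Suc k)) =
      overlined_M (Suc k) * overlined_M (Suc (Suc k)) * ?U"
  proof -
    have "?U * (overlined_M k * overlined_M (Suc k)) =
        overlined_M (Suc k) * (?U * overlined_M (Suc k))"
      by (simp only: M0 mult.assoc [symmetric])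
    then show ?thesis
      by (simp only: M1 mult.assoc)
  qed
  have r: "r (Suc k) * ?U = ?U * r k"
    by (simp add: U mult.assoc r_braid_left [of k 1, simplified])
  have "r (Suc k) * (overlined_M (Suc k) * overlined_M (Suc (Suc k))) * ?U =
      r (Suc k) * (?U * (overlined_M k * overlined_M (Suc k)))"
    by (simp only: M mult.assoc)
  also have "\<dots> = ?U * (r k * (overlined_M k * overlined_M (Suc k)))"
    by (simp only: r mult.assoc [symmetric])
  also have "\<dots> = ?U * (overlined_M k * overlined_M (Suc k)) * r k"
    by (simp only: Suc.IH mult.assoc)
  also have "\<dots> = overlined_M (Suc k) * overlined_M (Suc (Suc k)) * (?U * r k)"
    by (simp only: M mult.assoc)
  also have "\<dots> = overlined_M (Suc k) * overlined_M (Suc (Suc k)) * r (Suc k) * ?U"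
    by (simp only: r [symmetric] mult.assoc)
  finally have "r (Suc k) * (overlined_M (Suc k) * overlined_M (Suc (Suc k))) * ?U * dn ri k 2 =
      overlined_M (Suc k) * overlined_M (Suc (Suc k)) * r (Suc k) * ?U * dn ri k 2"
    by (rule arg_cong)
  then show ?case
    unfolding mult.assoc r_up_dn by simp
qed

lemma r_up_overlined_M: "Suc i < m \<Longrightarrow> r i * up overlined_M 0 m = up overlined_M 0 m * r i"
proof -
  assume "Suc i < m"
  then obtain l where m: "m = i + (Suc (Suc 0) + l)"
    using less_imp_Suc_add [OF \<open>Suc i < m\<close>] by auto
  have 1: "r i * up overlined_M 0 i = up overlined_M 0 i * r i"
    by (rule up_commute [symmetric]) (simp add: r_overlined_op)
  have 2: "r i * up overlined_M (i + Suc (Suc 0)) l = up overlined_M (i + Suc (Suc 0)) l * r i"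
    by (rule up_commute [symmetric]) (simp add: r_overlined_op)
  have 3: "r i * up overlined_M i (Suc (Suc 0)) = up overlined_M i (Suc (Suc 0)) * r i"
    using r_overlined_M_overlined_M [of i] by simp
  show ?thesis
    unfolding m up_append add_0 by
        (simp only: left_commute_if [OF 1] left_commute_if [OF 3] 2 mult.assoc)
qed

section \<open>Central elements\<close>

text \<open>\<open>Z'\<close> is \<open>Z\<close> translated by one tensor factor. The same
  translate serves the product of the R and the product of their inverses, and it leaves factor 0
  alone, which the last clause records.\<close>

lemma hecke_op_shift:
  assumes "hecke_op k Z"
  shows "\<exists>Z'. up r 0 k * Z = Z' * up r 0 k \<and> up ri 0 k * Z = Z' * up ri 0 k \<and>
      overlined_op K 0 * Z' = Z' * overlined_op K 0"
  using assms
proof (induction rule: hecke_op.induct)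
  case one
  then show ?case by (intro exI [of _ 1]) simp
next
  case (r i)
  then show ?case
    using up_r_shift [of i k 0] up_ri_shift [of i k 0]
    by (intro exI [of _ "r (Suc i)"]) (simp add: r_overlined_op [of "Suc i" 0, simplified])
next
  case (add X Y)
  then obtain X' Y' where
    "up r 0 k * X = X' * up r 0 k" "up ri 0 k * X = X' * up ri 0 k" "overlined_op K 0 * X' =
        X' * overlined_op K 0"
    "up r 0 k * Y = Y' * up r 0 k" "up ri 0 k * Y = Y' * up ri 0 k" "overlined_op K 0 * Y' =
        Y' * overlined_op K 0"
    by blast
  then show ?case by (intro exI [of _ "X' + Y'"]) (simp add: distrib_left distrib_right)
next
  case (sc X c)
  then obtain X' where
    "up r 0 k * X = X' * up r 0 k" "up ri 0 k * X = X' * up ri 0 k" "overlined_op K 0 * X' =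
        X' * overlined_op K 0"
    by blast
  then show ?case by (intro exI [of _ "sc c X'"]) simp
next
  case (mult X Y)
  then obtain X' Y' where
    X: "up r 0 k * X = X' * up r 0 k" "up ri 0 k * X = X' * up ri 0 k" "overlined_op K 0 * X' =
        X' * overlined_op K 0" and
    Y: "up r 0 k * Y = Y' * up r 0 k" "up ri 0 k * Y = Y' * up ri 0 k" "overlined_op K 0 * Y' =
        Y' * overlined_op K 0"
    by blast
  have "up u 0 k * (X * Y) = X' * Y' * up u 0 k"
    if "up u 0 k * X = X' * up u 0 k" "up u 0 k * Y = Y' * up u 0 k" for u
    by (metis that mult.assoc)
  with X Y show ?case
    by (intro exI [of _ "X' * Y'"]) (simp add: left_commute_if mult.assoc)
qed

lemma located_up_overlined_op: "n + k \<le> m \<Longrightarrow> located m (up (overlined_op K) n k)"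
  by (rule located_up) (simp add: located_overlined_op)

text \<open>Both products equal the trace over the factors 1, ..., k of the product of k + 1
  matrices times the translate of \<open>Z\<close>. Factor 0 is left untraced: there the
  multiplication by M takes place.\<close>

lemma ptraces_overlined_M_commute:
  fixes Z :: "'n::{finite,linorder} op"
  assumes Z: "hecke_op k Z" and z: "ptraces 0 k (up overlined_M 0 k * Z) = left_mult z"
  shows "overlined_M 0 * left_mult z = left_mult z * overlined_M 0"
proof -
  obtain Z' where Z': "up r 0 k * Z = Z' * up r 0 k" "up ri 0 k * Z = Z' * up ri 0 k"
    "overlined_M 0 * Z' = Z' * overlined_M 0"
    using hecke_op_shift [OF Z] by blast
  have loc: "located (0 + k) (up overlined_M 0 k * Z)"
    by (simp add: located_mult located_up_overlined_op located_hecke_op Z)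
  have M0: "located (Suc 0) (overlined_M 0 :: 'n op)"
    by (rule located_overlined_op) simp
  have "up r 0 k * up overlined_M 0 k = (up overlined_M (Suc 0) k * up r 0 k :: 'n op)"
    by (rule up_shift [of k])
        (simp_all del: overlined_op.simps add: up_r_overlined_op [of _ k 0, simplified])
  then have "up r 0 k * (up overlined_M 0 k * Z) * dn ri 0 k =
      up overlined_M (Suc 0) k * (up r 0 k * Z) * dn ri 0 k"
    by (simp flip: mult.assoc)
  also have "\<dots> = up overlined_M (Suc 0) k * Z'"
    unfolding Z' by (simp add: mult.assoc)
  finally have "left_mult z = ptraces (Suc 0) k (up overlined_M (Suc 0) k * Z')"
    using ptraces_conj_r [OF loc] by (simp add: z)
  then have 1: "overlined_M 0 * left_mult z = ptraces (Suc 0) k (up overlined_M 0 (Suc k) * Z')"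
    by (simp only: ptraces_left [OF M0, symmetric] up_Suc_left mult.assoc)
  have "Z * dn r 0 k = dn r 0 k * (up ri 0 k * Z) * dn r 0 k"
    by (simp flip: mult.assoc)
  also have "\<dots> = dn r 0 k * Z'"
    unfolding Z' by (simp add: mult.assoc)
  finally have Zdn: "Z * dn r 0 k = dn r 0 k * Z'" .
  have "left_mult z * overlined_M 0 = ptraces (Suc 0) k
      (up ri 0 k * (up overlined_M 0 k * Z) * dn r 0 k * overlined_M 0)"
    using ptraces_conj_ri [OF loc] by (simp add: z ptraces_right [OF M0] del: overlined_op.simps)
  also have "up ri 0 k * (up overlined_M 0 k * Z) * dn r 0 k * overlined_M 0 =
      up ri 0 k * (up overlined_M 0 k * (Z * dn r 0 k) * overlined_M 0)"
    by (simp only: mult.assoc)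
  also have "\<dots> = up ri 0 k * (up overlined_M 0 k * dn r 0 k * overlined_M 0) * Z'"
    by (simp only: Zdn Z'(3) mult.assoc)
  \<comment> \<open>\<open>dn r 0 k * overlined_M 0\<close> equals
    \<open>overlined_M k * dn r 0 k\<close>: the matrix multiplied from the right becomes the last
    factor of the longer product.\<close>
  also have "up overlined_M 0 k * dn r 0 k * overlined_M 0 = up overlined_M 0 (Suc k) * dn r 0 k"
    by (simp add: overlined_op_eq [of _ k] mult.assoc)
  also have "up overlined_M 0 (Suc k) * dn r 0 k = dn r 0 k * up overlined_M 0 (Suc k)"
    by (rule dn_commute [symmetric]) (simp add: r_up_overlined_M del: up.simps)
  also have "up ri 0 k * (dn r 0 k * up overlined_M 0 (Suc k)) * Z' = up overlined_M 0 (Suc k) * Z'"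
    by (simp del: up.simps flip: mult.assoc)
  finally show ?thesis
    using 1 by simp
qed

lemma rea_induct [case_names cst gen add mult]:
  assumes "\<And>c. P (rea_cst c)" "\<And>i j. P (rea_gen i j)"
    "\<And>x y. P x \<Longrightarrow> P y \<Longrightarrow> P (x + y)" "\<And>x y. P x \<Longrightarrow> P y \<Longrightarrow> P (x * y)"
  shows "P x"
proof -
  have s: "P (abs_rea (Poly_Mapping.single (NCMon w) c))" for w c
  proof (induction w)
    case Nil
    have "Poly_Mapping.single (NCMon []) c = (cst c :: ('a \<times> 'a) free_alg)"
      by (simp add: cst_def zero_ncmon_def)
    then show ?case using assms(1) [of c] by (simp add: rea_cst.abs_eq)
  next
    case (Cons g w)
    have "Poly_Mapping.single (NCMon (g # w)) c = gen g * Poly_Mapping.single (NCMon w) c"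
      by (simp add: gen_def Poly_Mapping.mult_single plus_ncmon_def)
    then show ?case
      using assms(2) [of "fst g" "snd g"] assms(4) Cons
      by (simp add: abs_rea_hom rea_gen.abs_eq)
  qed
  have "P (abs_rea p)" for p
  proof (induction p rule: poly_mapping_add_induct)
    case zero
    then show ?case using assms(1) [of 0] by (simp add: rea_cst_hom abs_rea_hom)
  next
    case (add p u b)
    then show ?case using s [of "letters u" b] by (simp add: abs_rea_hom assms(3))
  qed
  then show ?thesis by (rule rea.abs_induct)
qed

lemma rea_centerI:
  assumes "\<And>i j. rea_gen i j * z = z * rea_gen i j"
  shows "z \<in> rea_center"
proof -
  have "z * x = x * z" for x
  proof (induction x rule: rea_induct)
    case (mult x y)
    then show ?case by (simp add: left_commute_if [OF mult(2)] mult.assoc) (metis mult.assoc)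
  qed (simp_all add: assms rea_cst_commute distrib_left distrib_right)
  then show ?thesis by (simp add: rea_center_def)
qed

lemma ptraces_overlined_M_center:
  assumes "hecke_op k Z" and "ptraces 0 k (up overlined_M 0 k * Z) = left_mult z"
  shows "z \<in> rea_center"
proof (rule rea_centerI)
  fix i j
  \<comment> \<open>The indicator of \<open>s 0 = j\<close>, evaluated at the constant sequence
    \<open>i\<close>, reads off the matrix entry in row \<open>i\<close> and column
    \<open>j\<close>.\<close>
  have "app (overlined_M 0 * left_mult z) (\<lambda>s. if s 0 = j then 1 else 0) (\<lambda>_. i) =
      app (left_mult z * overlined_M 0) (\<lambda>s. if s 0 = j then 1 else 0) (\<lambda>_. i)"
    by (simp only: ptraces_overlined_M_commute [OF assms])
  then show "rea_gen i j * z = z * rea_gen i j"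
    by (simp add: M_matrix_def if_distrib [of "\<lambda>u. _ * u"] cong: if_cong)
qed

section \<open>The q-symmetrizer as an operator\<close>

lemma qq_power_neq_1: "n > 0 \<Longrightarrow> qq ^ n \<noteq> 1"
proof
  assume n: "n > 0" and *: "qq ^ n = 1"
  have "qq ^ n = Fract ([:0, 1:] ^ n) 1" for n
    by (induction n) (simp_all add: qq_def One_fract_def)
  with * have "[:0, 1:] ^ n = (1 :: complex poly)"
    by (simp add: One_fract_def eq_fract)
  then have "degree ([:0, 1:] ^ n :: complex poly) = 0" by simp
  with n show False
    by (simp add: degree_power_eq)
qed

lemma qint_nonzero: "n > 0 \<Longrightarrow> qint (int n) \<noteq> 0"
proof -
  assume n: "n > 0"
  have *: "1 - qq powi (- 2 * int k) \<noteq> 0" if "k > 0" for k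
  proof
    assume "1 - qq powi (- 2 * int k) = 0"
    then have "qq powi (int (2 * k)) = 1"
      by (simp add: power_int_minus)
    then show False
      using qq_power_neq_1 [of "2 * k"] that unfolding power_int_of_nat by simp
  qed
  from *[OF n] *[of 1] show ?thesis
    by (simp add: qint_def)
qed

lemma qint_0 [simp]: "qint 0 = 0"
  by (simp add: qint_def)

lemma qint_add: "qq powi (- 2 * a) * qint b + qint a = qint (a + b)"
proof -
  have "qq powi (- 2 * (a + b)) = qq powi (- 2 * a) * qq powi (- 2 * b)"
    using power_int_add [of qq "- 2 * a" "- 2 * b"] by (simp add: algebra_simps)
  then show ?thesis
    by (simp add: qint_def algebra_simps diff_divide_distrib add_divide_distrib)
qed

text \<open>The recursion runs from m to m + 1, so q^(2 - 2m) becomes q^(-2m). It covers the passage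
  from 0 to 1 as well: for \<open>m = 0\<close> the coefficient \<open>qint 0\<close> kills the term
  with the truncated index \<open>m - 1\<close>.\<close>

primrec symmetrizer_op :: "nat \<Rightarrow> 'n::{finite,linorder} op" where
  "symmetrizer_op 0 = 1"
| "symmetrizer_op (Suc m) = sc (1 / qint (int (Suc m)))
    (symmetrizer_op m * (sc (qq powi (- 2 * int m)) 1 +
        sc (inverse qq * qint (int m)) (r (m - 1))) * symmetrizer_op m)"

lemma hecke_op_symmetrizer_op: "hecke_op m (symmetrizer_op m :: 'n::{finite,linorder} op)"
proof (induction m)
  case (Suc m)
  then have h: "hecke_op (Suc m) (symmetrizer_op m :: 'n op)"
    by (rule hecke_op_mono) simp
  have "hecke_op (Suc m) (sc (inverse qq * qint (int m)) (r (m - 1)) :: 'n op)"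
  proof (cases m)
    case 0
    have "hecke_op (Suc m) (sc 0 1 :: 'n op)"
      by (intro hecke_op.intros)
    with 0 show ?thesis by simp
  qed (auto intro: hecke_op.intros)
  with h show ?case
    by (auto intro!: hecke_op.intros)
qed (simp add: hecke_op.one)

text \<open>With $f = h_{n+1}$, $e = h_n$, $g = R_{n+1}$ and $k = R_n$, the recursion for \<open>f\<close> rewrites
  \<open>f g f\<close> as a combination of \<open>f g\<close> and \<open>f g k e\<close>; on the latter \<open>g\<close> acts by \<open>q\<close>
  because of the braid relation $g k g = k g k$.\<close>

lemma symmetrizer_op_step:
  fixes n :: nat
  defines "f \<equiv> symmetrizer_op (Suc n) :: 'n::{finite,linorder} op" and "e \<equiv> symmetrizer_op n ::
      'n op"
  assumes ee: "e * e = e" and ff: "f * f = f"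
    and fr: "\<And>i. i < n \<Longrightarrow> f * r i = sc qq f" and rf: "\<And>i. i < n \<Longrightarrow> r i * f = sc qq f"
  shows "symmetrizer_op (Suc (Suc n)) * r n = sc qq (symmetrizer_op (Suc (Suc n)) :: 'n op)"
    and "r n * symmetrizer_op (Suc (Suc n)) = sc qq (symmetrizer_op (Suc (Suc n)) :: 'n op)"
proof -
  define g where "g = (r n :: 'n op)"
  define k where "k = (r (n - 1) :: 'n op)"
  define \<alpha> where "\<alpha> = qq powi (- 2 * int n)"
  define \<beta> where "\<beta> = inverse qq * qint (int n)"
  define N where "N = qint (int (Suc n))"
  have N: "N \<noteq> 0"
    unfolding N_def by (rule qint_nonzero) simp
  have f: "f = sc (1 / N) (sc \<alpha> e + sc \<beta> (e * (k * e)))"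
    unfolding f_def by (simp add: e_def[symmetric] k_def \<alpha>_def \<beta>_def N_def distrib_left
        distrib_right ee mult.assoc)
  have eX: "e * (e * X) = e * X" for X
    by (simp add: ee flip: mult.assoc)
  have fX: "f * (f * X) = f * X" for X
    by (simp add: ff flip: mult.assoc)
  have fe: "f * e = f" and ef: "e * f = f"
    by (simp_all add: f distrib_left distrib_right ee eX mult.assoc)
  have feX: "f * (e * X) = f * X" and efX: "e * (f * X) = f * X" for X
    by (simp_all add: fe ef flip: mult.assoc)
  have ge: "g * e = e * g"
    unfolding g_def e_def by (rule r_located [OF located_hecke_op [OF hecke_op_symmetrizer_op]])
        simp
  have geX: "g * (e * X) = e * (g * X)" for X
    by (rule left_commute_if) (rule ge)
  have gg: "g * g = 1 + sc q_diff g" and ggX: "g * (g * X) = X + sc q_diff (g * X)" for X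
    by (simp_all add: g_def r_hecke distrib_right flip: mult.assoc)
  have Nf: "sc N f = sc \<alpha> e + sc \<beta> (e * (k * e))"
    using N by (simp add: f)
  have fgf: "sc N (f * (g * f)) = sc \<alpha> (f * g) + sc \<beta> (f * (g * (k * e)))"
  proof -
    have "sc N (f * (g * f)) = f * (g * sc N f)" by simp
    then show ?thesis
      unfolding Nf by (simp add: distrib_left sc_add ge geX feX fe)
  qed
  have fgf': "sc N (f * (g * f)) = sc \<alpha> (g * f) + sc \<beta> (e * (k * (g * f)))"
  proof -
    have "sc N (f * (g * f)) = sc N f * (g * f)" by simp
    then show ?thesis
      unfolding Nf by (simp add: distrib_right sc_add ge geX feX fe ef efX mult.assoc flip: geX)
  qed
  define t where "t = (symmetrizer_op (Suc (Suc n)) :: 'n op)"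
  define N' where "N' = qint (int (Suc (Suc n)))"
  have t: "t = sc (1 / N') (sc (qq powi (- 2 * int (Suc n))) f +
      sc (inverse qq) (sc N (f * (g * f))))"
    unfolding t_def symmetrizer_op.simps(2) [of "Suc n"] f_def [symmetric]
    by (simp add: distrib_left distrib_right mult.assoc N'_def g_def N_def ff)
  \<comment> \<open>With this coefficient the terms in \<open>f\<close> and \<open>f * g\<close>
    combine to a multiple of \<open>f * (1 + sc qq g)\<close>, and by the quadratic relation
    \<open>1 + sc qq g\<close> absorbs \<open>g\<close> with eigenvalue q.\<close>
  have a: "inverse qq * \<alpha> = qq * qq powi (- 2 * int (Suc n))"
    using qq_powi_Suc [of "- 2 * int n - 1" "- 2 * int (Suc n)"] qq_powi_Suc
        [of "- 2 * int n" "- 2 * int n - 1"]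
    by (simp add: \<alpha>_def)
  have q2: "qq * qq = 1 + qq * q_diff"
    by (simp add: q_diff_def algebra_simps)
  have lin: "sc c f + sc (qq * c) (f * g) = sc c (f * (1 + sc qq g))"
    "sc c f + sc (qq * c) (g * f) = sc c ((1 + sc qq g) * f)" for c
    by (simp_all add: distrib_left distrib_right sc_add mult.commute)
  have qg: "(1 + sc qq g) * g = sc qq (1 + sc qq g)" "g * (1 + sc qq g) = sc qq (1 + sc qq g)"
    by (simp_all add: distrib_left distrib_right sc_add gg q2)
  have kg: "sc \<beta> (f * (g * (k * e))) * g = sc qq (sc \<beta> (f * (g * (k * e))))"
    "g * sc \<beta> (e * (k * (g * f))) = sc qq (sc \<beta> (e * (k * (g * f))))"
  proof -
    have "f * (g * (k * (g * e))) = sc qq (f * (g * (k * e)))" "g * (e * (k * (g * f))) =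
        sc qq (e * (k * (g * f)))"
      if "n > 0"
    proof -
      obtain n' where n': "n = Suc n'" using \<open>n > 0\<close> by (cases n) auto
      have b: "g * (k * (g * X)) = k * (g * (k * X))" for X
        unfolding g_def k_def n' using r_braid_left [of n' X] by simp
      have fkX: "f * (k * X) = sc qq (f * X)" for X
        using fr [of n'] by (simp add: k_def n' flip: mult.assoc)
      have kf: "k * f = sc qq f"
        using rf [of n'] by (simp add: k_def n')
      show "f * (g * (k * (g * e))) = sc qq (f * (g * (k * e)))"
        by (simp add: b fkX)
      show "g * (e * (k * (g * f))) = sc qq (e * (k * (g * f)))"
        by (simp add: geX b kf)
    qed
    note * = this
    \<comment> \<open>For \<open>n = 0\<close> the index \<open>n - 1\<close> in \<open>k\<close> is
      truncated; the vanishing coefficient removes that term.\<close>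
    have \<beta>0: "n = 0 \<Longrightarrow> \<beta> = 0"
      by (simp add: \<beta>_def)
    show "sc \<beta> (f * (g * (k * e))) * g = sc qq (sc \<beta> (f * (g * (k * e))))"
      by (cases "n = 0") (simp_all add: \<beta>0 mult.assoc mult.commute ge [symmetric] *)
    show "g * sc \<beta> (e * (k * (g * f))) = sc qq (sc \<beta> (e * (k * (g * f))))"
      by (cases "n = 0") (simp_all add: \<beta>0 mult.commute *)
  qed
  have lin': "sc c (sc d X + sc d' Y) * g = sc qq (sc c (sc d X + sc d' Y))"
    if "X * g = sc qq X" "Y * g = sc qq Y" for c d d' X Y
    using that by (simp add: distrib_right sc_add mult_ac)
  have lin'': "g * sc c (sc d X + sc d' Y) = sc qq (sc c (sc d X + sc d' Y))"
    if "g * X = sc qq X" "g * Y = sc qq Y" for c d d' X Y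
    using that by (simp add: distrib_left sc_add mult_ac)
  have "t = sc (1 / N') (sc (qq powi (- 2 * int (Suc n))) (f * (1 + sc qq g)) +
      sc (inverse qq) (sc \<beta> (f * (g * (k * e)))))"
    unfolding t fgf lin(1) [symmetric] by (simp add: sc_add a add.assoc)
  moreover have "f * (1 + sc qq g) * g = sc qq (f * (1 + sc qq g))"
    by (simp only: mult.assoc qg sc_mult)
  ultimately show "symmetrizer_op (Suc (Suc n)) * r n =
      sc qq (symmetrizer_op (Suc (Suc n)) :: 'n op)"
    unfolding t_def [symmetric] g_def [symmetric] using kg(1) by (simp only: lin')
  have "t = sc (1 / N') (sc (qq powi (- 2 * int (Suc n))) ((1 + sc qq g) * f) +
      sc (inverse qq) (sc \<beta> (e * (k * (g * f)))))"
    unfolding t fgf' lin(2) [symmetric] by (simp add: sc_add a add.assoc)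
  moreover have "g * ((1 + sc qq g) * f) = sc qq ((1 + sc qq g) * f)"
    by (simp only: mult.assoc [symmetric] qg sc_mult)
  ultimately show "r n * symmetrizer_op (Suc (Suc n)) =
      sc qq (symmetrizer_op (Suc (Suc n)) :: 'n op)"
    unfolding t_def [symmetric] g_def [symmetric] using kg(2) by (simp only: lin'')
qed

lemma qint_1 [simp]: "qint 1 = 1"
  using qint_nonzero [of 1] by (auto simp: qint_def)

text \<open>Absorption yields idempotence: in the second copy of the symmetrizer each braid operator
  becomes q, and the coefficients add up to \<open>qint (int (Suc m))\<close>, which the prefactor
  cancels. The induction carries two consecutive indices because \<open>symmetrizer_op_step\<close>
  uses both.\<close>

lemma symmetrizer_op_absorb_idem:
  "(\<forall>i. Suc i < m \<longrightarrow> symmetrizer_op m * r i = sc qq (symmetrizer_op m :: 'n op) \<and>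
      r i * symmetrizer_op m = sc qq (symmetrizer_op m :: 'n op)) \<and>
    symmetrizer_op m * symmetrizer_op m = (symmetrizer_op m :: 'n::{finite,linorder} op)"
  (is "?A m \<and> ?I m")
proof -
  have idem: "?I (Suc m)" if "?A (Suc m)" "?I m" for m
  proof -
    let ?h = "symmetrizer_op m :: 'n op" and ?h' = "symmetrizer_op (Suc m) :: 'n op"
    let ?\<beta> = "inverse qq * qint (int m)" and ?N = "qint (int (Suc m))"
    have N: "?N \<noteq> 0" by (rule qint_nonzero) simp
    have hh: "?h' * ?h = ?h'"
      using that(2) by (simp add: mult.assoc)
    have r: "sc ?\<beta> (?h' * r (m - 1)) = sc (qint (int m)) ?h'"
    proof (cases m)
      case (Suc n)
      then have "?h' * r n = sc qq ?h'"
        using that(1) [rule_format, of n] by (simp del: symmetrizer_op.simps)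
      moreover have q: "inverse qq * x * qq = x" for x
        by simp
      ultimately show ?thesis
        using Suc by (simp add: q del: symmetrizer_op.simps)
    qed simp
    have "?h' * ?h' = sc (1 / ?N) (?h' * ?h * (sc (qq powi (- 2 * int m)) 1 +
        sc ?\<beta> (r (m - 1))) * ?h)"
      by (simp only: symmetrizer_op.simps(2) [of m] sc_mult mult.assoc)
    also have "\<dots> = sc (1 / ?N) ((sc (qq powi (- 2 * int m)) ?h' + sc ?\<beta> (?h' * r (m - 1))) * ?h)"
      unfolding hh by (simp add: distrib_left del: symmetrizer_op.simps)
    also have "\<dots> = sc (1 / ?N * (qq powi (- 2 * int m) * qint 1 + qint (int m))) ?h'"
      unfolding r by (simp add: distrib_right hh sc_add distrib_left del: symmetrizer_op.simps)
    also have "\<dots> = ?h'"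
    proof -
      have "qq powi (- 2 * int m) * qint 1 + qint (int m) = ?N"
        unfolding qint_add by (simp add: add.commute)
      with N show ?thesis by (simp del: symmetrizer_op.simps qint_1)
    qed
    finally show ?thesis .
  qed
  have "?A m \<and> ?I m \<and> ?A (Suc m) \<and> ?I (Suc m)"
  proof (induction m)
    case 0
    then show ?case by (simp add: qint_1 [unfolded One_nat_def])
  next
    case (Suc n)
    let ?f = "symmetrizer_op (Suc n) :: 'n op" and ?h = "symmetrizer_op (Suc (Suc n)) :: 'n op"
    have ff: "?f * ?f = ?f" using Suc by blast
    have "?A (Suc (Suc n))"
    proof (intro allI impI)
      fix i assume "Suc i < Suc (Suc n)"
      then consider "i = n" | "Suc i < Suc n" by linarith
      then show "?h * r i = sc qq ?h \<and> r i * ?h = sc qq ?h"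
      proof cases
        case 1
        then show ?thesis
          using Suc by (auto simp del: symmetrizer_op.simps intro!: symmetrizer_op_step)
      next
        case 2
        then have "?f * r i = sc qq ?f" "r i * ?f = sc qq ?f" using Suc by blast+
        then show ?thesis
          by (simp add: symmetrizer_op.simps(2) [of "Suc n"] mult.assoc mult.commute [of qq] del:
              symmetrizer_op.simps)
            (simp add: symmetrizer_op.simps(2) [of "Suc n"] del: symmetrizer_op.simps flip:
              mult.assoc)
      qed
    qed
    with Suc idem [of "Suc n"] show ?case by blast
  qed
  then show ?thesis by blast
qed

lemma symmetrizer_op_r: "Suc i < m \<Longrightarrow> symmetrizer_op m * r i = sc qq (symmetrizer_op m)"
  and r_symmetrizer_op: "Suc i < m \<Longrightarrow> r i * symmetrizer_op m = sc qq (symmetrizer_op m)"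
  and symmetrizer_op_idem: "symmetrizer_op m * symmetrizer_op m = symmetrizer_op m"
  using symmetrizer_op_absorb_idem by blast+

section \<open>Partial traces of the symmetrizer\<close>

lemma located_symmetrizer_op: "located m (symmetrizer_op m)"
  by (rule located_hecke_op) (rule hecke_op_symmetrizer_op)

text \<open>The outer symmetrizers pass through the trace; inside, the trace of 1 is q^(-1) [N]_q
  and that of R is 1, and the two coefficients add up to q^(-1) [N + m]_q by
  \<open>qint_add\<close>.\<close>

lemma ptrace_symmetrizer_op: "ptrace m (symmetrizer_op (Suc m)) =
    sc (inverse qq * qint (int (CARD('n) + m)) / qint (int (Suc m))) (symmetrizer_op m ::
        'n::{finite,linorder} op)"
proof -
  let ?\<beta> = "inverse qq * qint (int m)"
  have t: "ptrace m (symmetrizer_op m * X * symmetrizer_op m) =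
      symmetrizer_op m * ptrace m X * (symmetrizer_op m :: 'n op)" for X
    by (simp add: ptrace_left ptrace_right locatedD [OF located_symmetrizer_op])
  have b: "sc ?\<beta> (ptrace m (r (m - 1))) = (sc ?\<beta> 1 :: 'n op)"
    by (cases m) (simp_all add: ptrace_r)
  have "ptrace m (symmetrizer_op (Suc m)) = sc (1 / qint (int (Suc m)))
      (symmetrizer_op m * (sc (qq powi (- 2 * int m)) (ptrace m 1) +
          sc ?\<beta> (ptrace m (r (m - 1)))) * (symmetrizer_op m :: 'n op))"
    by (simp only: symmetrizer_op.simps ptrace_sc t ptrace_add)
  also have "\<dots> = sc (1 / qint (int (Suc m)) *
      (qq powi (- 2 * int m) * (inverse qq * qint (int CARD('n))) + ?\<beta>)) (symmetrizer_op m)"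
    unfolding b ptrace_one by
        (simp add: distrib_left distrib_right symmetrizer_op_idem flip: sc_add(2))
  also have "qq powi (- 2 * int m) * (inverse qq * qint (int CARD('n))) + ?\<beta> =
      inverse qq * (qq powi (- 2 * int m) * qint (int CARD('n)) + qint (int m))"
    by (simp add: distrib_left mult_ac)
  finally show ?thesis
    unfolding qint_add by (simp add: add.commute)
qed

lemma ptraces_up_symmetrizer_op:
  assumes "k \<le> m"
  shows "ptraces 0 m (up overlined_M 0 k * symmetrizer_op m) =
    sc (\<Prod>j\<in>{k..<m}. inverse qq * qint (int (CARD('n) + j)) / qint (int (Suc j)))
      (ptraces 0 k (up overlined_M 0 k * (symmetrizer_op k :: 'n::{finite,linorder} op)))"
  using assms
proof (induction m rule: dec_induct)
  case (step m)
  have "located m (up overlined_M 0 k :: 'n op)"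
    by (rule located_up_overlined_op) (use step in simp)
  then have "ptraces 0 (Suc m) (up overlined_M 0 k * symmetrizer_op (Suc m)) =
      sc (inverse qq * qint (int (CARD('n) + m)) / qint (int (Suc m)))
        (ptraces 0 m (up overlined_M 0 k * (symmetrizer_op m :: 'n op)))"
    by (simp add: ptrace_left locatedD ptrace_symmetrizer_op ptraces_sc del: symmetrizer_op.simps)
  with step show ?case
    by (simp add: mult_ac del: symmetrizer_op.simps)
qed simp

section \<open>Newton identities\<close>

lemma dn_step: "n > 0 \<Longrightarrow> dn u n k * u (n - 1) = dn u (n - 1) (Suc k)"
  using dn_Suc_right [of u "n - 1" k] by simp

text \<open>In \<open>V n\<close> the symmetrizer on n + 1 factors overlaps the descending braid
  product in factor \<open>n\<close>; in \<open>T n\<close> they are disjoint, so \<open>T n\<close>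
  will split into a product. The recursion of the symmetrizer gives \<open>T n\<close> plus a term
  in which one of the two copies of h_n moves around the trace and is absorbed by the other; the
  remaining \<open>r (n - 1)\<close> extends the descending product and makes the term
  \<open>V (n - 1)\<close>.\<close>

lemma ptraces_newton_step:
  fixes m :: nat
  defines "V n \<equiv> ptraces 0 m (up overlined_M 0 m * dn r n (m - Suc n) * (symmetrizer_op (Suc n) ::
      'n::{finite,linorder} op))"
    and "T n \<equiv> ptraces 0 m (up overlined_M 0 m * dn r n (m - Suc n) * (symmetrizer_op n :: 'n op))"
  assumes n: "n < m"
  shows "sc (qint (int (Suc n))) (V n) = sc (qq powi (- 2 * int n)) (T n) +
    (if n = 0 then 0 else sc (inverse qq * qint (int n)) (V (n - 1)))"
proof -
  let ?N = "qint (int (Suc n))" and ?\<beta> = "inverse qq * qint (int n)"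
  let ?G = "up overlined_M 0 m * dn r n (m - Suc n) :: 'n op" and ?h = "symmetrizer_op n :: 'n op"
  have N: "?N \<noteq> 0" by (rule qint_nonzero) simp
  have h: "hecke_op m ?h"
    by (rule hecke_op_mono [OF hecke_op_symmetrizer_op]) (use n in simp)
  have 1: "?h * up overlined_M 0 m = up overlined_M 0 m * ?h"
    by (rule hecke_op_commute [OF h]) (rule r_up_overlined_M)
  have 2: "?h * dn r n (m - Suc n) = dn r n (m - Suc n) * ?h"
    by (rule dn_commute [symmetric]) (rule r_located [OF located_symmetrizer_op])
  have G: "?G * ?h = ?h * ?G"
    by (rule mult_commute_if [OF 1 [symmetric] 2 [symmetric]])
  have "ptraces 0 m (?G * (?h * r (n - 1) * ?h)) = ptraces 0 m (?h * (?G * (r (n - 1) * ?h)))"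
    by (simp only: mult.assoc [symmetric] G)
  also have "\<dots> = ptraces 0 m (?G * r (n - 1) * (?h * ?h))"
    by (simp add: ptraces_hecke_cyclic [OF h] mult.assoc)
  also have "\<dots> = ptraces 0 m (up overlined_M 0 m * (dn r n (m - Suc n) * r (n - 1)) * ?h)"
    by (simp add: symmetrizer_op_idem mult.assoc)
  finally have B: "ptraces 0 m (?G * (?h * r (n - 1) * ?h)) = V (n - 1)" if "n > 0"
    unfolding dn_step [OF that] V_def using that n by (simp add: Suc_diff_Suc del: dn.simps)
  have "sc ?N (V n) = ptraces 0 m (?G * (?h * (sc (qq powi (- 2 * int n)) 1 +
      sc ?\<beta> (r (n - 1))) * ?h))"
    using N by (simp add: V_def ptraces_sc)
  also have "\<dots> = ptraces 0 m (sc (qq powi (- 2 * int n)) (?G * ?h) +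
      sc ?\<beta> (?G * (?h * r (n - 1) * ?h)))"
    by (simp add: distrib_left distrib_right symmetrizer_op_idem)
  also have "\<dots> = sc (qq powi (- 2 * int n)) (T n) +
      sc ?\<beta> (ptraces 0 m (?G * (?h * r (n - 1) * ?h)))"
    by (simp add: ptraces_add ptraces_sc T_def)
  finally show ?thesis
    using B by (cases "n = 0") simp_all
qed

lemma ptraces_newton_sum:
  fixes m :: nat
  defines "V n \<equiv> ptraces 0 m (up overlined_M 0 m * dn r n (m - Suc n) * (symmetrizer_op (Suc n) ::
      'n::{finite,linorder} op))"
    and "T n \<equiv> ptraces 0 m (up overlined_M 0 m * dn r n (m - Suc n) * (symmetrizer_op n :: 'n op))"
  shows "n < m \<Longrightarrow> sc (qint (int (Suc n))) (V n) =
    (\<Sum>i\<le>n. sc (qq powi (- 2 * int i) * inverse qq ^ (n - i)) (T i))"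
proof (induction n)
  case 0
  then show ?case
    using ptraces_newton_step [of 0 m, where 'n = 'n] by (simp add: V_def T_def)
next
  case (Suc n)
  have "sc (qint (int (Suc (Suc n)))) (V (Suc n)) =
      sc (qq powi (- 2 * int (Suc n))) (T (Suc n)) + sc (inverse qq * qint (int (Suc n))) (V n)"
    using ptraces_newton_step [OF Suc.prems, where 'n = 'n]
      by (simp add: V_def T_def del: symmetrizer_op.simps)
  also have "sc (inverse qq * qint (int (Suc n))) (V n) =
      sc (inverse qq) (sc (qint (int (Suc n))) (V n))"
    by simp
  also have "\<dots> = (\<Sum>i\<le>n. sc (qq powi (- 2 * int i) * inverse qq ^ (Suc n - i)) (T i))"
    using Suc by (simp add: sc_sum Suc_diff_le mult_ac)
  finally show ?case
    by (simp add: add.commute)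
qed

text \<open>Conjugation by \<open>up r n (Suc k)\<close> moves both products one factor to the right
  and leaves the trace unchanged, so a power sum may be formed in any block of consecutive
  factors.\<close>

lemma ptraces_power_shift:
  "ptraces n (Suc k) (up overlined_M n (Suc k) * dn r n k) =
    ptraces 0 (Suc k) (up overlined_M 0 (Suc k) * dn r 0 k :: 'n::{finite,linorder} op)"
proof (induction n)
  case (Suc n)
  let ?X = "up overlined_M n (Suc k) * dn r n k :: 'n op" and ?W = "up r n (Suc k) :: 'n op"
  have loc: "located (n + Suc k) ?X"
    by (intro located_mult located_up_overlined_op located_dn located_r) simp_all
  have 1: "?W * up overlined_M n (Suc k) = up overlined_M (Suc n) (Suc k) * ?W"
    by (rule up_shift [of "Suc k"])
        (simp_all add: up_r_overlined_op del: overlined_op.simps up.simps)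
  have 2: "?W * dn r n k = dn r (Suc n) k * ?W"
    by (rule dn_shift [of k]) (simp_all add: up_r_shift del: up.simps)
  have "?W * ?X * dn ri n (Suc k) = up overlined_M (Suc n) (Suc k) * (?W * dn r n k) * dn ri n
      (Suc k)"
    by (simp only: mult.assoc [symmetric] 1)
  also have "\<dots> = up overlined_M (Suc n) (Suc k) * dn r (Suc n) k * (?W * dn ri n (Suc k))"
    by (simp only: 2 mult.assoc)
  finally show ?case
    using ptraces_conj_r [OF loc] Suc by (simp del: up.simps dn.simps)
qed simp

theorem newton_identity:
  assumes s: "\<And>k. ptraces 0 k (up overlined_M 0 k * (symmetrizer_op k ::
      'n::{finite,linorder} op)) = left_mult (s k)"
    and p: "\<And>k. ptraces 0 (Suc k) (up overlined_M 0 (Suc k) * dn r 0 k :: 'n op) =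
        left_mult (p (Suc k))"
  shows "rea_cst (qint (int (Suc n))) * s (Suc n) =
    (\<Sum>i\<le>n. rea_cst (qq powi (- 2 * int i) * inverse qq ^ (n - i)) * (s i * p (Suc n - i)))"
proof -
  have T: "ptraces 0 (Suc n) (up overlined_M 0 (Suc n) * dn r i (n - i) * (symmetrizer_op i ::
      'n op)) = left_mult (s i * p (Suc n - i))"
    if "i \<le> n" for i
  proof -
    define k where "k = n - i"
    have n: "Suc n = i + Suc k"
      using that by (simp add: k_def)
    let ?P = "up overlined_M i (Suc k) * dn r i k :: 'n op"
    have 1: "up overlined_M 0 (Suc n) * dn r i k * symmetrizer_op i =
        up overlined_M 0 i * (?P * (symmetrizer_op i :: 'n op))"
      unfolding n up_append by (simp add: mult.assoc)
    have 2: "ptraces i (Suc k) (up overlined_M 0 i * (?P * symmetrizer_op i)) =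
        up overlined_M 0 i * (ptraces i (Suc k) ?P * (symmetrizer_op i :: 'n op))"
      by (simp only: ptraces_left [OF located_up_overlined_op] ptraces_right
          [OF located_symmetrizer_op] add_0 order_refl)
    \<comment> \<open>Hecke operators have coefficients in the ground field, so they commute with
      left multiplication by any element of the algebra.\<close>
    have c: "hecke_op i X \<Longrightarrow> X * left_mult z = left_mult z * (X :: 'n op)" for X z
      by (rule hecke_op_commute) (simp_all add: r_left_mult)
    have loc: "located 0 (left_mult z :: 'n op)" for z
      by (simp add: located_def E_left_mult)
    show ?thesis
    proof -
      have "ptraces 0 (Suc n) (up overlined_M 0 (Suc n) * dn r i (n - i) * (symmetrizer_op i ::
          'n op)) =
          ptraces 0 (i + Suc k) (up overlined_M 0 i * (?P * symmetrizer_op i))"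
        by (simp only: k_def [symmetric] 1 flip: n)
      also have "\<dots> = ptraces 0 i (ptraces i (Suc k) (up overlined_M 0 i * (?P * symmetrizer_op i)))"
        by (simp only: ptraces_append add_0)
      also have "\<dots> = ptraces 0 i (up overlined_M 0 i * (left_mult (p (Suc k)) * symmetrizer_op i))"
        unfolding 2 by (simp only: p ptraces_power_shift [of i k])
      also have "\<dots> = ptraces 0 i (up overlined_M 0 i * symmetrizer_op i * left_mult (p (Suc k)))"
        by (simp only: c [OF hecke_op_symmetrizer_op] mult.assoc)
      also have "\<dots> = left_mult (s i * p (Suc k))"
        by (simp only: ptraces_right [OF loc] s left_mult_hom(2))
      finally show ?thesis
        using n by simp
    qed
  qed
  have "left_mult (rea_cst (qint (int (Suc n))) * s (Suc n)) =
      sc (qint (int (Suc n)))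
          (ptraces 0 (Suc n) (up overlined_M 0 (Suc n) * (symmetrizer_op (Suc n) :: 'n op)))"
    unfolding s sc_left_mult ..
  \<comment> \<open>For \<open>m = Suc n\<close> the descending product in \<open>V n\<close> is
    empty, so \<open>V n\<close> is the operator of s_(n+1).\<close>
  also have "\<dots> = (\<Sum>i\<le>n. sc (qq powi (- 2 * int i) * inverse qq ^ (n - i))
      (left_mult (s i * p (Suc n - i))))"
    using ptraces_newton_sum [of n "Suc n", where 'n = 'n]
      by (simp add: T del: up.simps symmetrizer_op.simps ptraces.simps)
  finally have "left_mult (rea_cst (qint (int (Suc n))) * s (Suc n)) = (left_mult (\<Sum>i\<le>n.
      rea_cst (qq powi (- 2 * int i) * inverse qq ^ (n - i)) * (s i * p (Suc n - i))) :: 'n op)"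
    by (simp only: sc_left_mult left_mult_sum)
  then show ?thesis by simp
qed

section \<open>Expansion in powers of M\<close>

text \<open>Splitting off the first factor 1 - M leaves, in the term with 1, a gap at position
  \<open>k\<close>. Conjugation by \<open>up r k j\<close> closes it: this product can be moved
  around the trace and commutes with the symmetrizer. The leading \<open>k\<close> factors
  accumulate the terms with M, and the two resulting sums combine by Pascal's rule.\<close>

lemma ptraces_binomial:
  assumes "k + j \<le> m"
  shows "ptraces 0 m (up overlined_M 0 k * up (\<lambda>i. 1 - overlined_M i) k j * symmetrizer_op m) =
    (\<Sum>i\<le>j. sc ((- 1) ^ i * of_nat (j choose i)) (ptraces 0 m (up overlined_M 0 (k +
        i) * (symmetrizer_op m :: 'n::{finite,linorder} op))))"
  using assms
proof (induction j arbitrary: k)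
  case (Suc j)
  let ?f = "\<lambda>i. 1 - overlined_M i :: 'n op" and ?U = "up r k j :: 'n op"
  let ?t = "\<lambda>i. ptraces 0 m (up overlined_M 0 i * (symmetrizer_op m :: 'n op))"
  have U: "hecke_op m ?U"
    by (rule hecke_op_up) (use Suc.prems in simp)
  have Uf: "?U * up ?f k j = up ?f (Suc k) j * ?U"
    by (rule up_shift [of j])
      (simp_all add: distrib_left distrib_right left_diff_distrib right_diff_distrib
          up_r_overlined_op del: overlined_op.simps)
  have UM: "?U * up overlined_M 0 k = up overlined_M 0 k * ?U"
    by (rule up_commute, rule up_commute [symmetric]) (simp add: r_overlined_op)
  have Uh: "?U * symmetrizer_op m = symmetrizer_op m * ?U"
    by (rule hecke_op_commute [OF U]) (simp add: r_symmetrizer_op symmetrizer_op_r)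
  have "up overlined_M 0 k * up ?f (Suc k) j = up overlined_M 0 k * (up ?f (Suc k) j * ?U) * dn ri
      k j"
    by (simp add: mult.assoc)
  also have "\<dots> = ?U * (up overlined_M 0 k * up ?f k j * dn ri k j)"
    by (simp only: Uf [symmetric] mult.assoc [symmetric] UM)
  finally have "ptraces 0 m (up overlined_M 0 k * up ?f (Suc k) j * symmetrizer_op m) =
      ptraces 0 m (?U * (up overlined_M 0 k * up ?f k j * dn ri k j * symmetrizer_op m))"
    by (simp add: mult.assoc)
  also have "\<dots> = ptraces 0 m (up overlined_M 0 k * up ?f k j * (dn ri k j * ?U) * symmetrizer_op m)"
    by (simp only: ptraces_hecke_cyclic [OF U] Uh mult.assoc)
  also have "\<dots> = (\<Sum>i\<le>j. sc ((- 1) ^ i * of_nat (j choose i)) (?t (k + i)))"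
    using Suc.IH [of k] Suc.prems by simp
  finally have 1: "ptraces 0 m (up overlined_M 0 k * up ?f (Suc k) j * symmetrizer_op m) =
      (\<Sum>i\<le>j. sc ((- 1) ^ i * of_nat (j choose i)) (?t (k + i)))" .
  have "ptraces 0 m (up overlined_M 0 (Suc k) * up ?f (Suc k) j * symmetrizer_op m) =
      (\<Sum>i\<le>j. sc ((- 1) ^ i * of_nat (j choose i)) (?t (Suc k + i)))"
    using Suc.prems by (intro Suc.IH) simp
  then have 2: "ptraces 0 m
      (up overlined_M 0 k * overlined_M k * up ?f (Suc k) j * symmetrizer_op m) =
      (\<Sum>i\<le>j. sc ((- 1) ^ i * of_nat (j choose i)) (?t (k + Suc i)))"
    by (simp del: overlined_op.simps)
  have "ptraces 0 m (up overlined_M 0 k * up ?f k (Suc j) * symmetrizer_op m) =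
      (\<Sum>i\<le>j. sc ((- 1) ^ i * of_nat (j choose i)) (?t (k + i))) -
      (\<Sum>i\<le>j. sc ((- 1) ^ i * of_nat (j choose i)) (?t (k + Suc i)))"
    unfolding up_Suc_left [of ?f] 1 [symmetric] 2 [symmetric]
    by (simp add: algebra_simps ptraces_diff del: overlined_op.simps)
  also have "\<dots> = (\<Sum>i\<le>Suc j. sc ((- 1) ^ i * of_nat (Suc j choose i)) (?t (k + i)))"
  proof -
    have "(\<Sum>i\<le>Suc j. sc ((- 1) ^ i * of_nat (Suc j choose i)) (?t (k + i))) =
        ?t k + (\<Sum>i\<le>j. sc ((- 1) ^ Suc i * of_nat (Suc j choose Suc i)) (?t (k + Suc i)))"
      by (subst sum.atMost_Suc_shift) simp
    also have "(\<Sum>i\<le>j. sc ((- 1) ^ Suc i * of_nat (Suc j choose Suc i)) (?t (k + Suc i))) =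
        (\<Sum>i\<le>j. sc ((- 1) ^ Suc i * of_nat (j choose Suc i)) (?t (k + Suc i))) -
        (\<Sum>i\<le>j. sc ((- 1) ^ i * of_nat (j choose i)) (?t (k + Suc i)))"
    proof -
      have "(- 1) ^ Suc i * of_nat (Suc j choose Suc i) =
          (- 1) ^ Suc i * of_nat (j choose Suc i) - (- 1) ^ i * (of_nat (j choose i) :: Cq)" for i
        by (simp add: algebra_simps)
      then show ?thesis
        by (simp only: sc_minus(4) sum_subtractf)
    qed
    also have "?t k + ((\<Sum>i\<le>j. sc ((- 1) ^ Suc i * of_nat (j choose Suc i)) (?t (k + Suc i))) -
        (\<Sum>i\<le>j. sc ((- 1) ^ i * of_nat (j choose i)) (?t (k + Suc i)))) =
        (\<Sum>i\<le>Suc j. sc ((- 1) ^ i * of_nat (j choose i)) (?t (k + i))) -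
        (\<Sum>i\<le>j. sc ((- 1) ^ i * of_nat (j choose i)) (?t (k + Suc i)))"
      by (subst sum.atMost_Suc_shift) simp
    finally show ?thesis by (simp add: binomial_eq_0 del: up.simps binomial_Suc_Suc)
  qed
  finally show ?case .
qed simp

section \<open>Matrices on tensor powers as operators\<close>

definition splice_seq :: "'n list \<Rightarrow> (nat \<Rightarrow> 'n) \<Rightarrow> nat \<Rightarrow> 'n"
  where "splice_seq b s = (\<lambda>j. if j < length b then b ! j else s j)"

abbreviation prefix_of :: "nat \<Rightarrow> (nat \<Rightarrow> 'n) \<Rightarrow> 'n list"
  where "prefix_of m s \<equiv> map s [0..<m]"

text \<open>The bridge from matrices indexed by lists to operators: a matrix on \<open>m\<close>
  factors rewrites the first \<open>m\<close> entries of a sequence, and only its entries at lists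
  of length \<open>m\<close> are read.\<close>

lift_definition tmat_op :: "nat \<Rightarrow> ('n::finite, 'a::ring_1) tmat \<Rightarrow> ('n, 'a) opr"
  is "\<lambda>m Y f s. \<Sum>b | length b = m. Y (prefix_of m s) b * f (splice_seq b s)"
  by (simp add: algebra_simps sum.distrib sum_distrib_right)

lemma app_tmat_op: "app (tmat_op m Y) f s = (\<Sum>b | length b =
    m. Y (prefix_of m s) b * f (splice_seq b s))"
  by transfer simp

lemma finite_lists_of_length [simp]: "finite {b :: 'n::finite list. length b = m}"
  using finite_lists_length_eq [of "UNIV :: 'n set" m] by simp

lemma prefix_of_splice [simp]: "length b = m \<Longrightarrow> prefix_of m (splice_seq b s) = b"
  by (auto simp: splice_seq_def intro: nth_equalityI)

lemma splice_splice: "length b = length c \<Longrightarrow> splice_seq c (splice_seq b s) = splice_seq c s"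
  by (auto simp: splice_seq_def)

lemma splice_prefix: "splice_seq (prefix_of m s) s = s"
  by (auto simp: splice_seq_def)

lemma tmat_op_mult: "tmat_op m (tmat_mult m A B) = tmat_op m A * tmat_op m B"
proof (rule opr_eqI)
  fix f :: "(nat \<Rightarrow> 'a) \<Rightarrow> 'b" and s :: "nat \<Rightarrow> 'a"
  have "app (tmat_op m (tmat_mult m A B)) f s = (\<Sum>b | length b = m. \<Sum>c | length c = m.
      A (prefix_of m s) c * B c b * f (splice_seq b s))"
    by (simp add: app_tmat_op tmat_mult_def sum_distrib_right)
  also have "\<dots> = app (tmat_op m A * tmat_op m B) f s"
    by (subst sum.swap) (simp add: app_tmat_op sum_distrib_left mult.assoc splice_splice)
  finally show "app (tmat_op m (tmat_mult m A B)) f s = app (tmat_op m A * tmat_op m B) f s" .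
qed

lemma tmat_op_one: "tmat_op m (tmat_one m) = 1"
proof (rule opr_eqI)
  fix f :: "(nat \<Rightarrow> 'a) \<Rightarrow> 'b" and s :: "nat \<Rightarrow> 'a"
  have "app (tmat_op m (tmat_one m)) f s =
      (\<Sum>b\<in>{b. length b = m}. if prefix_of m s = b then f (splice_seq b s) else 0)"
    unfolding app_tmat_op tmat_one_def by (intro sum.cong refl) auto
  then show "app (tmat_op m (tmat_one m)) f s = app 1 f s"
    by (simp add: splice_prefix)
qed

lemma tmat_op_prod: "tmat_op m (tmat_prod m As) = prod_list (map (tmat_op m) As)"
  unfolding tmat_prod_def by (induction As) (simp_all add: tmat_op_one tmat_op_mult)

lemma tmat_op_on_factor:
  assumes "j < m"
  shows "tmat_op m (on_factor m (Suc j) K) = on1 j K"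
proof (rule opr_eqI)
  fix f :: "(nat \<Rightarrow> 'a) \<Rightarrow> 'b" and s :: "nat \<Rightarrow> 'a"
  let ?a = "prefix_of m s"
  have inj: "inj (\<lambda>c. ?a[j := c])"
    by (rule injI) (metis assms diff_zero length_map length_upt nth_list_update_eq)
  \<comment> \<open>Only lists that differ from the current prefix in position \<open>j\<close> at
    most contribute.\<close>
  have "app (tmat_op m (on_factor m (Suc j) K)) f s =
      (\<Sum>b\<in>range (\<lambda>c. ?a[j := c]). on_factor m (Suc j) K ?a b * f (splice_seq b s))"
    unfolding app_tmat_op
  proof (rule sum.mono_neutral_right)
    show "\<forall>b\<in>{b. length b = m} - range (\<lambda>c. ?a[j := c]).
        on_factor m (Suc j) K ?a b * f (splice_seq b s) = 0"
    proof
      fix b assume b: "b \<in> {b. length b = m} - range (\<lambda>c. ?a[j := c])"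
      have "\<not> (\<forall>i<m. i \<noteq> j \<longrightarrow> ?a ! i = b ! i)"
      proof
        assume "\<forall>i<m. i \<noteq> j \<longrightarrow> ?a ! i = b ! i"
        then have "b = ?a[j := b ! j]"
          using b assms by (intro nth_equalityI) (auto simp: nth_list_update)
        with b show False by blast
      qed
      then show "on_factor m (Suc j) K ?a b * f (splice_seq b s) = 0"
        by (auto simp: on_factor_def)
    qed
  qed auto
  also have "\<dots> = (\<Sum>c\<in>UNIV. on_factor m (Suc j) K ?a (?a[j := c]) * f (splice_seq (?a[j := c]) s))"
    by (subst sum.reindex [OF inj]) simp
  also have "\<dots> = app (on1 j K) f s"
  proof -
    have "splice_seq (?a[j := c]) s = s(j := c)" for c
      using assms by (auto simp: splice_seq_def nth_list_update)
    then show ?thesis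
      using assms by (simp add: on_factor_def)
  qed
  finally show "app (tmat_op m (on_factor m (Suc j) K)) f s = app (on1 j K) f s" .
qed

lemma tmat_op_on_factors:
  assumes "Suc j < m"
  shows "tmat_op m (on_factors m (Suc j) X) = on2 j X"
proof (rule opr_eqI)
  fix f :: "(nat \<Rightarrow> 'a) \<Rightarrow> 'b" and s :: "nat \<Rightarrow> 'a"
  let ?a = "prefix_of m s"
  define u where "u c = ?a[j := fst c, Suc j := snd c]" for c
  have len [simp]: "length (u c) = m" for c
    by (simp add: u_def)
  have u_nth: "u c ! i = (if i = j then fst c else if i =
      Suc j then snd c else s i)" if "i < m" for c i
    using assms that by (auto simp: u_def nth_list_update)
  have inj: "inj u"
    by (rule injI) (metis Suc_lessD assms n_not_Suc_n prod_eqI u_nth)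
  have "app (tmat_op m (on_factors m (Suc j) X)) f s =
      (\<Sum>b\<in>range u. on_factors m (Suc j) X ?a b * f (splice_seq b s))"
    unfolding app_tmat_op
  proof (rule sum.mono_neutral_right)
    show "\<forall>b\<in>{b. length b = m} - range u. on_factors m (Suc j) X ?a b * f (splice_seq b s) = 0"
    proof
      fix b assume b: "b \<in> {b. length b = m} - range u"
      have "\<not> (\<forall>i<m. i \<noteq> j \<and> i \<noteq> Suc j \<longrightarrow> ?a ! i = b ! i)"
      proof
        assume "\<forall>i<m. i \<noteq> j \<and> i \<noteq> Suc j \<longrightarrow> ?a ! i = b ! i"
        then have "b = u (b ! j, b ! Suc j)"
          using b assms by (intro nth_equalityI) (auto simp: u_nth)
        with b show False by blast
      qed
      then show "on_factors m (Suc j) X ?a b * f (splice_seq b s) = 0"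
        by (auto simp: on_factors_def)
    qed
  qed auto
  also have "\<dots> = (\<Sum>c\<in>UNIV. on_factors m (Suc j) X ?a (u c) * f (splice_seq (u c) s))"
    by (subst sum.reindex [OF inj]) simp
  also have "\<dots> = app (on2 j X) f s"
  proof -
    have "splice_seq (u c) s = s(j := fst c, Suc j := snd c)" for c
      using assms by (auto simp: splice_seq_def u_nth)
    moreover have "on_factors m (Suc j) X ?a (u c) = X $ (s j, s (Suc j)) $ c" for c
      using assms by (simp add: on_factors_def u_nth)
    ultimately show ?thesis
      by (simp add: app_on2)
  qed
  finally show "app (tmat_op m (on_factors m (Suc j) X)) f s = app (on2 j X) f s" .
qed

lemma rea_cst_sum: "rea_cst (\<Sum>i\<in>A. f i) = (\<Sum>i\<in>A. rea_cst (f i))"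
  by (rule additive_sum) (simp_all add: rea_cst_hom)

lemma tmat_cst_mult: "tmat_cst (tmat_mult m A B) = tmat_mult m (tmat_cst A) (tmat_cst B)"
  by (simp add: tmat_cst_def tmat_mult_def rea_cst_sum rea_cst_hom)

lemma tmat_cst_one: "tmat_cst (tmat_one m) = tmat_one m"
  by (auto simp: tmat_cst_def tmat_one_def fun_eq_iff rea_cst_hom)

lemma tmat_cst_prod: "tmat_cst (tmat_prod m As) = tmat_prod m (map tmat_cst As)"
  unfolding tmat_prod_def by (induction As) (simp_all add: tmat_cst_one tmat_cst_mult)

lemma tmat_cst_on_factors: "tmat_cst (on_factors m i X) = on_factors m i (map_matrix rea_cst X)"
  by (auto simp: tmat_cst_def on_factors_def fun_eq_iff rea_cst_hom map_matrix_def)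

lemma tmat_op_R: "i \<in> {1..<m} \<Longrightarrow> tmat_op m (tmat_cst (on_factors m i R_matrix)) = r (i - 1)"
  by (cases i) (simp_all add: tmat_cst_on_factors tmat_op_on_factors r_def)

lemma tmat_op_R_inv:
  "i \<in> {1..<m} \<Longrightarrow> tmat_op m (tmat_cst (on_factors m i (matrix_inv R_matrix))) = ri (i - 1)"
  by (cases i) (simp_all add: tmat_cst_on_factors tmat_op_on_factors ri_def)

lemma tmat_op_overlined: "i < m \<Longrightarrow> tmat_op m (overlined m K (Suc i)) = overlined_op K i"
proof (induction i)
  case 0
  then show ?case
    using tmat_op_on_factor [of 0 m K] by simp
qed (simp add: tmat_op_prod tmat_op_R tmat_op_R_inv mult.assoc)

lemma prod_list_upt: "prod_list (map f [1..<Suc n]) = up (\<lambda>i. f (Suc i)) 0 n"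
  by (induction n) simp_all

lemma prod_list_rev_upt: "prod_list (map f (rev [1..<Suc n])) = dn (\<lambda>i. f (Suc i)) 0 n"
  by (induction n) simp_all

lemma up_cong: "(\<And>i. n \<le> i \<Longrightarrow> i < n + k \<Longrightarrow> u i = v i) \<Longrightarrow> up u n k = up v n k"
  by (induction k) simp_all

lemma tmat_op_overlined_prod: "tmat_op m (tmat_prod m (map (overlined m K) [1..<m + 1])) =
    up (overlined_op K) 0 m"
proof -
  have "tmat_op m (tmat_prod m (map (overlined m K) [1..<m + 1])) =
      up (\<lambda>i. tmat_op m (overlined m K (Suc i))) 0 m"
    using prod_list_upt [of "\<lambda>i. tmat_op m (overlined m K i)" m] by (simp add: tmat_op_prod o_def)
  also have "\<dots> = up (overlined_op K) 0 m"
    by (rule up_cong) (simp add: tmat_op_overlined)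
  finally show ?thesis .
qed

lemma dn_cong: "(\<And>i. n \<le> i \<Longrightarrow> i < n + k \<Longrightarrow> u i = v i) \<Longrightarrow> dn u n k = dn v n k"
  by (induction k) simp_all

lemma tmat_op_R_descending:
  "tmat_op (Suc k) (tmat_cst
      (tmat_prod (Suc k) (map (\<lambda>i. on_factors (Suc k) i R_matrix) (rev [1..<Suc k])))) = dn r 0 k"
proof -
  have "tmat_op (Suc k)
      (tmat_cst (tmat_prod (Suc k) (map (\<lambda>i. on_factors (Suc k) i R_matrix) (rev [1..<Suc k])))) =
      dn (\<lambda>i. tmat_op (Suc k) (tmat_cst (on_factors (Suc k) (Suc i) R_matrix))) 0 k"
    using prod_list_rev_upt [of "\<lambda>i. tmat_op (Suc k) (tmat_cst (on_factors (Suc k) i R_matrix))" k]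
    by (simp add: tmat_op_prod tmat_cst_prod o_def rev_map del: upt_Suc)
  also have "\<dots> = dn r 0 k"
    by (rule dn_cong) (simp add: tmat_op_R)
  finally show ?thesis .
qed

section \<open>The R-trace\<close>

lemma sum_lists_Suc:
  "(\<Sum>b | length b = Suc m. g b) = (\<Sum>b | length b = m. \<Sum>d\<in>UNIV. g (b @ [d :: 'n::finite]))"
proof -
  have "(\<Sum>b | length b = m. \<Sum>d\<in>UNIV. g (b @ [d])) =
      (\<Sum>p\<in>{b. length b = m} \<times> UNIV. g (fst p @ [snd p]))"
    by (simp add: sum.cartesian_product split_def)
  also have "\<dots> = (\<Sum>b | length b = Suc m. g b)"
    by (rule sum.reindex_bij_witness [of _ "\<lambda>b. (butlast b, last b)" "\<lambda>p. fst p @ [snd p]"])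
      (auto simp: append_butlast_last_id length_Suc_conv_rev)
  finally show ?thesis ..
qed

lemma on_factor_D: "i \<in> {1..m} \<Longrightarrow> on_factor m i D_matrix a b =
    (if length a = m \<and> a = b then D_weight (a ! (i - 1)) else 0)"
proof -
  assume i: "i \<in> {1..m}"
  have "a = b" if "length a = m" "length b = m" "\<forall>j<m. j \<noteq> i - 1 \<longrightarrow> a ! j = b ! j" "a ! (i - 1) =
      b ! (i - 1)"
    using that by (intro nth_equalityI) metis+
  then show ?thesis
    using i unfolding on_factor_def by (auto simp: D_matrix_def D_weight_def)
qed

lemma tmat_prod_Cons: "tmat_prod m (A # As) = tmat_mult m A (tmat_prod m As)"
  by (simp add: tmat_prod_def)

lemma D_prod:
  "set is \<subseteq> {1..m} \<Longrightarrow> tmat_prod m (map (\<lambda>i. on_factor m i D_matrix) is) a b =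
    (if length a = m \<and> a = b then prod_list (map (\<lambda>i. D_weight (a ! (i - 1))) is) else 0)"
proof (induction "is" arbitrary: a b)
  case Nil
  then show ?case by (auto simp: tmat_prod_def tmat_one_def)
next
  case (Cons i "is")
  have "tmat_prod m (map (\<lambda>i. on_factor m i D_matrix) (i # is)) a b =
      (\<Sum>c\<in>{c. length c = m}. if a = c then (if length a = m then
        D_weight (a ! (i - 1)) * tmat_prod m (map (\<lambda>i. on_factor m i D_matrix) is) a b else 0)
            else 0)"
    unfolding list.map tmat_prod_Cons tmat_mult_def using Cons.prems
    by (intro sum.cong refl) (auto simp: on_factor_D)
  with Cons show ?case by auto
qed

text \<open>The product of the matrices \<open>D\<close> over all factors is diagonal, so it only
  contributes the product of the weights of the list entries.\<close>

lemma R_trace_eq: "R_trace m Y = (\<Sum>a | length a = m. rea_cst (prod_list (map D_weight a)) * Y a a)"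
proof -
  have 1: "map (\<lambda>i. D_weight (a ! (i - 1))) [1..<m + 1] = map D_weight a" if "length a = m" for a
    using that by (intro nth_equalityI) (auto simp del: upt_Suc)
  have 2: "tmat_mult m (tmat_cst (tmat_prod m (map (\<lambda>i. on_factor m i D_matrix) [1..<m +
      1]))) Y a a =
      (\<Sum>c\<in>{c. length c = m}. if a = c then (if length a = m then
        rea_cst (prod_list (map (\<lambda>i. D_weight (a ! (i - 1))) [1..<m +
            1])) * Y c a else 0) else 0)" for a
    unfolding tmat_mult_def tmat_cst_def
    by (intro sum.cong refl, subst D_prod) (auto simp: rea_cst_hom)
  show ?thesis
    unfolding R_trace_def 2 by (intro sum.cong refl)
        (simp only: mem_Collect_eq 1 if_True simp_thms sum.delta' finite_lists_of_length)
qed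

lemma ptrace_tmat_op:
  "ptrace m (tmat_op (Suc m) Y) = tmat_op m
      (\<lambda>a b. \<Sum>c\<in>UNIV. rea_cst (D_weight c) * Y (a @ [c]) (b @ [c :: 'n::{finite,linorder}]))"
proof (rule opr_eqI)
  fix f :: "(nat \<Rightarrow> 'n) \<Rightarrow> 'n rea" and s :: "nat \<Rightarrow> 'n"
  have p: "prefix_of (Suc m) (s(m := c)) = prefix_of m s @ [c]" for c
    by simp
  have i: "splice_seq (b @ [d]) (s(m := c)) m = d"
    "(splice_seq (b @ [d]) (s(m := c)))(m := s m) = splice_seq b s" if "length b = m" for b c d
    using that by (auto simp: splice_seq_def nth_append fun_eq_iff)
  have "app (ptrace m (tmat_op (Suc m) Y)) f s =
      (\<Sum>c\<in>UNIV. rea_cst (D_weight c) * app (tmat_op (Suc m) Y) (app (E m c (s m)) f) (s(m := c)))"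
    unfolding ptrace_def sum_app
    by (intro sum.cong refl) (simp add: if_distrib [of "\<lambda>u. _ * u"] cong: if_cong)
  also have "\<dots> = (\<Sum>c\<in>UNIV. rea_cst (D_weight c) * (\<Sum>b | length b =
      m. Y (prefix_of m s @ [c]) (b @ [c]) * f (splice_seq b s)))"
  proof (intro sum.cong refl arg_cong [of _ _ "(*) _"])
    fix c
    show "app (tmat_op (Suc m) Y) (app (E m c (s m)) f) (s(m := c)) =
        (\<Sum>b | length b = m. Y (prefix_of m s @ [c]) (b @ [c]) * f (splice_seq b s))"
      unfolding app_tmat_op sum_lists_Suc p
      by (intro sum.cong refl)
          (simp add: i if_distrib [of "\<lambda>u. _ * u"] del: fun_upd_apply cong: if_cong)
  qed
  also have "\<dots> = app (tmat_op m (\<lambda>a b. \<Sum>c\<in>UNIV. rea_cst (D_weight c) * Y (a @ [c]) (b @ [c]))) f s"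
    unfolding app_tmat_op sum_distrib_left sum_distrib_right
    by (subst sum.swap) (simp add: mult.assoc)
  finally show "app (ptrace m (tmat_op (Suc m) Y)) f s =
      app (tmat_op m (\<lambda>a b. \<Sum>c\<in>UNIV. rea_cst (D_weight c) * Y (a @ [c]) (b @ [c]))) f s" .
qed

text \<open>Splitting off the last list entry matches tracing out the last factor. At the end no
  factor is left, so the operator is multiplication by an element of the algebra.\<close>

lemma ptraces_tmat_op: "ptraces 0 m (tmat_op m Y) = left_mult (R_trace m Y)"
proof (induction m arbitrary: Y)
  case 0
  have "splice_seq [] s = s" for s :: "nat \<Rightarrow> 'a"
    by (simp add: splice_seq_def)
  then show ?case
    by (intro opr_eqI) (simp add: app_tmat_op R_trace_eq rea_cst_hom)
next
  case (Suc m)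
  show ?case
    by (simp add: ptrace_tmat_op Suc R_trace_eq sum_lists_Suc rea_cst_hom sum_distrib_left
        mult.assoc)
qed

lemma left_mult_power_sum:
  "left_mult (power_sum (Suc k)) = ptraces 0 (Suc k) (up overlined_M 0 (Suc k) * dn r 0 k ::
      'n::{finite,linorder} op)"
  unfolding power_sum_def ptraces_tmat_op [symmetric] tmat_op_mult tmat_op_overlined_prod
      tmat_op_R_descending ..

section \<open>The representation of the Hecke algebra\<close>

definition word_op :: "nat list \<Rightarrow> 'n::{finite,linorder} op"
  where "word_op w = prod_list (map (\<lambda>i. r (i - 1)) w)"

text \<open>The evaluation homomorphism of the free algebra. Hecke generators count from 1 and braid
  operators from 0, hence the shift in \<open>word_op\<close>.\<close>

definition hecke_eval :: "nat free_alg \<Rightarrow> 'n::{finite,linorder} op"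
  where "hecke_eval p =
      (\<Sum>w\<in>Poly_Mapping.keys p. sc (Poly_Mapping.lookup p w) (word_op (letters w)))"

lemma hecke_eval_superset:
  "finite S \<Longrightarrow> Poly_Mapping.keys p \<subseteq> S \<Longrightarrow>
    hecke_eval p = (\<Sum>w\<in>S. sc (Poly_Mapping.lookup p w) (word_op (letters w)))"
  unfolding hecke_eval_def by (rule sum.mono_neutral_left) (auto simp: in_keys_iff)

lemma hecke_eval_add: "hecke_eval (p + q) = hecke_eval p + hecke_eval q"
proof -
  let ?S = "Poly_Mapping.keys p \<union> Poly_Mapping.keys q"
  have "finite ?S" by simp
  then show ?thesis
    using Poly_Mapping.keys_add [of p q]
    by (simp add: hecke_eval_superset [of ?S] lookup_add sc_add sum.distrib)
qed

lemma hecke_eval_zero [simp]: "hecke_eval 0 = 0"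
  by (simp add: hecke_eval_def)

lemma hecke_eval_uminus: "hecke_eval (- p) = - hecke_eval p"
  using hecke_eval_add [of p "- p"] by (simp add: eq_neg_iff_add_eq_0 add.commute)

lemma hecke_eval_single: "hecke_eval (Poly_Mapping.single w c) = sc c (word_op (letters w))"
  by (simp add: hecke_eval_def)

lemma hecke_eval_mult: "hecke_eval (p * q) = hecke_eval p * hecke_eval q"
proof (induction p rule: poly_mapping_add_induct)
  case (add p u b)
  have "hecke_eval (Poly_Mapping.single u b * q) =
      hecke_eval (Poly_Mapping.single u b) * hecke_eval q"
  proof (induction q rule: poly_mapping_add_induct)
    case (add q v c)
    have "hecke_eval (Poly_Mapping.single u b * Poly_Mapping.single v c) =
        hecke_eval (Poly_Mapping.single u b) * hecke_eval (Poly_Mapping.single v c)"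
      by (simp add: Poly_Mapping.mult_single hecke_eval_single plus_ncmon_def word_op_def
          mult.commute)
    with add show ?case by (simp add: distrib_left hecke_eval_add)
  qed simp
  with add show ?case by (simp add: distrib_right hecke_eval_add)
qed simp

lemma hecke_eval_cst: "hecke_eval (cst c) = sc c 1"
  by (simp add: cst_def hecke_eval_single zero_ncmon_def word_op_def)

lemma hecke_eval_one: "hecke_eval 1 = 1"
  using hecke_eval_cst [of 1] by (simp add: gen_cst)

lemma hecke_eval_gen: "hecke_eval (gen i) = r (i - 1)"
  by (simp add: gen_def hecke_eval_single word_op_def)

lemma hecke_eval_diff: "hecke_eval (p - q) = hecke_eval p - hecke_eval q"
  using hecke_eval_add [of p "- q"] by (simp add: hecke_eval_uminus)

lemma tmat_op_free_rep:
  assumes "p \<in> carrier (free_algebra {1..<m})"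
  shows "tmat_op m (tmat_cst (free_rep m p)) = hecke_eval p"
proof (rule opr_eqI)
  fix f :: "(nat \<Rightarrow> 'a) \<Rightarrow> 'a rea" and s :: "nat \<Rightarrow> 'a"
  let ?T = "\<lambda>w. tmat_prod m (map (\<lambda>i. on_factors m i R_matrix) (letters w)) :: ('a, Cq) tmat"
  have w: "tmat_op m (tmat_cst (?T w)) = word_op (letters w)" if "w \<in> Poly_Mapping.keys p" for w
  proof -
    have "set (letters w) \<subseteq> {1..<m}"
      using assms that by (auto simp: carrier_free_algebra)
    then show ?thesis
      unfolding tmat_cst_prod tmat_op_prod word_op_def
      by (auto simp: tmat_op_R intro!: arg_cong [of _ _ prod_list] map_cong)
  qed
  have "app (tmat_op m (tmat_cst (free_rep m p))) f s =
      (\<Sum>w\<in>Poly_Mapping.keys p. rea_cst (Poly_Mapping.lookup p w) * app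
          (tmat_op m (tmat_cst (?T w))) f s)"
    unfolding app_tmat_op free_rep_def tmat_cst_def rea_cst_sum sum_distrib_right sum_distrib_left
    by (subst sum.swap) (simp add: rea_cst_hom mult.assoc)
  also have "\<dots> = app (hecke_eval p) f s"
    by (simp add: w hecke_eval_def)
  finally show "app (tmat_op m (tmat_cst (free_rep m p))) f s = app (hecke_eval p) f s" .
qed

section \<open>The representation is well defined on cosets\<close>

lemma rea_cst_inject: "rea_cst a = (rea_cst b :: 'n::{finite,linorder} rea) \<Longrightarrow> a = b"
proof (rule ccontr)
  assume eq: "rea_cst a = (rea_cst b :: 'n rea)" and "a \<noteq> b"
  have "rea_cst (inverse (a - b)) * rea_cst (a - b) = (1 :: 'n rea)"
    using \<open>a \<noteq> b\<close> by (simp flip: rea_cst_hom)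
  moreover have "rea_cst (a - b) = (0 :: 'n rea)"
    using eq rea_cst_hom(1) [of "a - b" b, where 'a = 'n] by simp
  ultimately show False by simp
qed

lemma tmat_op_inject:
  assumes "tmat_op m X = (tmat_op m Y :: ('n::finite, 'a::ring_1) opr)" and "length a =
      m" "length b = m"
  shows "X a b = Y a b"
proof -
  have "app (tmat_op m Z) (\<lambda>t. if prefix_of m t = b then 1 else 0) (splice_seq a undefined) = Z a b"
    for Z :: "('n, 'a) tmat"
  proof -
    have "app (tmat_op m Z) (\<lambda>t. if prefix_of m t = b then 1 else 0) (splice_seq a undefined) =
        (\<Sum>c\<in>{c. length c = m}. if c = b then Z a c else 0)"
      unfolding app_tmat_op using assms(2) by (intro sum.cong refl) simp
    then show ?thesis using assms(3) by simp
  qed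
  from this [of X] this [of Y] show ?thesis
    by (simp add: assms(1))
qed

lemma tmat_prod_on_factors_outside:
  "length a \<noteq> m \<or> length b \<noteq> m \<Longrightarrow> tmat_prod m (map (\<lambda>i. on_factors m i X) w) a b = 0"
proof (induction w arbitrary: a)
  case Nil
  then show ?case by (auto simp: tmat_prod_def tmat_one_def)
next
  case (Cons i w)
  then have "on_factors m i X a c * tmat_prod m (map (\<lambda>i. on_factors m i X) w) c b = 0" for c
    by (cases "length a = m") (simp_all add: on_factors_def)
  then show ?case
    by (simp only: list.map tmat_prod_Cons tmat_mult_def sum.neutral_const)
qed

text \<open>Entries at lists of length \<open>m\<close> are recovered from the operator, and all
  others vanish for every word; so equality may be tested on operators, where the Hecke relations
  are known.\<close>

lemma free_rep_eqI:
  assumes "p \<in> carrier (free_algebra {1..<m})" "q \<in> carrier (free_algebra {1..<m})"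
    and "hecke_eval p = (hecke_eval q :: 'n::{finite,linorder} op)"
  shows "free_rep m p = (free_rep m q :: ('n, Cq) tmat)"
proof (intro ext)
  fix a b :: "'n list"
  show "free_rep m p a b = free_rep m q a b"
  proof (cases "length a = m \<and> length b = m")
    case True
    have "tmat_op m (tmat_cst (free_rep m p)) = (tmat_op m (tmat_cst (free_rep m q)) :: 'n op)"
      by (simp only: tmat_op_free_rep [OF assms(1)] tmat_op_free_rep [OF assms(2)] assms(3))
    from tmat_op_inject [OF this] True
    have "tmat_cst (free_rep m p) a b = tmat_cst (free_rep m q) a b"
      by blast
    then show ?thesis
      unfolding tmat_cst_def by (rule rea_cst_inject)
  next
    case False
    then show ?thesis
      by (auto simp: free_rep_def tmat_prod_on_factors_outside)
  qed
qed

lemma hecke_eval_hecke_relators: "p \<in> hecke_relators m \<Longrightarrow> hecke_eval p =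
    (0 :: 'n::{finite,linorder} op)"
proof -
  have far: "r (i - 1) * r (j - 1) = (r (j - 1) * r (i - 1) :: 'n op)"
    if "i \<in> {1..<m}" "j \<in> {1..<m}" "\<bar>int i - int j\<bar> > 1" for i j
  proof (cases "i < j")
    case True
    then show ?thesis using that by (intro r_far) auto
  next
    case False
    then show ?thesis using that by (intro r_far [symmetric]) auto
  qed
  have braid: "r (i - 1) * (r i * r (i - 1)) = (r i * (r (i - 1) * r i) :: 'n op)"
    if "i \<in> {1..<m}" for i
    using that r_braid [of "i - 1", where 'a = 'n] by (simp add: mult.assoc)
  assume "p \<in> hecke_relators m"
  then show ?thesis
    unfolding hecke_relators_def
    by (auto simp: hecke_eval_diff hecke_eval_mult hecke_eval_gen hecke_eval_add hecke_eval_one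
        hecke_eval_cst r_hecke q_diff_def far braid mult.assoc
      simp del: One_nat_def)
qed

lemma hecke_relators_carrier: "hecke_relators m \<subseteq> carrier (free_algebra {1..<m})"
proof -
  interpret F: ring "free_algebra {1..<m}" by (rule ring_free_algebra)
  have g: "gen i \<in> carrier (free_algebra {1..<m})" if "i \<in> {1..<m}" for i
    using that by (simp add: carrier_free_algebra gen_def)
  have c: "cst c \<in> carrier (free_algebra {1..<m})" for c
    by (simp add: carrier_free_algebra cst_def zero_ncmon_def)
  have m: "p * q \<in> carrier (free_algebra {1..<m})" and a: "p + q \<in> carrier (free_algebra {1..<m})"
    if "p \<in> carrier (free_algebra {1..<m})" "q \<in> carrier (free_algebra {1..<m})" for p q
    using F.m_closed [OF that] F.a_closed [OF that] by simp_all
  have o: "1 \<in> carrier (free_algebra {1..<m})"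
    using F.one_closed by simp
  have d: "p - q \<in> carrier (free_algebra {1..<m})"
    if "p \<in> carrier (free_algebra {1..<m})" "q \<in> carrier (free_algebra {1..<m})" for p q
  proof -
    have "- q \<in> carrier (free_algebra {1..<m})"
      using that(2) by (simp add: carrier_free_algebra)
    from a [OF that(1) this] show ?thesis by simp
  qed
  show ?thesis
  proof
    fix p assume "p \<in> hecke_relators m"
    then consider (far) i j where "i \<in> {1..<m}" "j \<in> {1..<m}" "p = gen i * gen j - gen j * gen i"
      | (braid) i where "i \<in> {1..<m}" "i + 1 \<in> {1..<m}"
        "p = gen i * gen (i + 1) * gen i - gen (i + 1) * gen i * gen (i + 1)"
      | (hecke) i where "i \<in> {1..<m}" "p = gen i * gen i - (1 + cst (qq - inverse qq) * gen i)"
      unfolding hecke_relators_def by blast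
    then show "p \<in> carrier (free_algebra {1..<m})"
      by cases (simp_all only: d m a g c o)
  qed
qed

text \<open>The kernel of \<open>hecke_eval\<close> on the carrier is an ideal containing the
  relators, hence it contains the ideal they generate.\<close>

lemma hecke_eval_hecke_ideal:
  assumes "p \<in> hecke_ideal m"
  shows "p \<in> carrier (free_algebra {1..<m})" "hecke_eval p = (0 :: 'n::{finite,linorder} op)"
proof -
  let ?F = "free_algebra {1..<m}"
  let ?I = "{p \<in> carrier ?F. hecke_eval p = (0 :: 'n op)}"
  interpret F: ring ?F by (rule ring_free_algebra)
  have "additive_subgroup ?I ?F"
  proof (intro additive_subgroup.intro subgroup.intro)
    fix x assume x: "x \<in> ?I"
    have "a_inv ?F x \<in> carrier ?F" using x F.a_inv_closed by blast
    moreover have "x + a_inv ?F x = 0" using x F.r_neg [of x] by simp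
    then have "hecke_eval (a_inv ?F x) = (0 :: 'n op)"
      using x hecke_eval_add [of x "a_inv ?F x", where 'a = 'n] by simp
    ultimately show "m_inv (add_monoid ?F) x \<in> ?I"
      by (simp add: a_inv_def)
  qed (use F.a_closed F.zero_closed in \<open>auto simp: hecke_eval_add\<close>)
  then have "ideal ?I ?F"
    using F.m_closed
    by (intro idealI F.ring_axioms additive_subgroup.a_subgroup) (auto simp: hecke_eval_mult)
  moreover have "hecke_relators m \<subseteq> ?I"
    using hecke_relators_carrier hecke_eval_hecke_relators by blast
  ultimately have "hecke_ideal m \<subseteq> ?I"
    unfolding hecke_ideal_def by (rule F.genideal_minimal)
  with assms show "p \<in> carrier ?F" "hecke_eval p = (0 :: 'n op)" by blast+
qed

text \<open>All representatives of the coset have the same image, so \<open>the_elem\<close> is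
  applied to a singleton.\<close>

lemma hecke_rep_coset:
  assumes "p \<in> carrier (free_algebra {1..<m})"
  shows "hecke_rep m (hecke_ideal m +>\<^bsub>free_algebra {1..<m}\<^esub> p) =
      (free_rep m p :: ('n::{finite,linorder}, Cq) tmat)"
proof -
  let ?F = "free_algebra {1..<m}"
  interpret F: ring ?F by (rule ring_free_algebra)
  have C: "hecke_ideal m +>\<^bsub>?F\<^esub> p = (\<lambda>x. x + p) ` hecke_ideal m"
    by (auto simp: a_r_coset_def r_coset_def)
  have "free_rep m (x + p) = (free_rep m p :: ('n, Cq) tmat)" if "x \<in> hecke_ideal m" for x
    using hecke_eval_hecke_ideal(1) [OF that] hecke_eval_hecke_ideal(2) [OF that, where 'n =
        'n] F.a_closed [of x p] assms
    by (intro free_rep_eqI) (simp_all add: hecke_eval_add)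
  moreover have "hecke_ideal m \<noteq> {}"
    using additive_subgroup.zero_closed
        [OF ideal.axioms(1) [OF F.genideal_ideal [OF hecke_relators_carrier]]]
    by (auto simp: hecke_ideal_def)
  ultimately have "free_rep m ` (hecke_ideal m +>\<^bsub>?F\<^esub> p) = {free_rep m p :: ('n, Cq) tmat}"
    unfolding C image_image by auto
  then show ?thesis
    by (simp add: hecke_rep_def)
qed

lemma q_symmetrizer_rep_carrier: "q_symmetrizer_rep m \<in> carrier (free_algebra {1..<m})"
proof (induction m rule: q_symmetrizer_rep.induct)
  case (3 k)
  let ?F = "free_algebra {1..<Suc (Suc k)}"
  interpret F: ring ?F by (rule ring_free_algebra)
  have c: "cst c \<in> carrier ?F" for c
    by (simp add: carrier_free_algebra cst_def zero_ncmon_def)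
  have g: "gen (Suc k) \<in> carrier ?F"
    by (simp add: carrier_free_algebra gen_def)
  have h: "q_symmetrizer_rep (Suc k) \<in> carrier ?F"
    using 3 [OF refl] by (fastforce simp: carrier_free_algebra)
  have m: "p * q \<in> carrier ?F" and a: "p + q \<in> carrier ?F"
    if "p \<in> carrier ?F" "q \<in> carrier ?F" for p q
    using F.m_closed [OF that] F.a_closed [OF that] by simp_all
  show ?case
    unfolding q_symmetrizer_rep.simps Let_def diff_Suc_1 by (intro m a c g h)
qed (simp_all add: carrier_free_algebra zero_ncmon_def)

lemma hecke_eval_q_symmetrizer_rep: "hecke_eval (q_symmetrizer_rep m) = symmetrizer_op m"
proof (induction m rule: q_symmetrizer_rep.induct)
  case (3 k)
  have "2 - 2 * int (Suc (Suc k)) = - 2 * int (Suc k)" "int (Suc (Suc k)) - 1 = int (Suc k)"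
    by simp_all
  with 3 show ?case
    unfolding q_symmetrizer_rep.simps Let_def diff_Suc_1 symmetrizer_op.simps(2) [of "Suc k"]
    by (simp only: hecke_eval_mult hecke_eval_add hecke_eval_cst hecke_eval_gen diff_Suc_1 sc_mult
        mult_1_left mult_1_right mult.assoc)
qed (simp_all add: hecke_eval_one qint_1 [unfolded One_nat_def])

lemma tmat_op_q_symmetrizer: "tmat_op m (tmat_cst (hecke_rep m (q_symmetrizer m))) =
    symmetrizer_op m"
  unfolding q_symmetrizer_def hecke_rep_coset [OF q_symmetrizer_rep_carrier]
    tmat_op_free_rep [OF q_symmetrizer_rep_carrier] by (rule hecke_eval_q_symmetrizer_rep)

section \<open>Quantum complete symmetric functions\<close>

text \<open>The element s_k: the weight system at the symmetrizer with \<open>M_matrix\<close> in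
  place of \<open>L_matrix\<close>. Up to a power of q it will correspond to a complete symmetric
  polynomial.\<close>

definition qcomplete :: "nat \<Rightarrow> 'n::{finite,linorder} rea"
  where "qcomplete k = R_trace k (tmat_mult k (tmat_prod k (map (overlined k M_matrix) [1..<k + 1]))
    (tmat_cst (hecke_rep k (q_symmetrizer k))))"

lemma left_mult_qcomplete: "left_mult (qcomplete k) =
    ptraces 0 k (up overlined_M 0 k * (symmetrizer_op k :: 'n::{finite,linorder} op))"
  unfolding qcomplete_def ptraces_tmat_op [symmetric] tmat_op_mult tmat_op_overlined_prod
      tmat_op_q_symmetrizer ..

lemma qcomplete_center: "qcomplete k \<in> rea_center"
  by (rule ptraces_overlined_M_center [OF hecke_op_symmetrizer_op left_mult_qcomplete [symmetric]])

lemma power_sum_center: "power_sum (Suc k) \<in> rea_center"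
  by (rule ptraces_overlined_M_center [OF hecke_op_dn left_mult_power_sum [symmetric]]) simp

lemma qcomplete_newton:
  "rea_cst (qint (int (Suc n))) * qcomplete (Suc n) =
    (\<Sum>i\<le>n. rea_cst (qq powi (- 2 * int i) * inverse qq ^ (n - i)) *
        (qcomplete i * power_sum (Suc n - i)))"
  by (rule newton_identity) (simp_all add: left_mult_qcomplete left_mult_power_sum)

lemma qcomplete_0: "qcomplete 0 = (1 :: 'n::{finite,linorder} rea)"
proof -
  have "left_mult (qcomplete 0) = (left_mult 1 :: 'n op)"
    by (simp add: left_mult_qcomplete left_mult_hom)
  then show ?thesis by simp
qed

section \<open>Expansion of the average value\<close>

lemma L_matrix_overlined_op: "overlined_op L_matrix i = sc (1 / q_diff) (1 - overlined_M i)"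
proof (induction i)
  case 0
  have "app (on1 0 L_matrix) f s = app (sc (1 / q_diff) (1 - on1 0 M_matrix)) f s"
    for f :: "(nat \<Rightarrow> 'a) \<Rightarrow> 'a rea" and s
  proof -
    have "app (on1 0 L_matrix) f s = (\<Sum>b\<in>UNIV. rea_cst (1 / q_diff) *
        ((if b = s 0 then f (s(0 := b)) else 0) - M_matrix $ s 0 $ b * f (s(0 := b))))"
      unfolding app_on1 L_matrix_def q_diff_def
      by (intro sum.cong refl) (simp add: mat_def mult.assoc left_diff_distrib)
    then show ?thesis
      by (simp add: sum_subtractf flip: sum_distrib_left)
  qed
  then show ?case
    by (auto intro: opr_eqI)
next
  case (Suc i)
  then show ?case
    by (simp add: left_diff_distrib right_diff_distrib)
qed

lemma average_value_expansion:
  "average_value m = rea_cst ((1 / q_diff) ^ m) * (\<Sum>k\<le>m.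
    rea_cst ((- 1) ^ k * of_nat (m choose k) *
      (\<Prod>j\<in>{k..<m}. inverse qq * qint (int (CARD('n) + j)) / qint (int (Suc j)))) *
    (qcomplete k :: 'n::{finite,linorder} rea))"
proof -
  have L: "up (overlined_op L_matrix) 0 m = sc ((1 / q_diff) ^ m) (up (\<lambda>i. 1 - overlined_M i ::
      'n op) 0 m)"
    by (induction m) (simp_all add: L_matrix_overlined_op mult.commute)
  have "left_mult (average_value m) = sc ((1 / q_diff) ^ m)
      (ptraces 0 m (up overlined_M 0 0 * up (\<lambda>i. 1 - overlined_M i ::
          'n op) 0 m * symmetrizer_op m))"
    unfolding average_value_def weight_system_def ptraces_tmat_op [symmetric] tmat_op_mult
        tmat_op_overlined_prod
      tmat_op_q_symmetrizer L by (simp add: ptraces_sc)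
  also have "\<dots> = sc ((1 / q_diff) ^ m)
      (\<Sum>k\<le>m. sc ((- 1) ^ k * of_nat (m choose k))
          (ptraces 0 m (up overlined_M 0 k * (symmetrizer_op m :: 'n op))))"
    by (subst ptraces_binomial) simp_all
  also have "\<dots> = sc ((1 / q_diff) ^ m) (\<Sum>k\<le>m. sc ((- 1) ^ k * of_nat (m choose k) *
      (\<Prod>j\<in>{k..<m}. inverse qq * qint (int (CARD('n) +
          j)) / qint (int (Suc j)))) (left_mult (qcomplete k)))"
    by (intro arg_cong [of _ _ "sc _"] sum.cong refl)
        (subst ptraces_up_symmetrizer_op, simp_all add: left_mult_qcomplete)
  finally show ?thesis
    by (simp only: sc_left_mult left_mult_sum [symmetric] left_mult_inject)
qed

section \<open>Complete symmetric polynomials\<close>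

text \<open>Restricting the variables to a set \<open>A\<close> allows induction on the set of
  variables, always adding a largest one.\<close>

definition complete_sym_on :: "'n::{finite,linorder} set \<Rightarrow> nat \<Rightarrow> ('n \<Rightarrow> 'a::comm_ring_1) \<Rightarrow> 'a"
  where "complete_sym_on A k x = (\<Sum>is | length is = k \<and> sorted is \<and>
      set is \<subseteq> A. prod_list (map x is))"

lemma complete_sym_complete_sym_on: "complete_sym k x = complete_sym_on UNIV k x"
  by (simp add: complete_sym_def complete_sym_on_def)

lemma complete_sym_on_0: "complete_sym_on A 0 x = 1"
proof -
  have "{is. length is = 0 \<and> sorted is \<and> set is \<subseteq> A} = {[]}" by auto
  then show ?thesis by (simp add: complete_sym_on_def)
qed

lemma complete_sym_on_empty: "complete_sym_on {} (Suc k) x = 0"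
  unfolding complete_sym_on_def by (rule sum.neutral) auto

text \<open>A sorted list over the larger set either avoids \<open>b\<close> or ends in
  \<open>b\<close>, because \<open>b\<close> is the maximum.\<close>

lemma complete_sym_on_insert_max:
  assumes "\<And>a. a \<in> A \<Longrightarrow> a < b"
  shows "complete_sym_on (insert b A) (Suc k) x = complete_sym_on A (Suc k) x +
      complete_sym_on (insert b A) k x * x b"
proof -
  let ?L = "\<lambda>A k. {is. length is = k \<and> sorted is \<and> set is \<subseteq> A}"
  have fin: "finite (?L A k)" for A :: "'a set" and k
    by (rule finite_subset [OF _ finite_lists_of_length [of k]]) auto
  have "?L (insert b A) (Suc k) = ?L A (Suc k) \<union> (\<lambda>is. is @ [b]) ` ?L (insert b A) k"
  proof (intro equalityI subsetI)
    fix u assume u: "u \<in> ?L (insert b A) (Suc k)"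
    then have "length u = Suc k" by blast
    then obtain v c where v: "u = v @ [c]" "length v = k"
      unfolding length_Suc_conv_rev by blast
    show "u \<in> ?L A (Suc k) \<union> (\<lambda>is. is @ [b]) ` ?L (insert b A) k"
    proof (cases "c = b")
      case True
      with u v show ?thesis by (auto simp: sorted_append)
    next
      case False
      have c: "c \<in> A" using u v False by auto
      have "b \<notin> set v"
      proof
        assume "b \<in> set v"
        then have "b \<le> c" using u v by (auto simp: sorted_append)
        with assms [OF c] show False by simp
      qed
      with u v c show ?thesis by auto
    qed
  next
    fix u assume "u \<in> ?L A (Suc k) \<union> (\<lambda>is. is @ [b]) ` ?L (insert b A) k"
    then show "u \<in> ?L (insert b A) (Suc k)"
      using assms by (fastforce simp: sorted_append)
  qed
  moreover have "?L A (Suc k) \<inter> (\<lambda>is. is @ [b]) ` ?L (insert b A) k = {}"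
    using assms by fastforce
  ultimately have "complete_sym_on (insert b A) (Suc k) x = complete_sym_on A (Suc k) x +
      (\<Sum>is\<in>(\<lambda>is. is @ [b]) ` ?L (insert b A) k. prod_list (map x is))"
    unfolding complete_sym_on_def by (simp add: sum.union_disjoint fin)
  also have "(\<Sum>is\<in>(\<lambda>is. is @ [b]) ` ?L (insert b A) k. prod_list (map x is)) =
      complete_sym_on (insert b A) k x * x b"
    unfolding complete_sym_on_def sum_distrib_right by (subst sum.reindex) (auto simp: inj_on_def)
  finally show ?thesis .
qed

lemma geometric_fps: "(1 - fps_const c * fps_X) * Abs_fps (\<lambda>k. c ^ k) = (1 :: 'a::comm_ring_1 fps)"
  by (rule fps_ext) (simp add: left_diff_distrib mult.assoc power_eq_if)

text \<open>By the recursion for a new maximal variable, the factor 1 - x_b v removes that variable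
  from the generating function.\<close>

lemma complete_sym_on_fps: "Abs_fps (\<lambda>k. complete_sym_on A k x) = (\<Prod>i\<in>A. Abs_fps (\<lambda>k. x i ^ k))"
  using finite [of A]
proof (induction A rule: finite_linorder_max_induct)
  case empty
  have "complete_sym_on {} k x = (if k = 0 then 1 else 0)" for k
    by (cases k) (simp_all add: complete_sym_on_0 complete_sym_on_empty)
  then show ?case
    by (intro fps_ext) simp
next
  case (insert b A)
  let ?G = "\<lambda>A. Abs_fps (\<lambda>k. complete_sym_on A k x)"
  have "(1 - fps_const (x b) * fps_X) * ?G (insert b A) = ?G A"
  proof (rule fps_ext)
    fix k
    show "fps_nth ((1 - fps_const (x b) * fps_X) * ?G (insert b A)) k = fps_nth (?G A) k"
      using complete_sym_on_insert_max [of A b "k - 1" x] insert.hyps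
      by (cases k) (simp_all add: left_diff_distrib mult.assoc complete_sym_on_0 mult.commute)
  qed
  then have "Abs_fps (\<lambda>k. x b ^ k) * ?G A =
      ((1 - fps_const (x b) * fps_X) * Abs_fps (\<lambda>k. x b ^ k)) * ?G (insert b A)"
    by (metis mult.assoc mult.commute)
  then have "?G (insert b A) = Abs_fps (\<lambda>k. x b ^ k) * ?G A"
    by (simp add: geometric_fps)
  with insert show ?case
    by (subst prod.insert) auto
qed

lemma complete_sym_on_scale: "complete_sym_on A k (\<lambda>i. c * x i) = c ^ k * complete_sym_on A k x"
proof -
  have "prod_list (map (\<lambda>i. c * x i) is) = c ^ length is * prod_list (map x is)" for "is"
    by (induction "is") (simp_all add: mult_ac)
  then show ?thesis
    unfolding complete_sym_on_def sum_distrib_left by (intro sum.cong) auto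
qed

text \<open>Pascal's rule matches the recursion for a new maximal variable \<open>b\<close>: one
  summand gives c times the formula in degree k, the other splits into the formula without
  \<open>b\<close> and t x_b times the formula in degree k. Together they form the recursion for the
  variable c + t x_b. The induction is on the set of variables and, inside it, on the
  degree.\<close>

lemma complete_sym_on_affine:
  "complete_sym_on A k (\<lambda>i. c + t * x i) =
    (\<Sum>j\<le>k. of_nat ((card A + k - 1) choose (k - j)) * c ^ (k - j) * t ^ j * complete_sym_on A j x)"
  using finite [of A]
proof (induction A arbitrary: k rule: finite_linorder_max_induct)
  case empty
  show ?case
  proof (cases k)
    case (Suc n)
    \<comment> \<open>Without variables only \<open>j = 0\<close> could contribute, and there the
      binomial coefficient of \<open>n\<close> over \<open>Suc n\<close> vanishes.\<close>
    have "(\<Sum>j\<le>Suc n. of_nat (n choose (Suc n - j)) * c ^ (Suc n - j) * t ^ j * complete_sym_on {}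
        j x) = 0"
    proof (rule sum.neutral, rule ballI)
      fix j assume "j \<in> {..Suc n}"
      show "of_nat (n choose (Suc n - j)) * c ^ (Suc n - j) * t ^ j * complete_sym_on {} j x = 0"
        by (cases j) (simp_all add: complete_sym_on_empty binomial_eq_0)
    qed
    with Suc show ?thesis by (simp add: complete_sym_on_empty)
  qed (simp add: complete_sym_on_0)
next
  case (insert b A)
  let ?n = "card A"
  have card: "card (insert b A) = Suc ?n"
    using insert.hyps by (subst card_insert_disjoint) auto
  let ?B = "insert b A"
  define T where "T n A k j = of_nat (n + k - 1 choose (k - j)) * c ^ (k - j) * t ^ j *
      complete_sym_on A j x" for n A k j
  have "complete_sym_on ?B k (\<lambda>i. c + t * x i) = (\<Sum>j\<le>k. T (Suc ?n) ?B k j)"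
  proof (induction k)
    case 0
    then show ?case by (simp add: complete_sym_on_0 T_def)
  next
    case (Suc k)
    have "(\<Sum>j\<le>Suc k. T (Suc ?n) ?B (Suc k) j) =
        (\<Sum>j\<le>Suc k. of_nat (?n + k choose (Suc k - j)) * c ^ (Suc k - j) * t ^ j * complete_sym_on
            ?B j x) +
        (\<Sum>j\<le>k. of_nat (?n + k choose (k - j)) * c ^ (Suc k - j) * t ^ j * complete_sym_on ?B j x)"
      by (simp add: T_def Suc_diff_le algebra_simps sum.distrib)
    also have "(\<Sum>j\<le>k. of_nat (?n + k choose (k - j)) * c ^ (Suc k - j) * t ^ j * complete_sym_on
        ?B j x) =
        c * (\<Sum>j\<le>k. T (Suc ?n) ?B k j)"
      unfolding sum_distrib_left by (intro sum.cong refl) (simp add: T_def Suc_diff_le mult_ac)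
    also have "(\<Sum>j\<le>Suc k. of_nat (?n + k choose (Suc k - j)) * c ^ (Suc k - j) * t ^ j *
        complete_sym_on ?B j x) =
        (\<Sum>j\<le>Suc k. T ?n A (Suc k) j) + t * x b * (\<Sum>j\<le>k. T (Suc ?n) ?B k j)"
    proof -
      have "complete_sym_on ?B (Suc j) x = complete_sym_on A (Suc j) x +
          complete_sym_on ?B j x * x b" for j
        by (rule complete_sym_on_insert_max) (use insert.hyps in blast)
      then show ?thesis
        unfolding sum.atMost_Suc_shift
        by (simp add: T_def complete_sym_on_0 algebra_simps sum.distrib sum_distrib_left)
    qed
    also have "(\<Sum>j\<le>Suc k. T ?n A (Suc k) j) = complete_sym_on A (Suc k) (\<lambda>i. c + t * x i)"
      by (simp add: insert.IH T_def)
    finally have "(\<Sum>j\<le>Suc k. T (Suc ?n) ?B (Suc k) j) =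
        complete_sym_on A (Suc k) (\<lambda>i. c + t * x i) +
            complete_sym_on ?B k (\<lambda>i. c + t * x i) * (c + t * x b)"
      by (simp add: Suc.IH algebra_simps)
    also have "\<dots> = complete_sym_on ?B (Suc k) (\<lambda>i. c + t * x i)"
      by (rule complete_sym_on_insert_max [symmetric]) (use insert.hyps in blast)
    finally show ?case ..
  qed
  then show ?case by (simp add: card T_def)
qed

section \<open>The Harish-Chandra image of the quantum complete symmetric functions\<close>

lemma pcst_hom: "pcst (a + b) = pcst a + pcst b" "pcst (a * b) = pcst a * pcst b" "pcst 1 = 1"
  "pcst 0 = 0" "pcst (- a) = - pcst a" "pcst (a - b) = pcst a - pcst b"
  by (simp_all add: pcst_def Poly_Mapping.single_add Poly_Mapping.mult_single single_uminus
      single_diff)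

lemma pcst_power: "pcst (a ^ k) = pcst a ^ k"
  by (induction k) (simp_all add: pcst_hom)

lemma pcst_sum: "pcst (\<Sum>i\<in>A. f i) = (\<Sum>i\<in>A. pcst (f i))"
  by (rule additive_sum) (simp_all add: pcst_hom)

lemma pcst_of_nat: "pcst (of_nat n) = of_nat n"
  by (induction n) (simp_all add: pcst_hom)

lemma rea_center_closed:
  "y \<in> rea_center \<Longrightarrow> z \<in> rea_center \<Longrightarrow> y + z \<in> rea_center"
  "y \<in> rea_center \<Longrightarrow> z \<in> rea_center \<Longrightarrow> y * z \<in> rea_center"
  "z \<in> rea_center \<Longrightarrow> rea_cst c * z \<in> rea_center"
  "0 \<in> rea_center"
proof -
  show *: "y * z \<in> rea_center" if "y \<in> rea_center" "z \<in> rea_center" for y z :: "'a rea"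
    unfolding rea_center_def
    by (intro CollectI allI mult_commute_if) (use that in \<open>simp_all add: rea_center_def\<close>)
  have "rea_cst c \<in> rea_center"
    unfolding rea_center_def by (intro CollectI allI rea_cst_commute)
  then show "rea_cst c * z \<in> rea_center" if "z \<in> rea_center"
    using that by (rule *)
qed (auto simp: rea_center_def distrib_left distrib_right)

lemma rea_center_sum: "(\<And>i. i \<in> A \<Longrightarrow> z i \<in> rea_center) \<Longrightarrow> (\<Sum>i\<in>A. z i) \<in> rea_center"
  by (induction A rule: infinite_finite_induct) (simp_all add: rea_center_closed)

lemma average_value_center: "average_value m \<in> rea_center"
  unfolding average_value_expansion
  by (intro rea_center_closed rea_center_sum qcomplete_center)

context
  fixes \<Phi> :: "'n::{finite,linorder} rea \<Rightarrow> 'n xi_poly"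
  assumes \<Phi>: "quantum_Harish_Chandra \<Phi>"
begin

lemma HC_simps:
  "y \<in> rea_center \<Longrightarrow> z \<in> rea_center \<Longrightarrow> \<Phi> (y + z) = \<Phi> y + \<Phi> z"
  "y \<in> rea_center \<Longrightarrow> z \<in> rea_center \<Longrightarrow> \<Phi> (y * z) = \<Phi> y * \<Phi> z"
  "z \<in> rea_center \<Longrightarrow> \<Phi> (rea_cst c * z) = pcst c * \<Phi> z"
  "\<Phi> 1 = 1"
  using \<Phi> unfolding quantum_Harish_Chandra_def by blast+

lemma HC_zero: "\<Phi> 0 = 0"
proof -
  have "\<Phi> (0 + 0) = \<Phi> 0 + \<Phi> 0"
    by (rule HC_simps) (rule rea_center_closed)+
  then show ?thesis
    unfolding add_0 by (metis add_cancel_right_right)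
qed

lemma HC_sum: "(\<And>i. i \<in> A \<Longrightarrow> z i \<in> rea_center) \<Longrightarrow> \<Phi> (\<Sum>i\<in>A. z i) = (\<Sum>i\<in>A. \<Phi> (z i))"
proof (induction A rule: infinite_finite_induct)
  case (insert i A)
  then show ?case by (simp add: HC_simps rea_center_sum)
qed (simp_all add: HC_zero)

text \<open>With H(v) the generating function of the complete symmetric polynomials in the \<xi>_i
  and P(v) that of the images of the power sums, the Harish-Chandra identity reads 1 + (q - q^(-1))
  P(v) = H(v) / H(q^(-2) v). Clear the denominator and compare coefficients of v^(n + 1).\<close>

lemma HC_generating_identity:
  "pcst (1 - (inverse qq ^ 2) ^ Suc n) * complete_sym (Suc n) xi =
    pcst q_diff * (\<Sum>i\<le>n. pcst ((inverse qq ^ 2) ^ i) *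
        (complete_sym i xi * \<Phi> (power_sum (Suc n - i))))"
proof -
  let ?c = "pcst (inverse qq ^ 2) :: 'n xi_poly"
  let ?P = "Abs_fps (\<lambda>k. if k = 0 then 0 else \<Phi> (power_sum k))"
  let ?H = "Abs_fps (\<lambda>k. complete_sym k xi) :: 'n xi_poly fps"
  let ?H' = "Abs_fps (\<lambda>k. ?c ^ k * complete_sym k xi) :: 'n xi_poly fps"
  have H: "?H = (\<Prod>i\<in>UNIV. Abs_fps (\<lambda>k. xi i ^ k))"
    unfolding complete_sym_complete_sym_on by (rule complete_sym_on_fps)
  have H': "?H' = (\<Prod>i\<in>UNIV. Abs_fps (\<lambda>k. (?c * xi i) ^ k))"
    unfolding complete_sym_complete_sym_on complete_sym_on_scale [symmetric]
      by (rule complete_sym_on_fps)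
  have "1 + fps_const (pcst q_diff) * ?P =
      (\<Prod>i\<in>UNIV. 1 - fps_const (?c * xi i) * fps_X) * ?H"
    using \<Phi> unfolding quantum_Harish_Chandra_def H prod.distrib [symmetric] q_diff_def by blast
  then have "(1 + fps_const (pcst q_diff) * ?P) * ?H' =
      (\<Prod>i\<in>UNIV. (1 - fps_const (?c * xi i) * fps_X) * Abs_fps (\<lambda>k. (?c * xi i) ^ k)) * ?H"
    unfolding prod.distrib H' by (simp add: mult_ac)
  also have "\<dots> = ?H"
    unfolding geometric_fps by simp
  finally have "?H' + fps_const (pcst q_diff) * (?H' * ?P) = ?H"
    by (simp only: distrib_right mult_1_left mult.assoc mult.commute [of ?P ?H'])
  then have "fps_nth (?H' + fps_const (pcst q_diff) * (?H' * ?P)) (Suc n) = fps_nth ?H (Suc n)"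
    by simp
  moreover have "fps_nth (?H' * ?P) (Suc n) =
      (\<Sum>i\<le>n. ?c ^ i * (complete_sym i xi * \<Phi> (power_sum (Suc n - i))))"
    by (simp add: fps_mult_nth atLeast0AtMost mult.assoc)
  ultimately show ?thesis
    by (simp add: pcst_hom pcst_power left_diff_distrib diff_eq_eq add.commute)
qed

text \<open>Both sides are 1 in degree 0 and satisfy the same recursion, the left by
  \<open>qcomplete_newton\<close> and the right by \<open>HC_generating_identity\<close>; the
  coefficient [k]_q of the highest term can be inverted.\<close>

lemma HC_qcomplete: "\<Phi> (qcomplete k) = pcst (inverse qq ^ k) * complete_sym k xi"
proof (induction k rule: less_induct)
  case (less k)
  show ?case
  proof (cases k)
    case 0
    then show ?thesis
      by (simp add: qcomplete_0 HC_simps pcst_hom complete_sym_complete_sym_on complete_sym_on_0)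
  next
    case (Suc n)
    let ?N = "qint (int (Suc n))"
    have N: "?N \<noteq> 0" by (rule qint_nonzero) simp
    have pw: "qq powi (- 2 * int i) = (inverse qq ^ 2) ^ i" for i
    proof -
      have "qq powi (- 2 * int i) = inverse (qq powi int (2 * i))"
        by (simp only: power_int_minus [symmetric]) simp
      then show ?thesis
        unfolding power_int_of_nat power_mult power_inverse .
    qed
    have "pcst ?N * \<Phi> (qcomplete (Suc n)) = \<Phi> (rea_cst ?N * qcomplete (Suc n))"
      by (simp add: HC_simps qcomplete_center)
    also have "\<dots> = (\<Sum>i\<le>n. pcst (qq powi (- 2 * int i) * inverse qq ^ (n - i)) *
        (\<Phi> (qcomplete i) * \<Phi> (power_sum (Suc n - i))))"
      unfolding qcomplete_newton
      by (simp add: HC_sum HC_simps rea_center_closed qcomplete_center power_sum_center Suc_diff_le)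
    \<comment> \<open>The exponents -(n - i) from the Newton identity and -i from the induction
      hypothesis add up to -n, independently of \<open>i\<close>.\<close>
    also have "\<dots> = (\<Sum>i\<le>n. pcst (inverse qq ^ n) * (pcst ((inverse qq ^ 2) ^ i) *
        (complete_sym i xi * \<Phi> (power_sum (Suc n - i)))))"
    proof (intro sum.cong refl)
      fix i assume "i \<in> {..n}"
      then have "inverse qq ^ n = inverse qq ^ (n - i) * inverse qq ^ i"
        by (simp add: power_add [symmetric])
      then show "pcst (qq powi (- 2 * int i) * inverse qq ^ (n - i)) *
          (\<Phi> (qcomplete i) * \<Phi> (power_sum (Suc n - i))) =
        pcst (inverse qq ^ n) *
            (pcst ((inverse qq ^ 2) ^ i) * (complete_sym i xi * \<Phi> (power_sum (Suc n - i))))"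
        using \<open>i \<in> {..n}\<close> Suc less by (simp only: pw pcst_hom) (simp add: mult_ac)
    qed
    also have "\<dots> = pcst (inverse qq ^ n * (1 / q_diff)) *
        (pcst q_diff * (\<Sum>i\<le>n. pcst ((inverse qq ^ 2) ^ i) *
        (complete_sym i xi * \<Phi> (power_sum (Suc n - i)))))"
    proof -
      have "pcst (a * (1 / q_diff)) * (pcst q_diff * X) = pcst a * X" for a and X :: "'n xi_poly"
        by (simp add: mult.assoc [symmetric] pcst_hom(2) [symmetric])
      then show ?thesis
        by (simp only: sum_distrib_left)
    qed
    also have "\<dots> = pcst (inverse qq ^ n * (1 / q_diff) * (1 - (inverse qq ^ 2) ^ Suc n)) *
        complete_sym (Suc n) xi"
      unfolding HC_generating_identity [symmetric] by (simp only: mult.assoc pcst_hom(2))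
    also have "inverse qq ^ n * (1 / q_diff) * (1 - (inverse qq ^ 2) ^ Suc n) =
        ?N * inverse qq ^ Suc n"
    proof -
      have "qint a * (1 - qq powi - 2) = 1 - qq powi (- 2 * a)" for a
        using q_diff_nonzero unfolding q_diff_eq by (simp add: qint_def)
      then have *: "1 - (inverse qq ^ 2) ^ Suc n = ?N * (1 - qq powi - 2)"
        by (simp only: pw [symmetric])
      obtain Y where Y: "1 - qq powi - 2 = Y" "q_diff = qq * Y" "Y \<noteq> 0"
        using q_diff_nonzero q_diff_eq by force
      show ?thesis
        unfolding * Y(1,2) using Y(3) by (simp add: field_simps)
    qed
    \<comment> \<open>In the polynomial ring, [n + 1]_q is cancelled by multiplying with the
      constant polynomial of its inverse.\<close>
    finally have "pcst (1 / ?N) * (pcst ?N * \<Phi> (qcomplete (Suc n))) =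
        pcst (1 / ?N) * (pcst (?N * inverse qq ^ Suc n) * complete_sym (Suc n) xi)"
      by simp
    then show ?thesis
      using N unfolding Suc mult.assoc [symmetric] pcst_hom(2) [symmetric]
        by (simp add: pcst_hom(3) del: power_Suc)
  qed
qed

lemma HC_average_value:
  "\<Phi> (average_value m) = (\<Sum>k\<le>m. pcst ((1 / q_diff) ^ m * ((- 1) ^ k * of_nat (m choose k) *
      (\<Prod>j\<in>{k..<m}. inverse qq * qint (int (CARD('n) + j)) / qint (int (Suc j))) * inverse qq ^ k)) *
    complete_sym k xi)"
  unfolding average_value_expansion
  by (simp add: HC_simps HC_sum rea_center_closed rea_center_sum qcomplete_center HC_qcomplete
      sum_distrib_left pcst_hom(2) mult.assoc)

end

text \<open>Solving the definition of \<open>x_var\<close> for \<open>xi\<close> gives \<xi>_i =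
  q^(1 - N) + (1 - q^2) x_i, to which \<open>complete_sym_on_affine\<close> applies.\<close>

lemma complete_sym_xi:
  "complete_sym k (xi :: 'n::{finite,linorder} \<Rightarrow> 'n xi_poly) =
    (\<Sum>j\<le>k. pcst (of_nat ((CARD('n) + k - 1) choose (k - j)) *
      (qq powi (1 - int CARD('n))) ^ (k - j) * (1 - qq ^ 2) ^ j) * complete_sym j x_var)"
proof -
  have q: "qq ^ 2 - 1 \<noteq> 0"
    using qq_power_neq_1 [of 2] by simp
  have "xi i = pcst (qq powi (1 - int CARD('n))) + pcst (1 - qq ^ 2) * x_var i" for i :: 'n
  proof -
    have "(1 - qq ^ 2) * (1 / (qq ^ 2 - 1)) = - 1"
      using q by (simp add: field_simps)
    then have "pcst (1 - qq ^ 2) * pcst (1 / (qq ^ 2 - 1)) = (- 1 :: 'n xi_poly)"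
      unfolding pcst_hom(2) [symmetric] by (simp only: pcst_hom)
    then show ?thesis
      by (simp add: x_var_def flip: mult.assoc)
  qed
  then have xi: "(xi :: 'n \<Rightarrow> 'n xi_poly) =
      (\<lambda>i. pcst (qq powi (1 - int CARD('n))) + pcst (1 - qq ^ 2) * x_var i)"
    by blast
  show ?thesis
    unfolding complete_sym_complete_sym_on
    by (subst xi) (simp add: complete_sym_on_affine pcst_hom pcst_power pcst_of_nat mult.assoc)
qed

section \<open>The coefficients\<close>

lemma of_nat_nonzero: "n > 0 \<Longrightarrow> of_nat n \<noteq> (0 :: Cq)"
proof -
  have "of_nat n = Fract (of_nat n :: complex poly) 1" for n
    by (induction n) (simp_all add: Zero_fract_def One_fract_def add.commute)
  then show "n > 0 \<Longrightarrow> of_nat n \<noteq> (0 :: Cq)"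
    by (simp add: Zero_fract_def eq_fract)
qed

lemma falling_fact: "falling (int (n + k)) k * of_nat (fact n) = of_nat (fact (n + k))"
proof (induction k)
  case 0
  then show ?case by (simp add: falling_def)
next
  case (Suc k)
  have "falling (int (n + Suc k)) (Suc k) = of_nat (n + Suc k) * falling (int (n + k)) k"
    unfolding falling_def prod.lessThan_Suc_shift by (simp add: algebra_simps)
  with Suc show ?case
    by (simp add: mult.assoc) (simp add: algebra_simps)
qed

lemma qfalling_qfact: "qfalling (int (n + k)) k * qfact n = qfact (n + k)"
proof (induction k)
  case 0
  then show ?case by (simp add: qfalling_def)
next
  case (Suc k)
  have "qfalling (int (n + Suc k)) (Suc k) = qint (int (n + Suc k)) * qfalling (int (n + k)) k"
    unfolding qfalling_def prod.lessThan_Suc_shift by (simp add: algebra_simps)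
  moreover have "qfact (n + Suc k) = qfact (n + k) * qint (int (n + Suc k))"
    by (simp add: qfact_def)
  ultimately have "qfalling (int (n + Suc k)) (Suc k) * qfact n =
      (qfalling (int (n + k)) k * qfact n) * qint (int (n + Suc k))"
    and *: "qfact (n + Suc k) = qfact (n + k) * qint (int (n + Suc k))"
    by (simp_all only: mult_ac)
  then show ?case
    unfolding * Suc by simp
qed

lemma qfact_nonzero: "qfact n \<noteq> 0"
proof -
  have "qint (int j) \<noteq> 0" if "j \<in> {1..n}" for j
    using that by (intro qint_nonzero) simp
  then show ?thesis
    unfolding qfact_def by (simp add: prod_zero_iff)
qed

lemma fact_nonzero_Cq: "of_nat (fact n) \<noteq> (0 :: Cq)"
  by (rule of_nat_nonzero) simp

lemma qint_prod:
  assumes "k \<le> m"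
  shows "(\<Prod>j\<in>{k..<m}. inverse qq * qint (int (Suc \<nu> + j)) / qint (int (Suc j))) =
    inverse qq ^ (m - k) * (qfact (\<nu> + m) * qfact k) / (qfact (\<nu> + k) * qfact m)"
  using assms
proof (induction m rule: dec_induct)
  case base
  then show ?case by (simp add: qfact_nonzero)
next
  case (step m)
  have q: "qfact (\<nu> + Suc m) = qfact (\<nu> + m) * qint (int (Suc \<nu> + m))" "qfact (Suc m) =
      qfact m * qint (int (Suc m))"
    by (simp_all add: qfact_def)
  show ?case
    unfolding prod.atLeastLessThan_Suc [OF step.hyps(1)] step.IH q Suc_diff_le [OF step.hyps(1)]
    by (simp only: times_divide_times_eq power_Suc mult_ac)
qed

text \<open>Rearranged so that the dependence on \<open>k\<close> sits in the binomial coefficient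
  of m - j over k - j and in (\<nu> + k)! / k!, the ordinary part of a summand of the q-Bernoulli
  polynomial.\<close>

lemma binomial_product:
  assumes "j \<le> k" "k \<le> m"
  shows "(of_nat (m choose k) * of_nat ((\<nu> + k) choose (k - j)) :: Cq) =
    of_nat (fact m) / (of_nat (fact (\<nu> + j)) * of_nat (fact (m - j))) *
      (of_nat ((m - j) choose (k - j)) * (of_nat (fact (\<nu> + k)) / of_nat (fact k)))"
proof -
  have 1: "of_nat (m choose k) = of_nat (fact m) / (of_nat (fact k) * (of_nat (fact (m - k)) ::
      Cq))"
    and 2: "of_nat ((\<nu> + k) choose (k - j)) =
      of_nat (fact (\<nu> + k)) / (of_nat (fact (k - j)) * (of_nat (fact (\<nu> + j)) :: Cq))"
    and 3: "of_nat ((m - j) choose (k - j)) =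
      of_nat (fact (m - j)) / (of_nat (fact (k - j)) * (of_nat (fact (m - k)) :: Cq))"
  proof -
    have b: "of_nat (n choose i) = of_nat (fact n) / (of_nat (fact i) * (of_nat (fact (n - i)) ::
        Cq))"
      if "i \<le> n" for n i
    proof -
      have "of_nat (fact i) * of_nat (fact (n - i)) * of_nat (n choose i) = (of_nat (fact n) :: Cq)"
        by (simp only: of_nat_mult [symmetric] binomial_fact_lemma [OF that])
      then show ?thesis
        using fact_nonzero_Cq by (simp add: field_simps)
    qed
    show "of_nat (m choose k) = of_nat (fact m) / (of_nat (fact k) * (of_nat (fact (m - k)) :: Cq))"
      using assms by (intro b)
    have "\<nu> + k - (k - j) = \<nu> + j" "m - j - (k - j) = m - k" using assms by simp_all
    with b [of "k - j" "\<nu> + k"] b [of "k - j" "m - j"] assms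
    show "of_nat ((\<nu> + k) choose (k - j)) =
      of_nat (fact (\<nu> + k)) / (of_nat (fact (k - j)) * (of_nat (fact (\<nu> + j)) :: Cq))"
      "of_nat ((m - j) choose (k - j)) =
      of_nat (fact (m - j)) / (of_nat (fact (k - j)) * (of_nat (fact (m - k)) :: Cq))"
      by (simp_all add: diff_le_mono)
  qed
  show ?thesis
    unfolding 1 2 3 using fact_nonzero_Cq by (simp add: field_simps)
qed

text \<open>Collects what the degrees k = j, ..., m in the \<xi>_i contribute to degree
  \<open>j\<close> in the x_i; with l = m - j the sum over k - j becomes the defining sum of the
  q-Bernoulli polynomial.\<close>

lemma coefficient_identity:
  assumes "j \<le> m"
  defines "l \<equiv> m - j"
  shows "(\<Sum>k=j..m. (1 / q_diff) ^ m * ((- 1) ^ k * of_nat (m choose k) *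
      (\<Prod>i\<in>{k..<m}. inverse qq * qint (int (Suc \<nu> + i)) / qint (int (Suc i))) * inverse qq ^ k) *
      (of_nat ((\<nu> + k) choose (k - j)) * (qq powi (- int \<nu>)) ^ (k - j) * (1 - qq ^ 2) ^ j)) =
    of_nat (fact m) / of_nat (fact (\<nu> + m)) * (qfact (\<nu> + m) / qfact m) *
      (falling (int (\<nu> + m)) l / (qq ^ (2 * l) * of_nat (fact l)) *
        qbernoulli l (int (\<nu> + m - l)) \<nu> (of_nat \<nu> / 2))"
proof -
  \<comment> \<open>q^2 - 1 arises as q (q - q^(-1)): the m factors q^(-1) / (q - q^(-1)) give
    a^(-m), (1 - q^2)^j gives a^j up to sign, and the remaining a^(-l) is q^(-2l) (1 -
    q^(-2))^(-l).\<close>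
  define a where "a = qq ^ 2 - 1"
  have a: "a \<noteq> 0"
    using qq_power_neq_1 [of 2] by (simp add: a_def)
  have qka: "inverse qq * (1 / q_diff) = 1 / a"
    by (simp add: q_diff_def a_def field_simps power2_eq_square)
  have q2: "qq ^ (2 * l) * (1 - qq powi (- 2)) ^ l = a ^ l"
  proof -
    have "qq ^ 2 * (1 - qq powi (- 2)) = a"
      by (simp add: a_def right_diff_distrib power_int_minus)
    then show ?thesis
      by (simp add: power_mult flip: power_mult_distrib)
  qed
  have ml: "m = j + l" "\<nu> + m - l = \<nu> + j"
    using assms by simp_all
  have fall: "falling (int (\<nu> + m)) l = of_nat (fact (\<nu> + m)) / of_nat (fact (\<nu> + j))"
    using falling_fact [of "\<nu> + j" l] fact_nonzero_Cq by (simp add: ml(1) field_simps)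
  \<comment> \<open>\<open>?b k\<close> is the summand i = k - j of the q-Bernoulli polynomial;
    there i + h = \<nu> + k, since h = \<nu> + m - l = \<nu> + j.\<close>
  let ?b = "\<lambda>k. of_nat (l choose (k - j)) * (of_nat (fact (\<nu> + k)) / of_nat (fact k)) *
    (qfact k / qfact (\<nu> + k)) * (- (qq powi (- int \<nu>))) ^ (k - j)"
  have floor: "\<lfloor>- 2 * (of_nat \<nu> / 2 :: rat)\<rfloor> = - int \<nu>"
  proof -
    have "- 2 * (of_nat \<nu> / 2) = (of_int (- int \<nu>) :: rat)"
      by simp
    then show ?thesis
      by (simp only: floor_of_int)
  qed
  have bern: "qbernoulli l (int (\<nu> + m - l)) \<nu> (of_nat \<nu> / 2) =
      1 / (1 - qq powi (- 2)) ^ l * (\<Sum>k=j..m. ?b k)"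
  proof -
    have "(\<Sum>k=j..m. ?b k) = (\<Sum>i=0..l. ?b (i + j))"
      using sum.shift_bounds_cl_nat_ivl [of ?b 0 j l] by (simp add: ml(1) add.commute)
    also have "\<dots> = (\<Sum>i=0..l. of_nat (l choose i) *
        (falling (int i + int (\<nu> + m - l)) \<nu> / qfalling (int i + int (\<nu> + m - l)) \<nu>) *
        (- (qq powi (- int \<nu>))) ^ i)"
    proof (intro sum.cong refl)
      fix i
      have e: "int i + int (\<nu> + m - l) = int (i + j + \<nu>)"
        by (simp add: ml(2))
      have "falling (int (i + j + \<nu>)) \<nu> = of_nat (fact (\<nu> + (i + j))) / of_nat (fact (i + j))"
        using falling_fact [of "i + j" \<nu>] fact_nonzero_Cq by (simp add: field_simps add_ac)
      moreover have "qfalling (int (i + j + \<nu>)) \<nu> = qfact (\<nu> + (i + j)) / qfact (i + j)"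
        using qfalling_qfact [of "i + j" \<nu>] qfact_nonzero [of "i + j"]
        by (simp only: add.commute [of \<nu>] nonzero_eq_divide_eq not_False_eq_True)
      ultimately show "?b (i + j) = of_nat (l choose i) *
        (falling (int i + int (\<nu> + m - l)) \<nu> / qfalling (int i + int (\<nu> + m - l)) \<nu>) *
        (- (qq powi (- int \<nu>))) ^ i"
        unfolding e by (simp only: add_diff_cancel_right' divide_divide_eq_right
            divide_divide_eq_left
            times_divide_eq_right times_divide_eq_left mult_ac)
    qed
    finally show ?thesis
      unfolding qbernoulli_def floor by simp
  qed
  have "(1 / q_diff) ^ m * ((- 1) ^ k * of_nat (m choose k) *
      (\<Prod>i\<in>{k..<m}. inverse qq * qint (int (Suc \<nu> + i)) / qint (int (Suc i))) * inverse qq ^ k) *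
      (of_nat ((\<nu> + k) choose (k - j)) * (qq powi (- int \<nu>)) ^ (k - j) * (1 - qq ^ 2) ^ j) =
      of_nat (fact m) / (of_nat (fact (\<nu> + j)) * of_nat (fact l)) * (qfact (\<nu> +
          m) / qfact m) * (1 / a ^ l) * ?b k"
    if "k \<in> {j..m}" for k
  proof -
    define i where "i = k - j"
    have k: "k = j + i" "j \<le> k" "k \<le> m" using that by (simp_all add: i_def)
    have A: "(1 / q_diff) ^ m * (inverse qq ^ (m - k) * inverse qq ^ k) = (1 / a) ^ m"
    proof -
      have "inverse qq ^ (m - k) * inverse qq ^ k = inverse qq ^ m"
        using k(3) by (simp flip: power_add)
      then show ?thesis
        by (simp only: power_mult_distrib [symmetric] mult.commute [of "1 / q_diff"] qka)
    qed
    have B: "(1 / a) ^ m * ((- 1) ^ k * (1 - qq ^ 2) ^ j) = (- 1) ^ i * (1 / a ^ l)"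
    proof -
      have "1 - qq ^ 2 = - 1 * a" by (simp add: a_def)
      then have "(1 - qq ^ 2) ^ j = (- 1) ^ j * a ^ j"
        by (simp only: power_mult_distrib)
      moreover have "(- 1) ^ k * (- 1) ^ j = ((- 1) ^ i :: Cq)"
        by (simp add: k(1) power_add mult_ac flip: power_mult_distrib)
      moreover have "(1 / a) ^ m * a ^ j = 1 / a ^ l"
        using a by (simp add: ml(1) power_add power_one_over)
      ultimately show ?thesis
        by (metis (no_types, lifting) mult.assoc mult.left_commute)
    qed
    have C: "(- (qq powi (- int \<nu>))) ^ (k - j) = (- 1) ^ i * (qq powi (- int \<nu>)) ^ (k - j)"
      by (simp add: i_def power_minus [of "qq powi (- int \<nu>)"])
    let ?Q = "qfact (\<nu> + m) * qfact k / (qfact (\<nu> + k) * qfact m)"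
    let ?p = "(qq powi (- int \<nu>)) ^ (k - j)"
    have P: "(\<Prod>i\<in>{k..<m}. inverse qq * qint (int (Suc \<nu> + i)) / qint (int (Suc i))) =
        inverse qq ^ (m - k) * ?Q"
      unfolding qint_prod [OF k(3)] by (rule times_divide_eq_right [symmetric])
    have "(1 / q_diff) ^ m * ((- 1) ^ k * of_nat (m choose k) *
      (\<Prod>i\<in>{k..<m}. inverse qq * qint (int (Suc \<nu> + i)) / qint (int (Suc i))) * inverse qq ^ k) *
      (of_nat ((\<nu> + k) choose (k - j)) * ?p * (1 - qq ^ 2) ^ j) =
      ((1 / q_diff) ^ m * (inverse qq ^ (m - k) * inverse qq ^ k)) *
          ((- 1) ^ k * (1 - qq ^ 2) ^ j) *
      (of_nat (m choose k) * of_nat ((\<nu> + k) choose (k - j))) * ?Q * ?p"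
      unfolding P by (simp only: mult_ac)
    also have "\<dots> = (- 1) ^ i * (1 / a ^ l) * (of_nat (m choose k) * of_nat ((\<nu> +
        k) choose (k - j))) * ?Q * ?p"
      unfolding A B ..
    also have "\<dots> = of_nat (fact m) / (of_nat (fact (\<nu> + j)) * of_nat (fact l)) *
        (qfact (\<nu> + m) / qfact m) * (1 / a ^ l) * ?b k"
      unfolding binomial_product [OF k(2,3)] C l_def
      by (simp only: times_divide_eq_right times_divide_eq_left divide_divide_eq_left mult_ac)
    finally show ?thesis .
  qed
  then have "(\<Sum>k=j..m. (1 / q_diff) ^ m * ((- 1) ^ k * of_nat (m choose k) *
      (\<Prod>i\<in>{k..<m}. inverse qq * qint (int (Suc \<nu> + i)) / qint (int (Suc i))) * inverse qq ^ k) *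
      (of_nat ((\<nu> + k) choose (k - j)) * (qq powi (- int \<nu>)) ^ (k - j) * (1 - qq ^ 2) ^ j)) =
      of_nat (fact m) / (of_nat (fact (\<nu> + j)) * of_nat (fact l)) * (qfact (\<nu> +
          m) / qfact m) * (1 / a ^ l) *
      (\<Sum>k=j..m. ?b k)"
    unfolding sum_distrib_left by (intro sum.cong refl)
  also have "\<dots> = of_nat (fact m) / of_nat (fact (\<nu> + m)) * (qfact (\<nu> + m) / qfact m) *
      (falling (int (\<nu> + m)) l / (qq ^ (2 * l) * of_nat (fact l)) *
        qbernoulli l (int (\<nu> + m - l)) \<nu> (of_nat \<nu> / 2))"
    unfolding bern fall q2 [symmetric] using fact_nonzero_Cq [of "\<nu> + m"] by (simp add: mult_ac)
  finally show ?thesis .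
qed

theorem corollary27:
  fixes \<Phi> :: "'n::{finite,linorder} rea \<Rightarrow> 'n xi_poly"
    and N \<nu> m :: nat
  assumes "quantum_Harish_Chandra \<Phi>"
    and "N = CARD('n)" and "N \<ge> 1" and "\<nu> = N - 1" and "m \<ge> 1"
  shows "average_value m \<in> (rea_center :: 'n rea set) \<and>
    \<Phi> (average_value m) =
      pcst (of_nat (fact m) / of_nat (fact (\<nu> + m)) * (qfact (\<nu> + m) / qfact m)) *
      (\<Sum>l = 0..m.
        pcst (falling (int (\<nu> + m)) l / (qq ^ (2 * l) * of_nat (fact l)) *
              qbernoulli l (int (\<nu> + m - l)) \<nu> (of_nat \<nu> / 2)) *
        complete_sym (m - l) x_var)"
proof
  show "average_value m \<in> (rea_center :: 'n rea set)"
    by (rule average_value_center)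
  have N: "CARD('n) = Suc \<nu>"
    using assms by simp
  define c where "c k = (1 / q_diff) ^ m * ((- 1) ^ k * of_nat (m choose k) *
    (\<Prod>i\<in>{k..<m}. inverse qq * qint (int (Suc \<nu> + i)) / qint (int (Suc i))) * inverse qq ^ k)" for k
  define d where "d k j = of_nat ((\<nu> + k) choose (k - j)) * (qq powi (- int \<nu>)) ^ (k - j) *
      (1 - qq ^ 2) ^ j" for k j
  define C where "C = of_nat (fact m) / of_nat (fact (\<nu> + m)) * (qfact (\<nu> + m) / qfact m)"
  define D where "D l = falling (int (\<nu> + m)) l / (qq ^ (2 * l) * of_nat (fact l)) *
    qbernoulli l (int (\<nu> + m - l)) \<nu> (of_nat \<nu> / 2)" for l
  let ?S = "\<lambda>j. complete_sym j x_var :: 'n xi_poly"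
  have "\<Phi> (average_value m) = (\<Sum>k\<le>m. pcst (c k) * (\<Sum>j\<le>k. pcst (d k j) * ?S j))"
    unfolding HC_average_value [OF assms(1)] complete_sym_xi N c_def d_def by simp
  also have "\<dots> = (\<Sum>k\<le>m. \<Sum>j\<le>k. pcst (c k * d k j) * ?S j)"
    by (simp add: sum_distrib_left pcst_hom mult.assoc)
  \<comment> \<open>Exchanging the sums collects the coefficient of each complete symmetric
    polynomial in the x_i, as \<open>coefficient_identity\<close> evaluates it.\<close>
  also have "\<dots> = (\<Sum>j\<le>m. \<Sum>k=j..m. pcst (c k * d k j) * ?S j)"
    by (simp add: sum.Sigma) (rule sum.reindex_bij_witness [of _ prod.swap prod.swap], auto)
  also have "\<dots> = (\<Sum>j\<le>m. pcst (\<Sum>k=j..m. c k * d k j) * ?S j)"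
    by (simp add: pcst_sum sum_distrib_right)
  also have "\<dots> = (\<Sum>j\<le>m. pcst (C * D (m - j)) * ?S j)"
    unfolding c_def d_def C_def D_def by (intro sum.cong refl)
        (subst coefficient_identity, simp_all)
  also have "\<dots> = (\<Sum>l\<le>m. pcst (C * D l) * ?S (m - l))"
    by (rule sum.reindex_bij_witness [of _ "\<lambda>l. m - l" "\<lambda>l. m - l"]) auto
  also have "\<dots> = pcst C * (\<Sum>l=0..m. pcst (D l) * ?S (m - l))"
    by (simp add: sum_distrib_left pcst_hom mult.assoc atLeast0AtMost)
  finally show "\<Phi> (average_value m) =
      pcst (of_nat (fact m) / of_nat (fact (\<nu> + m)) * (qfact (\<nu> + m) / qfact m)) *
      (\<Sum>l = 0..m.
        pcst (falling (int (\<nu> + m)) l / (qq ^ (2 * l) * of_nat (fact l)) *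
              qbernoulli l (int (\<nu> + m - l)) \<nu> (of_nat \<nu> / 2)) *
        complete_sym (m - l) x_var)"
    unfolding C_def D_def .
qed

end
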